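(* Let $X$ be a differentiable manifold, $G$ a finite dimensional connected Lie group, and let $(x_t,g_t)_{t\ge 0}$ be a diffusion process with values in $X\times G$, with infinite lifetime and infinitesimal generator $\mathcal L$, satisfying the Dévissage, Convergence, Equivariance and Regularity conditions (all four are stated in the context). Let $g_\infty$ denote the almost sure limit of $g_t$ as $t\to+\infty$. Then, for every starting point $(x,g)\in X\times G$, the invariant sigma field $\mathrm{Inv}((x_t,g_t)_{t\ge 0})$ coincides, up to $\mathbb P_{(x,g)}$-negligible sets, with $$\mathrm{Inv}((x_t)_{t\ge 0})\vee\sigma(g_\infty).$$
   Context: Setting. The process $(x_t,g_t)_{t\ge0}$ is realized as the coordinate process on the path space $\Omega=C(\mathbb R^+,X\times G)$ with its Borel sigma field; $\mathbb P_{(x,g)}$ is the law of the diffusion started from $(x,g)$ and $\mathbb E_{(x,g)}$ the expectation. As usual, a diffusion with generator $\mathcal L$ (acting on $C^\infty(X\times G,\mathbb R)$) means that $(\mathbb P_{(x,g)})$ is a strong Markov family of laws on continuous paths, $\mathbb P_{(x,g)}$ being the unique solution of the martingale problem for $\mathcal L$ (with smooth compactly supported test functions) started at $(x,g)$. Invariant sigma field. Let $\theta_s\omega=(\omega_{t+s})_{t\ge0}$ be the shift operators and $\mathcal F^\infty=\bigcap_{t\ge0}\sigma((x_s,g_s),\,s\ge t)$ the tail sigma field. Then $\mathrm{Inv}((x_t,g_t)_{t\ge0})$ is the sigma field of all $A\in\mathcal F^\infty$ such that $\theta_s^{-1}A=A$ for all $s>0$. $\mathrm{Inv}((x_t)_{t\ge0})$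 is defined in the same way from the process $(x_t)_{t\ge 0}$ alone. A sigma field is trivial for $\mathbb P$ if all its events have $\mathbb P$-probability $0$ or $1$. Action of $G$. For $g\in G$ and $f\in C^\infty(X\times G,\mathbb R)$, $(g\cdot f)(x,h):=f(x,gh)$. Harmonic functions. A bounded measurable $H:X\times G\to\mathbb R$ is $\mathcal L$-harmonic if $H(x,g)=\mathbb E_{(x,g)}[H(x_t,g_t)]$ for all $t\ge 0$ and all $(x,g)$; equivalently $H(x,g)=\mathbb E_{(x,g)}[Z]$ for some bounded shift-invariant $\mathrm{Inv}((x_t,g_t)_{t\ge0})$-measurable $Z$. Conditions. - Dévissage condition: $(x_t)_{t\ge0}$ is itself a diffusion (a sub-diffusion of the full process) on $X$. Its own invariant sigma field $\mathrm{Inv}((x_t)_{t\ge0})$ is either trivial, or generated (up to negligible sets) by a random variable $\ell_\infty$ with values in a separable (i.e. countably generated) measure space $(S,\mathcal G,\lambda)$, with $\lambda$ a probability measure, and the law of $\ell_\infty$ (under each starting point) is absolutely continuous with respect to $\lambda$. - Convergence condition: for every $(x,g)\in X\times G$, $g_t$ converges $\mathbb P_{(x,g)}$-almost surely as $t\to\infty$ to a random variable $g_\infty$ in $G$. - Equivariance condition: $\mathcal L(g\cdot f)=g\cdot(\mathcal Lf)$ for all $g\in G$ and $f\in C^\infty(X\times G,\mathbb R)$. - Regularity condition: ($\bf$ bounded) $\mathcal L$-harmonic functions are continuous on $X\times G$. *)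

theory Defs
  imports "HOL-Probability.Probability" "HOL-Algebra.Group"
begin

section \<open>Smooth manifolds and Lie groups\<close>

text \<open>
  Every type of class \<^class>\<open>euclidean_space\<close> has dimension at least 1.  In order not to lose the
  manifolds of dimension 0, charts take their values in a linear subspace \<open>V\<close> of such a
  type; every dimension occurs as \<open>dim V\<close>.  All notions of openness and differentiability
  are relative to \<open>V\<close>.

  \<open>Ck_on k V S f\<close>: on the relatively open subset \<open>S\<close> of \<open>V\<close>, all iterated directional derivatives
  of \<open>f\<close> of order at most \<open>k\<close> along \<open>V\<close> exist and are continuous.
\<close>

primrec Ck_on ::
    "nat \<Rightarrow> 'e::euclidean_space set \<Rightarrow> 'e set \<Rightarrow> ('e \<Rightarrow> 'f::real_normed_vector) \<Rightarrow> bool" where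
  "Ck_on 0 V S f \<longleftrightarrow> continuous_on S f"
| "Ck_on (Suc k) V S f \<longleftrightarrow> continuous_on S f \<and>
     (\<forall>v\<in>V. \<exists>f'. (\<forall>x\<in>S. ((\<lambda>t. f (x + t *\<^sub>R v)) has_vector_derivative f' x) (at 0)) \<and>
                 Ck_on k V S f')"

definition smooth_rel ::
    "'e::euclidean_space set \<Rightarrow> 'e set \<Rightarrow> ('e \<Rightarrow> 'f::real_normed_vector) \<Rightarrow> bool" where
  "smooth_rel V S f \<longleftrightarrow> (\<forall>k. Ck_on k V S f)"

text \<open>A chart is a pair of its domain and its coordinate map, which is only relevant on the domain.\<close>

record ('x, 'e) manifold =
  model_space :: "'e set"
  atlas :: "('x set \<times> ('x \<Rightarrow> 'e)) set"

definition smooth_manifold ::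
    "('x::{second_countable_topology,t2_space}, 'e::euclidean_space) manifold \<Rightarrow> bool" where
  "smooth_manifold M \<longleftrightarrow>
     subspace (model_space M) \<and>
     (\<Union>(U, \<phi>)\<in>atlas M. U) = UNIV \<and>
     (\<forall>(U, \<phi>)\<in>atlas M.
        open U \<and> openin (top_of_set (model_space M)) (\<phi> ` U) \<and>
        homeomorphism U (\<phi> ` U) \<phi> (inv_into U \<phi>)) \<and>
     (\<forall>(U, \<phi>)\<in>atlas M. \<forall>(U', \<psi>)\<in>atlas M.
        smooth_rel (model_space M) (\<phi> ` (U \<inter> U')) (\<psi> \<circ> inv_into U \<phi>))"

definition smooth_function ::
    "('x::topological_space, 'e::euclidean_space) manifold \<Rightarrow> ('x \<Rightarrow> real) \<Rightarrow> bool" where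
  "smooth_function M f \<longleftrightarrow>
     (\<forall>(U, \<phi>)\<in>atlas M. smooth_rel (model_space M) (\<phi> ` U) (f \<circ> inv_into U \<phi>))"

definition smooth_map ::
    "('x::topological_space, 'e::euclidean_space) manifold \<Rightarrow>
     ('y::topological_space, 'f::euclidean_space) manifold \<Rightarrow> ('x \<Rightarrow> 'y) \<Rightarrow> bool" where
  "smooth_map M N F \<longleftrightarrow>
     continuous_on UNIV F \<and>
     (\<forall>(U, \<phi>)\<in>atlas M. \<forall>(U', \<psi>)\<in>atlas N.
        smooth_rel (model_space M) (\<phi> ` (U \<inter> F -` U')) (\<psi> \<circ> F \<circ> inv_into U \<phi>))"

definition product_manifold ::
    "('x, 'e) manifold \<Rightarrow> ('y, 'f) manifold \<Rightarrow> ('x \<times> 'y, 'e \<times> 'f) manifold" where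
  "product_manifold M N =
     \<lparr>model_space = model_space M \<times> model_space N,
      atlas = {(U \<times> U', map_prod \<phi> \<psi>) | U \<phi> U' \<psi>. (U, \<phi>) \<in> atlas M \<and> (U', \<psi>) \<in> atlas N}\<rparr>"

definition lie_group ::
    "'g monoid \<Rightarrow> ('g::{second_countable_topology,t2_space}, 'e::euclidean_space) manifold \<Rightarrow> bool"
  where
  "lie_group G M \<longleftrightarrow>
     group G \<and> carrier G = UNIV \<and> smooth_manifold M \<and>
     smooth_map (product_manifold M M) M (\<lambda>(g, h). g \<otimes>\<^bsub>G\<^esub> h) \<and>
     smooth_map M M (\<lambda>g. inv\<^bsub>G\<^esub> g)"


section \<open>Path space\<close>

text \<open>
  \<open>C(\<real>\<^sup>+, Z)\<close>; to have one function per path, the values at negative times are fixed to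
  \<^term>\<open>undefined\<close>.
\<close>

definition paths :: "(real \<Rightarrow> 'z::topological_space) set" where
  "paths = {\<omega> \<in> extensional {0..}. continuous_on {0..} \<omega>}"

definition path_topology :: "(real \<Rightarrow> 'z::topological_space) topology" where
  "path_topology = topology_generated_by
     {{\<omega> \<in> paths. \<omega> ` K \<subseteq> U} | K U. compact K \<and> K \<subseteq> {0..} \<and> open U}"

definition path_space :: "(real \<Rightarrow> 'z::topological_space) measure" where
  "path_space = sigma paths {A. openin path_topology A}"

definition shift :: "real \<Rightarrow> (real \<Rightarrow> 'z) \<Rightarrow> real \<Rightarrow> 'z" where
  "shift s \<omega> = (\<lambda>t\<in>{0..}. \<omega> (t + s))"

text \<open>
  \<open>observed \<pi> T\<close> is the sigma field on the path space generated by \<open>\<pi> (\<omega> s)\<close>, \<open>s \<in> T\<close>, where \<open>T\<close> is a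
  set of nonnegative times.
\<close>

definition observed ::
    "('z::topological_space \<Rightarrow> 'y::topological_space) \<Rightarrow> real set \<Rightarrow> (real \<Rightarrow> 'z) measure" where
  "observed \<pi> T =
     sigma paths {{\<omega> \<in> paths. \<pi> (\<omega> s) \<in> B} | s B. s \<in> T \<and> B \<in> sets borel}"

definition tail_field ::
    "('z::topological_space \<Rightarrow> 'y::topological_space) \<Rightarrow> (real \<Rightarrow> 'z) set set" where
  "tail_field \<pi> = (\<Inter>t\<in>{0..}. sets (observed \<pi> {t..}))"

definition inv_field ::
    "('z::topological_space \<Rightarrow> 'y::topological_space) \<Rightarrow> (real \<Rightarrow> 'z) set set" where
  "inv_field \<pi> = {A \<in> tail_field \<pi>. \<forall>s>0. shift s -` A \<inter> paths = A}"

text \<open>Indexed by \<open>[0, \<infinity>]\<close>, so that stopping times may take the value \<open>\<infinity>\<close>.\<close>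

definition natural_filtration :: "ennreal \<Rightarrow> (real \<Rightarrow> 'z::topological_space) measure" where
  "natural_filtration t = observed id {s. 0 \<le> s \<and> ennreal s \<le> t}"


section \<open>Diffusions\<close>

definition martingale :: "'w measure \<Rightarrow> (ennreal \<Rightarrow> 'w measure) \<Rightarrow> (real \<Rightarrow> 'w \<Rightarrow> real) \<Rightarrow> bool" where
  "martingale Q F M \<longleftrightarrow>
     (\<forall>t\<ge>0. integrable Q (M t) \<and> M t \<in> borel_measurable (F (ennreal t))) \<and>
     (\<forall>s t. 0 \<le> s \<and> s \<le> t \<longrightarrow>
        (AE \<omega> in Q. real_cond_exp Q (F (ennreal s)) (M t) \<omega> = M s \<omega>))"

definition test_function ::
    "('z::topological_space, 'e::euclidean_space) manifold \<Rightarrow> ('z \<Rightarrow> real) \<Rightarrow> bool" where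
  "test_function M f \<longleftrightarrow> smooth_function M f \<and> compact (closure {z. f z \<noteq> 0})"

definition solves_martingale_problem ::
    "('z::topological_space, 'e::euclidean_space) manifold \<Rightarrow>
     (('z \<Rightarrow> real) \<Rightarrow> 'z \<Rightarrow> real) \<Rightarrow> 'z \<Rightarrow> (real \<Rightarrow> 'z) measure \<Rightarrow> bool" where
  "solves_martingale_problem M L z Q \<longleftrightarrow>
     prob_space Q \<and> sets Q = sets path_space \<and> (AE \<omega> in Q. \<omega> 0 = z) \<and>
     (\<forall>f. test_function M f \<longrightarrow>
        martingale Q natural_filtration
          (\<lambda>t \<omega>. f (\<omega> t) - f (\<omega> 0) - (LINT s:{0..t}|lborel. L f (\<omega> s))))"

definition strong_markov :: "('z::topological_space \<Rightarrow> (real \<Rightarrow> 'z) measure) \<Rightarrow> bool" where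
  "strong_markov P \<longleftrightarrow>
     P \<in> borel \<rightarrow>\<^sub>M prob_algebra path_space \<and>
     (\<forall>z T B. stopping_time natural_filtration T \<and> B \<in> sets path_space \<longrightarrow>
        (AE \<omega> in P z. T \<omega> < \<infinity> \<longrightarrow>
           real_cond_exp (P z) (filtration.pre_sigma paths natural_filtration T)
             (indicator {\<omega> \<in> paths. T \<omega> < \<infinity> \<and> shift (enn2real (T \<omega>)) \<omega> \<in> B}) \<omega>
           = measure (P (\<omega> (enn2real (T \<omega>)))) B))"

definition operator_on_smooth ::
    "('z::topological_space, 'e::euclidean_space) manifold \<Rightarrow>
     (('z \<Rightarrow> real) \<Rightarrow> 'z \<Rightarrow> real) \<Rightarrow> bool" where
  "operator_on_smooth M L \<longleftrightarrow>
     (\<forall>f. smooth_function M f \<longrightarrow> smooth_function M (L f)) \<and>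
     (\<forall>f g a b. smooth_function M f \<and> smooth_function M g \<longrightarrow>
        L (\<lambda>z. a * f z + b * g z) = (\<lambda>z. a * L f z + b * L g z))"

definition diffusion ::
    "('z::topological_space, 'e::euclidean_space) manifold \<Rightarrow>
     (('z \<Rightarrow> real) \<Rightarrow> 'z \<Rightarrow> real) \<Rightarrow> ('z \<Rightarrow> (real \<Rightarrow> 'z) measure) \<Rightarrow> bool" where
  "diffusion M L P \<longleftrightarrow>
     operator_on_smooth M L \<and> strong_markov P \<and>
     (\<forall>z. solves_martingale_problem M L z (P z) \<and>
          (\<forall>Q. solves_martingale_problem M L z Q \<longrightarrow> Q = P z))"

definition harmonic ::
    "('z::topological_space \<Rightarrow> (real \<Rightarrow> 'z) measure) \<Rightarrow> ('z \<Rightarrow> real) \<Rightarrow> bool" where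
  "harmonic P H \<longleftrightarrow>
     H \<in> borel_measurable borel \<and> bounded (range H) \<and>
     (\<forall>t\<ge>0. \<forall>z. H z = (\<integral>\<omega>. H (\<omega> t) \<partial>P z))"


section \<open>The four conditions\<close>

definition eq_up_to_null :: "'w measure \<Rightarrow> 'w set set \<Rightarrow> 'w set set \<Rightarrow> bool" where
  "eq_up_to_null Q \<A> \<B> \<longleftrightarrow>
     (\<forall>A\<in>\<A>. \<exists>B\<in>\<B>. sym_diff A B \<in> null_sets Q) \<and>
     (\<forall>B\<in>\<B>. \<exists>A\<in>\<A>. sym_diff A B \<in> null_sets Q)"

definition trivial_field :: "'w measure \<Rightarrow> 'w set set \<Rightarrow> bool" where
  "trivial_field Q \<A> \<longleftrightarrow> (\<forall>A\<in>\<A>. measure Q A = 0 \<or> measure Q A = 1)"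

definition countably_generated :: "'s measure \<Rightarrow> bool" where
  "countably_generated N \<longleftrightarrow>
     (\<exists>E. countable E \<and> E \<subseteq> Pow (space N) \<and> sets N = sigma_sets (space N) E)"

definition sub_diffusion ::
    "('x::topological_space, 'e::euclidean_space) manifold \<Rightarrow>
     ('x \<times> 'g::topological_space \<Rightarrow> (real \<Rightarrow> 'x \<times> 'g) measure) \<Rightarrow> bool" where
  "sub_diffusion M P \<longleftrightarrow>
     (\<exists>L' P'. diffusion M L' P' \<and>
        (\<forall>x g. distr (P (x, g)) path_space (\<lambda>\<omega>. \<lambda>t\<in>{0..}. fst (\<omega> t)) = P' x))"

text \<open>
  HOL cannot quantify existentially over the type of the space in which \<open>ell\<close> takes its values, so
  \<open>ell\<close> and its reference measure \<open>\<Lambda>\<close> are arguments; they are irrelevant in the trivial case.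
\<close>

definition devissage ::
    "('x::topological_space, 'e::euclidean_space) manifold \<Rightarrow>
     ('x \<times> 'g::topological_space \<Rightarrow> (real \<Rightarrow> 'x \<times> 'g) measure) \<Rightarrow>
     's measure \<Rightarrow> ((real \<Rightarrow> 'x \<times> 'g) \<Rightarrow> 's) \<Rightarrow> bool" where
  "devissage M P \<Lambda> ell \<longleftrightarrow>
     sub_diffusion M P \<and>
     ((\<forall>z. trivial_field (P z) (inv_field fst)) \<or>
      (prob_space \<Lambda> \<and> countably_generated \<Lambda> \<and> ell \<in> path_space \<rightarrow>\<^sub>M \<Lambda> \<and>
       (\<forall>z. eq_up_to_null (P z) (inv_field fst) (sets (vimage_algebra paths ell \<Lambda>)) \<and>
            absolutely_continuous \<Lambda> (distr (P z) \<Lambda> ell))))"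

definition is_group_limit ::
    "(real \<Rightarrow> 'x::topological_space \<times> 'g::topological_space) measure \<Rightarrow>
     ((real \<Rightarrow> 'x \<times> 'g) \<Rightarrow> 'g) \<Rightarrow> bool" where
  "is_group_limit Q glim \<longleftrightarrow>
     glim \<in> path_space \<rightarrow>\<^sub>M borel \<and> (AE \<omega> in Q. ((\<lambda>t. snd (\<omega> t)) \<longlongrightarrow> glim \<omega>) at_top)"

definition convergence ::
    "('x::topological_space \<times> 'g::topological_space \<Rightarrow> (real \<Rightarrow> 'x \<times> 'g) measure) \<Rightarrow> bool" where
  "convergence P \<longleftrightarrow> (\<forall>z. \<exists>glim. is_group_limit (P z) glim)"

definition act :: "'g monoid \<Rightarrow> 'g \<Rightarrow> ('x \<times> 'g \<Rightarrow> real) \<Rightarrow> 'x \<times> 'g \<Rightarrow> real" where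
  "act G g f = (\<lambda>(x, h). f (x, g \<otimes>\<^bsub>G\<^esub> h))"

definition equivariance ::
    "'g monoid \<Rightarrow> ('x::topological_space \<times> 'g::topological_space, 'e::euclidean_space) manifold \<Rightarrow>
     (('x \<times> 'g \<Rightarrow> real) \<Rightarrow> 'x \<times> 'g \<Rightarrow> real) \<Rightarrow> bool" where
  "equivariance G M L \<longleftrightarrow>
     (\<forall>g f. smooth_function M f \<longrightarrow> L (act G g f) = act G g (L f))"

definition regularity :: "('z::topological_space \<Rightarrow> (real \<Rightarrow> 'z) measure) \<Rightarrow> bool" where
  "regularity P \<longleftrightarrow> (\<forall>H. harmonic P H \<longrightarrow> continuous_on UNIV H)"

end

theory Submission
  imports Defs
begin

text \<open>
  Let \<open>\<gamma>\<close> be the limit of the second component and let \<open>\<T>\<^sub>k\<close> be left translation of the second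
  component by \<open>k\<close>.  Uniqueness in the martingale problem turns equivariance of the generator into
  equivariance of the laws: \<open>\<T>\<^sub>k\<close> maps the law started at \<open>(x, g)\<close> to the law started at \<open>(x, k g)\<close>
  (\<open>diffusion_equivariant\<close>).

  Let \<open>A\<close> be an invariant event.  For each \<open>k\<close> the event \<open>A\<^sub>k = {\<omega>. \<T>\<^sub>h \<omega> \<in> A for h = k \<gamma>(\<omega>)\<^sup>-\<^sup>1}\<close> is invariant
  under shifts and under all translations.  Hence its probability, as a function of the starting
  point, is a harmonic function \<open>K\<close> of the first component alone, and \<open>A\<^sub>k\<close> is recovered as the limit
  of \<open>K (x\<^sub>t)\<close>; it is an invariant event of the first component up to a null set
  (\<open>translation_invariant_event\<close>).  Since \<open>\<omega> \<in> A\<close> iff \<open>\<omega> \<in> A\<^sub>k\<close> for \<open>k = \<gamma>(\<omega>)\<close>, it is tempting to conclude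
  at once that \<open>A\<close> is determined by \<open>\<gamma>\<close> and the invariant events of the first component.  But
  the exceptional null set depends on \<open>k\<close>, and the law of \<open>\<gamma>\<close> may be singular.

  Smoothing over the group repairs this.  For every probability measure \<open>\<nu>\<close> on the group, the
  family \<open>A\<^sub>k\<close> agrees, almost everywhere for \<open>\<nu> \<Otimes> P\<close>, with a family that is jointly measurable in
  \<open>k\<close> and the invariant events of the first component (\<open>jointly_measurable_version\<close>).  If the null
  sets of \<open>\<nu>\<close> are stable under right translations, \<open>k\<close> may be replaced by \<open>k \<gamma>(\<omega>)\<close> outside a null set; this
  says that the translate \<open>\<T>\<^sub>k\<^sup>-\<^sup>1 A\<close> is determined by \<open>\<gamma>\<close> and the invariant events of the first
  component, for \<open>\<nu>\<close>-almost every \<open>k\<close> (\<open>almost_every_translate\<close>).  The null sets of Lebesgue measure in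
  charts provide such a \<open>\<nu>\<close>, which charges every open set (\<open>quasi_invariant_measure\<close>).  So there are
  \<open>k\<close> with this property arbitrarily close to the unit.

  Finally the regularity condition lets \<open>k\<close> tend to the unit: the harmonic function of \<open>A\<close> is
  continuous, and by the Markov property this makes the probability of the symmetric difference of
  \<open>A\<close> and \<open>\<T>\<^sub>k\<^sup>-\<^sup>1 A\<close> tend to \<open>0\<close> (\<open>translate_continuous_in_probability\<close>).

  The other inclusion holds because the limit of a trajectory does not change under time shifts; the
  point is that the set of convergent paths and the limit are measurable (\<open>conv_paths_measurable\<close>).
\<close>

section \<open>Measure theory\<close>

text \<open>
  The events that can be approximated form a sigma field: a countable union is first replaced by a
  finite one, whose members are then approximated.
\<close>

lemma (in finite_measure) approximation_by_algebra:
  assumes alg: "algebra (space M) \<A>" and gen: "sets M = sigma_sets (space M) \<A>"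
    and E: "E \<in> sets M" and e: "(e::real) > 0"
  shows "\<exists>D\<in>\<A>. measure M (sym_diff E D) < e"
proof -
  interpret A: algebra "space M" \<A> by fact
  have sub: "\<A> \<subseteq> sets M" unfolding gen by auto
  have "E \<in> sigma_sets (space M) \<A>" using E gen by simp
  then have "E \<in> sets M \<and> (\<forall>e>0. \<exists>D\<in>\<A>. measure M (sym_diff E D) < e)"
  proof (induction rule: sigma_sets.induct)
    case (Basic a)
    then show ?case using sub by (auto intro!: bexI[of _ a])
  next
    case Empty
    then show ?case by (auto intro!: bexI[of _ "{}"])
  next
    case (Compl a)
    have "\<exists>D\<in>\<A>. measure M (sym_diff (space M - a) D) < e" if e: "e > 0" for e
    proof -
      obtain D where D: "D \<in> \<A>" "measure M (sym_diff a D) < e" using Compl e by auto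
      have "sym_diff (space M - a) (space M - D) = sym_diff a D"
        using Compl D sub sets.sets_into_space[of a M] sets.sets_into_space[of D M] by auto
      then show ?thesis using D by (intro bexI[of _ "space M - D"]) auto
    qed
    then show ?case using Compl by auto
  next
    case (Union a)
    then have a: "\<And>i. a i \<in> sets M" by auto
    have "\<exists>D\<in>\<A>. measure M (sym_diff (\<Union>i. a i) D) < e" if e: "e > 0" for e
    proof -
      have "(\<lambda>n. measure M (\<Union>i<n. a i)) \<longlonglongrightarrow> measure M (\<Union>n. \<Union>i<n. a i)"
        using a by (intro finite_Lim_measure_incseq) (auto simp: incseq_def, force)
      moreover have "(\<Union>n. \<Union>i<n. a i) = (\<Union>i. a i)" by auto
      ultimately have "\<forall>\<^sub>F n in sequentially. measure M (\<Union>i. a i) - e / 2 < measure M (\<Union>i<n. a i)"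
        using e by (intro order_tendstoD) auto
      then obtain n where n: "measure M (\<Union>i. a i) - e / 2 < measure M (\<Union>i<n. a i)"
        by (auto simp: eventually_sequentially)
      have "\<exists>D\<in>\<A>. measure M (sym_diff (a i) D) < e / (2 * (n + 1))" for i
        using Union e by simp
      then obtain D where D: "\<And>i. D i \<in> \<A>" "\<And>i. measure M (sym_diff (a i) (D i)) < e / (2 * (n + 1))"
        by metis
      have Ds: "D i \<in> sets M" for i using D sub by auto
      have U: "(\<Union>i<n. D i) \<in> \<A>" using D by (intro A.finite_UN) auto
      have "measure M (sym_diff (\<Union>i. a i) (\<Union>i<n. D i)) \<le>
        measure M (((\<Union>i. a i) - (\<Union>i<n. a i)) \<union> (\<Union>i<n. sym_diff (a i) (D i)))"
        using a Ds by (intro finite_measure_mono) auto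
      also have "\<dots> \<le> measure M ((\<Union>i. a i) - (\<Union>i<n. a i)) + measure M (\<Union>i<n. sym_diff (a i) (D i))"
        using a Ds by (intro measure_Un_le) auto
      also have "measure M ((\<Union>i. a i) - (\<Union>i<n. a i)) = measure M (\<Union>i. a i) - measure M (\<Union>i<n. a i)"
        using a by (intro finite_measure_Diff) auto
      also have "measure M (\<Union>i<n. sym_diff (a i) (D i)) \<le> (\<Sum>i<n. measure M (sym_diff (a i) (D i)))"
        using a Ds by (intro finite_measure_subadditive_finite) auto
      also have "(\<Sum>i<n. measure M (sym_diff (a i) (D i))) \<le> (\<Sum>i<n. e / (2 * (n + 1)))"
        using D(2) by (intro sum_mono less_imp_le)
      also have "(\<Sum>i<n. e / (2 * (n + 1))) \<le> e / 2" using e by (simp add: field_simps)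
      finally have "measure M (sym_diff (\<Union>i. a i) (\<Union>i<n. D i)) < e" using n by linarith
      then show ?thesis using U by blast
    qed
    then show ?case using a by auto
  qed
  then show ?thesis using e by blast
qed

text \<open>
  With errors at most \<open>2\<^sup>-\<^sup>n\<close>, the limes superior of the approximating events is the required
  event, by the Borel-Cantelli lemma.
\<close>

lemma (in finite_measure) limit_of_close_sets:
  assumes sig: "sigma_algebra (space M) \<B>" and sub: "\<B> \<subseteq> sets M" and A: "A \<in> sets M"
    and close: "\<And>e::real. e > 0 \<Longrightarrow> \<exists>B\<in>\<B>. measure M (sym_diff A B) < e"
  shows "\<exists>B\<in>\<B>. sym_diff A B \<in> null_sets M"
proof -
  interpret B: sigma_algebra "space M" \<B> by fact
  have "\<exists>B\<in>\<B>. measure M (sym_diff A B) < (1/2)^n" for n :: nat by (intro close) simp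
  then obtain B where B: "\<And>n. B n \<in> \<B>" "\<And>n::nat. measure M (sym_diff A (B n)) < (1/2)^n" by metis
  have Bs: "B n \<in> sets M" for n using B sub by auto
  have "summable (\<lambda>n. measure M (sym_diff A (B n)))"
    by (rule summable_comparison_test'[of "\<lambda>n. (1/2)^n"]) (use B(2) less_imp_le in \<open>auto intro: summable_geometric\<close>)
  then have AE: "AE \<omega> in M. \<forall>\<^sub>F n in sequentially. \<omega> \<in> space M - sym_diff A (B n)"
    using A Bs by (intro borel_cantelli_AE1) (auto simp: emeasure_eq_measure)
  let ?B = "\<Inter>m. \<Union>n\<in>{m..}. B n"
  have B': "?B \<in> \<B>" using B(1) by (intro B.countable_INT B.countable_UN') auto
  have "AE \<omega> in M. \<omega> \<notin> sym_diff A ?B"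
    using AE
  proof eventually_elim
    fix \<omega> assume "\<forall>\<^sub>F n in sequentially. \<omega> \<in> space M - sym_diff A (B n)"
    then obtain m where m: "\<And>n. n \<ge> m \<Longrightarrow> (\<omega> \<in> A \<longleftrightarrow> \<omega> \<in> B n)"
      unfolding eventually_sequentially by auto
    have "\<omega> \<in> ?B" if "\<omega> \<in> A"
    proof (intro INT_I)
      fix k show "\<omega> \<in> (\<Union>n\<in>{k..}. B n)" using m[of "max m k"] that by (intro UN_I[of "max m k"]) auto
    qed
    moreover have "\<omega> \<in> A" if "\<omega> \<in> ?B"
    proof -
      from that obtain n where "n \<ge> m" "\<omega> \<in> B n" by blast
      then show ?thesis using m by blast
    qed
    ultimately show "\<omega> \<notin> sym_diff A ?B" by blast
  qed
  moreover have "sym_diff A ?B \<in> sets M" using A B' sub by auto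
  ultimately have "sym_diff A ?B \<in> null_sets M" by (subst (asm) AE_iff_null_sets[symmetric]) simp_all
  then show ?thesis using B' by blast
qed

lemma product_subalgebra:
  assumes "subalgebra P F"
  shows "subalgebra (\<nu> \<Otimes>\<^sub>M P) (\<nu> \<Otimes>\<^sub>M F)"
proof -
  have sp: "space F = space P" using assms by (simp add: subalgebra_def)
  have "snd \<in> \<nu> \<Otimes>\<^sub>M P \<rightarrow>\<^sub>M F"
    by (rule measurable_compose[OF measurable_snd, of "\<lambda>x. x", simplified])
      (rule measurable_from_subalg[OF assms measurable_ident_sets[OF refl]])
  then have "(\<lambda>z. (fst z, snd z)) \<in> \<nu> \<Otimes>\<^sub>M P \<rightarrow>\<^sub>M \<nu> \<Otimes>\<^sub>M F"
    by (intro measurable_Pair) auto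
  then have "(\<lambda>z. z) \<in> \<nu> \<Otimes>\<^sub>M P \<rightarrow>\<^sub>M \<nu> \<Otimes>\<^sub>M F" by simp
  from measurable_sets[OF this] have "sets (\<nu> \<Otimes>\<^sub>M F) \<subseteq> sets (\<nu> \<Otimes>\<^sub>M P)"
    using sets.sets_into_space[of _ "\<nu> \<Otimes>\<^sub>M F"] sp by (auto simp: space_pair_measure Int_absorb2)
  then show ?thesis using sp by (simp add: subalgebra_def space_pair_measure)
qed

lemma AE_eq_from_rectangles:
  fixes f f' :: "'a \<times> 'b \<Rightarrow> real"
  assumes "prob_space \<nu>" "prob_space P"
    and f[measurable]: "integrable (\<nu> \<Otimes>\<^sub>M P) f" and f'[measurable]: "integrable (\<nu> \<Otimes>\<^sub>M P) f'"
    and eq: "\<And>C D. C \<in> sets \<nu> \<Longrightarrow> D \<in> sets P \<Longrightarrow>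
      set_lebesgue_integral (\<nu> \<Otimes>\<^sub>M P) (C \<times> D) f = set_lebesgue_integral (\<nu> \<Otimes>\<^sub>M P) (C \<times> D) f'"
  shows "AE z in \<nu> \<Otimes>\<^sub>M P. f z = f' z"
proof -
  let ?Q = "\<nu> \<Otimes>\<^sub>M P"
  have si: "set_integrable ?Q A f" "set_integrable ?Q A f'" if "A \<in> sets ?Q" for A
    using integrable_mult_indicator[OF that f] integrable_mult_indicator[OF that f']
    by (simp_all add: set_integrable_def)
  have "set_lebesgue_integral ?Q A f = set_lebesgue_integral ?Q A f'" if A: "A \<in> sets ?Q" for A
  proof -
    let ?G = "{a \<times> b |a b. a \<in> sets \<nu> \<and> b \<in> sets P}"
    have gen: "sets ?Q = sigma_sets (space \<nu> \<times> space P) ?G" by (rule sets_pair_measure)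
    have "A \<in> sigma_sets (space \<nu> \<times> space P) ?G" using A gen by simp
    with Int_stable_pair_measure_generator pair_measure_closed show ?thesis
    proof (induction rule: sigma_sets_induct_disjoint)
      case (basic A) then show ?case using eq by auto
    next
      case empty then show ?case by (simp add: set_lebesgue_integral_def)
    next
      case (compl A)
      then have A: "A \<in> sets ?Q" using gen by simp
      have sp: "space \<nu> \<times> space P \<in> sets ?Q" by (metis sets.top space_pair_measure)
      have "set_lebesgue_integral ?Q (space \<nu> \<times> space P - A) h =
          set_lebesgue_integral ?Q (space \<nu> \<times> space P) h - set_lebesgue_integral ?Q A h"
        if "h \<in> {f, f'}" for h
      proof -
        have h: "set_integrable ?Q B h" if "B \<in> sets ?Q" for B using si[OF that] \<open>h \<in> {f, f'}\<close> by auto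
        have "set_lebesgue_integral ?Q ((space \<nu> \<times> space P - A) \<union> A) h =
           set_lebesgue_integral ?Q (space \<nu> \<times> space P - A) h + set_lebesgue_integral ?Q A h"
          using A sp by (intro set_integral_Un h) auto
        moreover have "(space \<nu> \<times> space P - A) \<union> A = space \<nu> \<times> space P"
          using sets.sets_into_space[OF A] by (auto simp: space_pair_measure)
        ultimately show ?thesis by simp
      qed
      then show ?case using compl eq[OF sets.top sets.top] by simp
    next
      case (union A)
      then have A: "A i \<in> sets ?Q" for i using gen by auto
      have "set_lebesgue_integral ?Q (\<Union>(range A)) h = (\<Sum>i. set_lebesgue_integral ?Q (A i) h)"
        if "h \<in> {f, f'}" for h
        using union(1) A si[of "\<Union>(range A)"] that
        by (intro lebesgue_integral_countable_add) (auto simp: disjoint_family_on_def)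
      then show ?case using union by simp
    qed
  qed
  then show ?thesis by (intro density_unique_real f f')
qed

text \<open>
  The version is the conditional expectation of the indicator of \<open>S\<close> on the product.  It differs
  from the indicator only on a null set, because both have the same integral over each rectangle
  \<open>C \<times> D\<close>: for each \<open>k\<close> the section of \<open>S\<close> is an event of the sub-sigma-field, so that the indicator of
  \<open>D\<close> can be replaced by its conditional expectation.
\<close>

lemma jointly_measurable_version:
  assumes nu: "prob_space \<nu>" and P: "prob_space P" and F: "subalgebra P F"
    and S: "S \<in> sets (\<nu> \<Otimes>\<^sub>M P)"
    and sec: "\<And>k. k \<in> space \<nu> \<Longrightarrow> \<exists>B\<in>sets F. AE \<omega> in P. (k, \<omega>) \<in> S \<longleftrightarrow> \<omega> \<in> B"
  shows "\<exists>S'\<in>sets (\<nu> \<Otimes>\<^sub>M F). AE z in \<nu> \<Otimes>\<^sub>M P. z \<in> S \<longleftrightarrow> z \<in> S'"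
proof -
  interpret nu: prob_space \<nu> by fact
  interpret P: prob_space P by fact
  interpret nuP: pair_prob_space \<nu> P ..
  let ?Q = "\<nu> \<Otimes>\<^sub>M P" and ?H = "\<nu> \<Otimes>\<^sub>M F"
  have subH: "subalgebra ?Q ?H" by (rule product_subalgebra[OF F])
  interpret H: finite_measure_subalgebra ?Q ?H by unfold_locales (rule subH)
  interpret F: finite_measure_subalgebra P F by unfold_locales (rule F)
  have FP: "sets F \<subseteq> sets P" "space F = space P" using F by (auto simp: subalgebra_def)
  define f where "f = (indicator S :: _ \<Rightarrow> real)"
  define f' where "f' = real_cond_exp ?Q ?H f"
  have f: "integrable ?Q f" unfolding f_def using S by (simp add: nuP.emeasure_eq_measure)
  have f'm: "f' \<in> borel_measurable ?H" unfolding f'_def by simp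
  have f': "integrable ?Q f'" unfolding f'_def by (rule H.real_cond_exp_int[OF f])
  have rect: "set_lebesgue_integral ?Q (C \<times> D) f = set_lebesgue_integral ?Q (C \<times> D) f'"
    if C: "C \<in> sets \<nu>" and D: "D \<in> sets P" for C D
  proof -
    define r where "r = (indicator (C \<times> D) :: _ \<Rightarrow> real)"
    define d where "d = real_cond_exp P F (indicator D)"
    have CD: "C \<times> D \<in> sets ?Q" using C D by auto
    have Dint: "integrable P (indicator D :: _ \<Rightarrow> real)" using D by (simp add: P.emeasure_eq_measure)
    have d: "integrable P d" "d \<in> borel_measurable F" unfolding d_def using F.real_cond_exp_int[OF Dint] by auto
    have dP: "d \<in> borel_measurable P" using d by auto
    have dsec: "(\<integral>\<omega>. indicator B \<omega> * d \<omega> \<partial>P) = (\<integral>\<omega>. indicator B \<omega> * indicator D \<omega> \<partial>P)"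
      if "B \<in> sets F" for B
      unfolding d_def
    proof (rule F.real_cond_exp_intg(2))
      show "integrable P (\<lambda>x. indicator B x * (indicator D x :: real))"
        using integrable_mult_indicator[OF _ Dint, of B] that FP(1) by auto
    qed (use D that in auto)
    define g where "g = (\<lambda>z. indicator C (fst z) * d (snd z))"
    have gQ: "integrable ?Q g"
    proof -
      have "integrable ?Q (\<lambda>z. d (snd z))"
        using d(1) dP by (intro nuP.Fubini_integrable) simp_all
      from integrable_mult_indicator[OF _ this, of "C \<times> space P"] C
      have "integrable ?Q (\<lambda>z. indicator (C \<times> space P) z * d (snd z))" by simp
      moreover have "indicator (C \<times> space P) z * d (snd z) = indicator C (fst z) * d (snd z)"
        if "z \<in> space ?Q" for z
        using that by (auto simp: space_pair_measure indicator_def)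
      ultimately show ?thesis unfolding g_def by (subst (asm) Bochner_Integration.integrable_cong[OF refl]) auto
    qed
    have rQ: "integrable ?Q r" unfolding r_def using CD by (simp add: nuP.emeasure_eq_measure)
    have g: "AE z in ?Q. real_cond_exp ?Q ?H r z = g z"
    proof (rule H.real_cond_exp_charact)
      show "integrable ?Q r" by (rule rQ)
      show "integrable ?Q g" by (rule gQ)
      have "(\<lambda>z. d (snd z)) \<in> borel_measurable ?H" "(\<lambda>z. indicator C (fst z) :: real) \<in> borel_measurable ?H"
        using d(2) C by measurable
      then show "g \<in> borel_measurable ?H" unfolding g_def by simp
      fix W assume W: "W \<in> sets ?H"
      then have WQ: "W \<in> sets ?Q" using subH by (auto simp: subalgebra_def)
      have Wk: "Pair k -` W \<in> sets F" for k using W by (rule sets_Pair1)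
      have "set_lebesgue_integral ?Q W r = (\<integral>z. indicator W z * r z \<partial>?Q)"
        by (simp add: set_lebesgue_integral_def)
      also have "\<dots> = (\<integral>k. (\<integral>\<omega>. indicator W (k, \<omega>) * r (k, \<omega>) \<partial>P) \<partial>\<nu>)"
        using nuP.integral_fst'[OF integrable_mult_indicator[OF WQ rQ]] by simp
      also have "\<dots> = (\<integral>k. indicator C k * (\<integral>\<omega>. indicator (Pair k -` W) \<omega> * indicator D \<omega> \<partial>P) \<partial>\<nu>)"
        by (intro Bochner_Integration.integral_cong refl)
          (auto simp: r_def indicator_def simp flip: integral_mult_right_zero intro!: Bochner_Integration.integral_cong)
      also have "\<dots> = (\<integral>k. indicator C k * (\<integral>\<omega>. indicator (Pair k -` W) \<omega> * d \<omega> \<partial>P) \<partial>\<nu>)"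
        by (simp add: dsec[OF Wk])
      also have "\<dots> = (\<integral>k. (\<integral>\<omega>. indicator W (k, \<omega>) * g (k, \<omega>) \<partial>P) \<partial>\<nu>)"
        by (intro Bochner_Integration.integral_cong refl)
          (auto simp: g_def indicator_def simp flip: integral_mult_right_zero intro!: Bochner_Integration.integral_cong)
      also have "\<dots> = (\<integral>z. indicator W z * g z \<partial>?Q)"
        using nuP.integral_fst'[OF integrable_mult_indicator[OF WQ gQ]] by simp
      finally show "set_lebesgue_integral ?Q W r = set_lebesgue_integral ?Q W g"
        by (simp add: set_lebesgue_integral_def)
    qed
    have rm: "r \<in> borel_measurable ?Q" "f \<in> borel_measurable ?Q" using CD S by (auto simp: r_def f_def)
    have fr: "integrable ?Q (\<lambda>z. r z * f z)"
      using integrable_mult_indicator[OF CD f] by (simp add: r_def)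
    have f'r: "integrable ?Q (\<lambda>z. f' z * r z)"
      using integrable_mult_indicator[OF CD f'] by (simp add: r_def mult.commute)
    have gf: "integrable ?Q (\<lambda>z. g z * f z)"
      using integrable_mult_indicator[OF S gQ] by (simp add: f_def mult.commute)
    have gm: "real_cond_exp ?Q ?H r \<in> borel_measurable ?H" by simp
    have "set_lebesgue_integral ?Q (C \<times> D) f' = (\<integral>z. f' z * r z \<partial>?Q)"
      by (simp add: set_lebesgue_integral_def r_def mult.commute)
    also have "\<dots> = (\<integral>z. f' z * real_cond_exp ?Q ?H r z \<partial>?Q)"
      using H.real_cond_exp_intg(2)[OF f'r f'm rm(1)] by simp
    also have "\<dots> = (\<integral>z. real_cond_exp ?Q ?H r z * real_cond_exp ?Q ?H f z \<partial>?Q)"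
      by (simp add: f'_def mult.commute)
    also have "\<dots> = (\<integral>z. real_cond_exp ?Q ?H r z * f z \<partial>?Q)"
    proof (rule H.real_cond_exp_intg(2)[OF _ gm rm(2)])
      show "integrable ?Q (\<lambda>z. real_cond_exp ?Q ?H r z * f z)"
        by (rule integrable_cong_AE_imp[OF gf]) (use g rm in auto)
    qed
    also have "\<dots> = (\<integral>z. g z * f z \<partial>?Q)"
      by (rule integral_cong_AE) (use g rm gQ in auto)
    also have "\<dots> = (\<integral>k. (\<integral>\<omega>. g (k, \<omega>) * f (k, \<omega>) \<partial>P) \<partial>\<nu>)"
      using nuP.integral_fst'[OF gf] by simp
    also have "\<dots> = (\<integral>k. (\<integral>\<omega>. r (k, \<omega>) * f (k, \<omega>) \<partial>P) \<partial>\<nu>)"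
    proof (rule Bochner_Integration.integral_cong[OF refl])
      fix k assume k: "k \<in> space \<nu>"
      obtain B where B: "B \<in> sets F" "AE \<omega> in P. (k, \<omega>) \<in> S \<longleftrightarrow> \<omega> \<in> B" using sec[OF k] by blast
      have B': "B \<in> sets P" using B FP by auto
      have Sk: "(\<lambda>\<omega>. f (k, \<omega>)) \<in> borel_measurable P" unfolding f_def
        using measurable_compose[OF measurable_Pair1'[OF k], of "indicator S" P borel] S by simp
      have "(\<integral>\<omega>. g (k, \<omega>) * f (k, \<omega>) \<partial>P) = (\<integral>\<omega>. indicator C k * (indicator B \<omega> * d \<omega>) \<partial>P)"
        by (rule integral_cong_AE) (use B B' Sk dP in \<open>auto simp: g_def f_def indicator_def\<close>)
      also have "\<dots> = (\<integral>\<omega>. indicator C k * (indicator B \<omega> * indicator D \<omega>) \<partial>P)"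
        using dsec[OF B(1)] by simp
      also have "\<dots> = (\<integral>\<omega>. r (k, \<omega>) * f (k, \<omega>) \<partial>P)"
        by (rule integral_cong_AE) (use B B' Sk D in \<open>auto simp: r_def f_def indicator_def\<close>)
      finally show "(\<integral>\<omega>. g (k, \<omega>) * f (k, \<omega>) \<partial>P) = (\<integral>\<omega>. r (k, \<omega>) * f (k, \<omega>) \<partial>P)" .
    qed
    also have "\<dots> = (\<integral>z. r z * f z \<partial>?Q)"
      using nuP.integral_fst'[OF fr] by simp
    also have "\<dots> = set_lebesgue_integral ?Q (C \<times> D) f"
      by (simp add: set_lebesgue_integral_def r_def)
    finally show ?thesis by simp
  qed
  have AE: "AE z in ?Q. f z = f' z" by (rule AE_eq_from_rectangles[OF nu P f f' rect])
  let ?S = "{z \<in> space ?H. f' z > 1/2}"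
  show ?thesis
  proof (rule bexI[of _ ?S])
    show "?S \<in> sets ?H" using f'm by measurable
    show "AE z in ?Q. z \<in> S \<longleftrightarrow> z \<in> ?S"
      using AE AE_space
    proof eventually_elim
      fix z assume "f z = f' z" "z \<in> space ?Q"
      then show "z \<in> S \<longleftrightarrow> z \<in> ?S" using subH by (cases "z \<in> S") (auto simp: f_def subalgebra_def)
    qed
  qed
qed


section \<open>Iterated directional derivatives\<close>

definition dir_deriv :: "('e::euclidean_space \<Rightarrow> 'f::real_normed_vector) \<Rightarrow> 'e \<Rightarrow> 'e \<Rightarrow> 'f" where
  "dir_deriv f v x = vector_derivative (\<lambda>t. f (x + t *\<^sub>R v)) (at 0)"

definition has_dir_derivs :: "'e::euclidean_space set \<Rightarrow> 'e set \<Rightarrow> ('e \<Rightarrow> 'f::real_normed_vector) \<Rightarrow> bool" where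
  "has_dir_derivs V S f \<longleftrightarrow>
     (\<forall>v\<in>V. \<forall>x\<in>S. ((\<lambda>t. f (x + t *\<^sub>R v)) has_vector_derivative dir_deriv f v x) (at 0))"

lemma eventually_line_in_openin:
  fixes V :: "'e::euclidean_space set"
  assumes "subspace V" "openin (top_of_set V) S" "x \<in> S" "v \<in> V"
  shows "open {t::real. x + t *\<^sub>R v \<in> S}"
proof -
  obtain T where T: "open T" "S = V \<inter> T"
    using assms(2) by (auto simp: openin_open)
  have "x + t *\<^sub>R v \<in> V" for t
    using assms T by (auto intro!: subspace_add subspace_scale)
  then have "{t::real. x + t *\<^sub>R v \<in> S} = (\<lambda>t. x + t *\<^sub>R v) -` T"
    using T by auto
  moreover have "open ((\<lambda>t::real. x + t *\<^sub>R v) -` T)"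
    by (intro open_vimage T continuous_intros)
  ultimately show ?thesis by simp
qed

lemma line_derivative_cong:
  fixes V :: "'e::euclidean_space set"
  assumes V: "subspace V" "openin (top_of_set V) S" "x \<in> S" "v \<in> V"
    and eq: "\<And>y. y \<in> S \<Longrightarrow> f y = g y"
    and der: "((\<lambda>t. f (x + t *\<^sub>R v)) has_vector_derivative D) (at 0)"
  shows "((\<lambda>t. g (x + t *\<^sub>R v)) has_vector_derivative D) (at 0)"
  by (rule has_vector_derivative_transform_within_open
        [OF der eventually_line_in_openin[OF V]]) (use V eq in auto)

lemma Ck_on_imp_continuous_on: "Ck_on k V S f \<Longrightarrow> continuous_on S f"
  by (cases k) auto

lemma Ck_on_SucE:
  assumes "Ck_on (Suc k) V S f" "v \<in> V"
  obtains f' where "\<And>x. x \<in> S \<Longrightarrow> ((\<lambda>t. f (x + t *\<^sub>R v)) has_vector_derivative f' x) (at 0)"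
    "Ck_on k V S f'"
proof -
  have "\<exists>f'. (\<forall>x\<in>S. ((\<lambda>t. f (x + t *\<^sub>R v)) has_vector_derivative f' x) (at 0)) \<and> Ck_on k V S f'"
    using assms unfolding Ck_on.simps by (elim conjE bspec)
  then obtain f' where "\<forall>x\<in>S. ((\<lambda>t. f (x + t *\<^sub>R v)) has_vector_derivative f' x) (at 0)"
    "Ck_on k V S f'" by blast
  then show ?thesis by (intro that[of f']) simp_all
qed

lemma Ck_on_SucI:
  assumes "continuous_on S f"
    and "\<And>v. v \<in> V \<Longrightarrow>
      \<exists>f'. (\<forall>x\<in>S. ((\<lambda>t. f (x + t *\<^sub>R v)) has_vector_derivative f' x) (at 0)) \<and> Ck_on k V S f'"
  shows "Ck_on (Suc k) V S f"
  unfolding Ck_on.simps by (intro conjI ballI assms)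

lemma Ck_on_cong:
  fixes V :: "'e::euclidean_space set" and f :: "'e \<Rightarrow> 'f::real_normed_vector"
  assumes V: "subspace V" "openin (top_of_set V) S"
  shows "\<forall>x\<in>S. f x = g x \<Longrightarrow> Ck_on k V S f \<Longrightarrow> Ck_on k V S g"
proof (induction k arbitrary: f g)
  case 0
  then show ?case by (simp cong: continuous_on_cong_simp)
next
  case (Suc k)
  show ?case
  proof (rule Ck_on_SucI)
    show "continuous_on S g"
      using Ck_on_imp_continuous_on[OF Suc.prems(2)] Suc.prems(1) by (simp cong: continuous_on_cong_simp)
    fix v assume v: "v \<in> V"
    obtain f' where f': "\<And>x. x \<in> S \<Longrightarrow> ((\<lambda>t. f (x + t *\<^sub>R v)) has_vector_derivative f' x) (at 0)" "Ck_on k V S f'"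
      using Ck_on_SucE[OF Suc.prems(2) v] by blast
    show "\<exists>f'. (\<forall>x\<in>S. ((\<lambda>t. g (x + t *\<^sub>R v)) has_vector_derivative f' x) (at 0)) \<and> Ck_on k V S f'"
      using line_derivative_cong[OF V _ v, of _ f g] Suc.prems(1) f'
      by (intro exI[of _ f'] conjI ballI) simp_all
  qed
qed

text \<open>
  The definition of \<open>Ck_on\<close> asks for some derivative on \<open>S\<close>; replacing it by a canonical one lets
  derivatives on different open sets be glued together.
\<close>

lemma Ck_on_Suc:
  fixes V :: "'e::euclidean_space set" and f :: "'e \<Rightarrow> 'f::real_normed_vector"
  assumes V: "subspace V" "openin (top_of_set V) S"
  shows "Ck_on (Suc k) V S f \<longleftrightarrow>
    continuous_on S f \<and> has_dir_derivs V S f \<and> (\<forall>v\<in>V. Ck_on k V S (dir_deriv f v))"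
proof (intro iffI conjI; (elim conjE)?)
  assume L: "Ck_on (Suc k) V S f"
  then show "continuous_on S f" by simp
  have *: "\<exists>f'. (\<forall>x\<in>S. ((\<lambda>t. f (x + t *\<^sub>R v)) has_vector_derivative f' x) (at 0) \<and> dir_deriv f v x = f' x)
     \<and> Ck_on k V S f'" if "v \<in> V" for v
    using Ck_on_SucE[OF L that] by (metis dir_deriv_def vector_derivative_at)
  show "has_dir_derivs V S f"
    unfolding has_dir_derivs_def using * by fastforce
  show "\<forall>v\<in>V. Ck_on k V S (dir_deriv f v)"
  proof
    fix v assume v: "v \<in> V"
    from *[OF v] obtain f' where "\<forall>x\<in>S. f' x = dir_deriv f v x" "Ck_on k V S f'" by metis
    then show "Ck_on k V S (dir_deriv f v)" by (rule Ck_on_cong[OF V])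
  qed
next
  assume "continuous_on S f" "has_dir_derivs V S f" "\<forall>v\<in>V. Ck_on k V S (dir_deriv f v)"
  then show "Ck_on (Suc k) V S f"
    unfolding has_dir_derivs_def Ck_on.simps by blast
qed

lemma Ck_on_SucD: "Ck_on (Suc k) V S f \<Longrightarrow> Ck_on k V S f"
proof (induction k arbitrary: f)
  case (Suc k)
  show ?case
  proof (rule Ck_on_SucI)
    show "continuous_on S f" by (rule Ck_on_imp_continuous_on[OF Suc.prems])
    fix v assume v: "v \<in> V"
    obtain f' where f': "\<And>x. x \<in> S \<Longrightarrow> ((\<lambda>t. f (x + t *\<^sub>R v)) has_vector_derivative f' x) (at 0)" "Ck_on (Suc k) V S f'"
      using Ck_on_SucE[OF Suc.prems v] by blast
    then show "\<exists>f'. (\<forall>x\<in>S. ((\<lambda>t. f (x + t *\<^sub>R v)) has_vector_derivative f' x) (at 0)) \<and> Ck_on k V S f'"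
      using Suc.IH by (intro exI[of _ f'] conjI ballI) simp_all
  qed
qed simp

lemma Ck_on_local:
  fixes V :: "'e::euclidean_space set" and f :: "'e \<Rightarrow> 'f::real_normed_vector"
  assumes V: "subspace V" "openin (top_of_set V) S"
  shows "(\<And>x. x \<in> S \<Longrightarrow> \<exists>S'. x \<in> S' \<and> S' \<subseteq> S \<and> openin (top_of_set V) S' \<and> Ck_on k V S' f)
    \<Longrightarrow> Ck_on k V S f"
proof (induction k arbitrary: f)
  case 0
  have "continuous (at x within S) f" if x: "x \<in> S" for x
  proof -
    obtain S' where S': "x \<in> S'" "S' \<subseteq> S" "openin (top_of_set V) S'" "continuous_on S' f"
      using 0[OF x] by auto
    have "openin (top_of_set S) S'"
      using S' V(2) by (meson openin_imp_subset openin_subset_trans)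
    then obtain T where T: "open T" "S' = S \<inter> T" by (auto simp: openin_open)
    then have "at x within S' = at x within S"
      using S'(1) by (intro at_within_nhd[of x T]) auto
    then show ?thesis using S' by (auto simp: continuous_on_eq_continuous_within)
  qed
  then show ?case by (simp add: continuous_on_eq_continuous_within)
next
  case (Suc k)
  have loc: "\<exists>S'. x \<in> S' \<and> S' \<subseteq> S \<and> openin (top_of_set V) S' \<and> Ck_on j V S' f"
    if x: "x \<in> S" and j: "j \<le> Suc k" for x j
  proof -
    have "Ck_on (Suc k) V S' f \<Longrightarrow> Ck_on j V S' f" for S'
      using j by (induction rule: inc_induct) (auto intro: Ck_on_SucD simp del: Ck_on.simps)
    then show ?thesis using Suc.prems[OF x] by blast
  qed
  have "Ck_on k V S f" by (rule Suc.IH) (use loc[of _ k] in simp)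
  then have "continuous_on S f" by (rule Ck_on_imp_continuous_on)
  moreover have "has_dir_derivs V S f"
    unfolding has_dir_derivs_def
  proof (intro ballI)
    fix v x assume "v \<in> V" "x \<in> S"
    then show "((\<lambda>t. f (x + t *\<^sub>R v)) has_vector_derivative dir_deriv f v x) (at 0)"
      using Suc.prems[of x] V by (auto simp: Ck_on_Suc has_dir_derivs_def simp del: Ck_on.simps)
  qed
  moreover have "Ck_on k V S (dir_deriv f v)" if "v \<in> V" for v
  proof (rule Suc.IH)
    fix x assume "x \<in> S"
    then show "\<exists>S'. x \<in> S' \<and> S' \<subseteq> S \<and> openin (top_of_set V) S' \<and> Ck_on k V S' (dir_deriv f v)"
      using Suc.prems[of x] that V by (metis Ck_on_Suc)
  qed
  ultimately show ?case using Ck_on_Suc[OF V] by blast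
qed

lemma Ck_on_bounded_linear:
  assumes L: "bounded_linear L"
  shows "Ck_on k V S f \<Longrightarrow> Ck_on k V S (\<lambda>x. L (f x))"
proof (induction k arbitrary: f)
  case 0
  then show ?case by (simp add: bounded_linear.continuous_on[OF L])
next
  case (Suc k)
  show ?case
  proof (rule Ck_on_SucI)
    show "continuous_on S (\<lambda>x. L (f x))"
      by (intro bounded_linear.continuous_on[OF L] Ck_on_imp_continuous_on[OF Suc.prems])
    fix v assume "v \<in> V"
    from Ck_on_SucE[OF Suc.prems this] obtain f' where
      "\<And>x. x \<in> S \<Longrightarrow> ((\<lambda>t. f (x + t *\<^sub>R v)) has_vector_derivative f' x) (at 0)" "Ck_on k V S f'"
      by blast
    then show "\<exists>f'. (\<forall>x\<in>S. ((\<lambda>t. L (f (x + t *\<^sub>R v))) has_vector_derivative f' x) (at 0)) \<and> Ck_on k V S f'"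
      using Suc.IH bounded_linear.has_vector_derivative[OF L]
      by (intro exI[of _ "\<lambda>x. L (f' x)"] conjI ballI) simp_all
  qed
qed

lemma Ck_on_add:
  "Ck_on k V S f \<Longrightarrow> Ck_on k V S g \<Longrightarrow> Ck_on k V S (\<lambda>x. f x + g x)"
proof (induction k arbitrary: f g)
  case 0
  then show ?case by (simp add: continuous_on_add)
next
  case (Suc k)
  show ?case
  proof (rule Ck_on_SucI)
    show "continuous_on S (\<lambda>x. f x + g x)"
      by (intro continuous_on_add Suc.prems[THEN Ck_on_imp_continuous_on])
    fix v assume v: "v \<in> V"
    obtain f' where f': "\<And>x. x \<in> S \<Longrightarrow> ((\<lambda>t. f (x + t *\<^sub>R v)) has_vector_derivative f' x) (at 0)" "Ck_on k V S f'"
      using Ck_on_SucE[OF Suc.prems(1) v] by blast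
    obtain g' where g': "\<And>x. x \<in> S \<Longrightarrow> ((\<lambda>t. g (x + t *\<^sub>R v)) has_vector_derivative g' x) (at 0)" "Ck_on k V S g'"
      using Ck_on_SucE[OF Suc.prems(2) v] by blast
    show "\<exists>f'. (\<forall>x\<in>S. ((\<lambda>t. f (x + t *\<^sub>R v) + g (x + t *\<^sub>R v)) has_vector_derivative f' x) (at 0)) \<and> Ck_on k V S f'"
      using f' g' Suc.IH
      by (intro exI[of _ "\<lambda>x. f' x + g' x"] conjI ballI has_vector_derivative_add) simp_all
  qed
qed

lemma Ck_on_mult:
  fixes f g :: "'e::euclidean_space \<Rightarrow> real"
  shows "Ck_on k V S f \<Longrightarrow> Ck_on k V S g \<Longrightarrow> Ck_on k V S (\<lambda>x. f x * g x)"
proof (induction k arbitrary: f g)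
  case 0
  then show ?case by (simp add: continuous_on_mult)
next
  case (Suc k)
  show ?case
  proof (rule Ck_on_SucI)
    show "continuous_on S (\<lambda>x. f x * g x)"
      by (intro continuous_on_mult Suc.prems[THEN Ck_on_imp_continuous_on])
    fix v assume v: "v \<in> V"
    obtain f' where f': "\<And>x. x \<in> S \<Longrightarrow> ((\<lambda>t. f (x + t *\<^sub>R v)) has_vector_derivative f' x) (at 0)" "Ck_on k V S f'"
      using Ck_on_SucE[OF Suc.prems(1) v] by blast
    obtain g' where g': "\<And>x. x \<in> S \<Longrightarrow> ((\<lambda>t. g (x + t *\<^sub>R v)) has_vector_derivative g' x) (at 0)" "Ck_on k V S g'"
      using Ck_on_SucE[OF Suc.prems(2) v] by blast
    have "((\<lambda>t. f (x + t *\<^sub>R v) * g (x + t *\<^sub>R v)) has_vector_derivative f x * g' x + f' x * g x) (at 0)"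
      if "x \<in> S" for x
      using has_vector_derivative_mult[OF f'(1)[OF that] g'(1)[OF that]] by simp
    moreover have "Ck_on k V S (\<lambda>x. f x * g' x + f' x * g x)"
      using f'(2) g'(2) Suc.prems[THEN Ck_on_SucD] by (intro Ck_on_add Suc.IH)
    ultimately show "\<exists>f'. (\<forall>x\<in>S. ((\<lambda>t. f (x + t *\<^sub>R v) * g (x + t *\<^sub>R v)) has_vector_derivative f' x) (at 0)) \<and> Ck_on k V S f'"
      by (intro exI[of _ "\<lambda>x. f x * g' x + f' x * g x"] conjI ballI) simp_all
  qed
qed

lemma Ck_on_const: "Ck_on k V S (\<lambda>x. c)"
proof (induction k arbitrary: c)
  case (Suc k)
  show ?case
    by (rule Ck_on_SucI) (auto intro!: exI[of _ "\<lambda>x. 0"] Suc)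
qed simp

lemma Ck_on_sum:
  "finite I \<Longrightarrow> (\<And>i. i \<in> I \<Longrightarrow> Ck_on k V S (f i)) \<Longrightarrow> Ck_on k V S (\<lambda>x. \<Sum>i\<in>I. f i x)"
  by (induction rule: finite_induct) (auto intro: Ck_on_const Ck_on_add)

lemma orthonormal_expansion:
  fixes w :: "'e::euclidean_space"
  assumes "finite B" "pairwise orthogonal B" "\<And>b. b \<in> B \<Longrightarrow> norm b = 1" "w \<in> span B"
  shows "(\<Sum>b\<in>B. (w \<bullet> b) *\<^sub>R b) = w"
proof -
  obtain c where c: "w = (\<Sum>b\<in>B. c b *\<^sub>R b)"
    using assms(1,4) by (auto simp: span_finite)
  have "w \<bullet> b = c b" if "b \<in> B" for b
  proof -
    have "w \<bullet> b = (\<Sum>b'\<in>B. if b' = b then c b else 0)"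
      unfolding c inner_sum_left
    proof (rule sum.cong[OF refl])
      fix b' assume "b' \<in> B"
      then show "(c b' *\<^sub>R b') \<bullet> b = (if b' = b then c b else 0)"
        using assms(2,3) that by (auto simp: pairwise_def orthogonal_def norm_eq_1)
    qed
    then show ?thesis using that assms(1) by simp
  qed
  then show ?thesis using c by simp
qed

text \<open>
  The coordinates are changed one at a time, and each increment is estimated by the mean value
  theorem.  The bound on the sum of the coordinates keeps all intermediate points in the ball.
\<close>

lemma partial_increments_bound:
  fixes f :: "'e::euclidean_space \<Rightarrow> 'f::real_normed_vector"
  assumes "finite B" and B: "\<And>b. b \<in> B \<Longrightarrow> norm b = 1" "B \<subseteq> V" and V: "subspace V"
    and ball: "ball y r \<inter> V \<subseteq> S" and y: "y \<in> V"
    and der: "\<And>b x. b \<in> B \<Longrightarrow> x \<in> S \<Longrightarrow>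
          ((\<lambda>t. f (x + t *\<^sub>R b)) has_vector_derivative f' b x) (at 0)"
    and close: "\<And>b x. b \<in> B \<Longrightarrow> x \<in> ball y r \<inter> V \<Longrightarrow> norm (f' b x - f' b y) \<le> \<epsilon>"
    and c: "(\<Sum>b\<in>B. \<bar>c b\<bar>) < r"
  shows "norm (f (y + (\<Sum>b\<in>B. c b *\<^sub>R b)) - f y - (\<Sum>b\<in>B. c b *\<^sub>R f' b y)) \<le> \<epsilon> * (\<Sum>b\<in>B. \<bar>c b\<bar>)"
  using assms(1) B der close c
proof (induction B rule: finite_induct)
  case (insert b B)
  define w where "w = (\<Sum>b\<in>B. c b *\<^sub>R b)"
  have wB: "norm w \<le> (\<Sum>b\<in>B. \<bar>c b\<bar>)"
    unfolding w_def using insert.prems(1) by (intro sum_norm_le) simp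
  have IH: "norm (f (y + w) - f y - (\<Sum>b\<in>B. c b *\<^sub>R f' b y)) \<le> \<epsilon> * (\<Sum>b\<in>B. \<bar>c b\<bar>)"
    unfolding w_def using insert by (intro insert.IH) auto
  have wV: "w \<in> V" unfolding w_def
    using insert.prems(2) by (intro subspace_sum[OF V] subspace_scale[OF V]) auto
  have bV: "b \<in> V" and nb: "norm b = 1" using insert.prems by auto
  have seg: "y + w + (s * c b) *\<^sub>R b \<in> ball y r \<inter> V" if "0 \<le> s" "s \<le> 1" for s
  proof -
    have "\<bar>s * c b\<bar> \<le> \<bar>c b\<bar>" using that by (simp add: abs_mult mult_left_le_one_le)
    then have "norm (w + (s * c b) *\<^sub>R b) < r"
      using norm_triangle_ineq[of w "(s * c b) *\<^sub>R b"] wB insert.prems(5) insert.hyps nb by simp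
    moreover have "dist y (y + w + (s * c b) *\<^sub>R b) = norm (w + (s * c b) *\<^sub>R b)"
    proof -
      have "y - (y + w + (s * c b) *\<^sub>R b) = - (w + (s * c b) *\<^sub>R b)" by simp
      then show ?thesis unfolding dist_norm by (simp only: norm_minus_cancel)
    qed
    ultimately show ?thesis using V y wV bV
      by (auto intro!: subspace_add subspace_scale)
  qed
  define g where "g s = f (y + w + (s * c b) *\<^sub>R b) - s *\<^sub>R (c b *\<^sub>R f' b y)" for s
  have "norm (g 1 - g 0) \<le> (\<epsilon> * \<bar>c b\<bar>) * norm (1 - 0 :: real)"
  proof (rule differentiable_bound[where S="{0..1}"
        and f'="\<lambda>s h. h *\<^sub>R (c b *\<^sub>R (f' b (y + w + (s * c b) *\<^sub>R b) - f' b y))"])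
    fix s :: real assume s: "s \<in> {0..1}"
    then have s': "y + w + (s * c b) *\<^sub>R b \<in> ball y r \<inter> V" using seg by auto
    then have "((\<lambda>t. f (y + w + (s * c b) *\<^sub>R b + t *\<^sub>R b)) has_vector_derivative
       f' b (y + w + (s * c b) *\<^sub>R b)) (at 0)"
      using insert.prems(3) ball by auto
    moreover have "((\<lambda>t. (t - s) * c b) has_vector_derivative c b) (at s)"
      by (auto intro!: derivative_eq_intros)
    ultimately have "((\<lambda>t. f (y + w + (s * c b) *\<^sub>R b + t *\<^sub>R b)) \<circ> (\<lambda>t. (t - s) * c b)
       has_vector_derivative c b *\<^sub>R f' b (y + w + (s * c b) *\<^sub>R b)) (at s)"
      by (intro vector_diff_chain_at) simp_all
    then have "((\<lambda>t. f (y + w + (t * c b) *\<^sub>R b)) has_vector_derivative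
       c b *\<^sub>R f' b (y + w + (s * c b) *\<^sub>R b)) (at s)"
      by (simp add: o_def algebra_simps)
    then have "(g has_vector_derivative
       c b *\<^sub>R f' b (y + w + (s * c b) *\<^sub>R b) - c b *\<^sub>R f' b y) (at s)"
      unfolding g_def by (auto intro!: derivative_eq_intros)
    then show "(g has_derivative (\<lambda>h. h *\<^sub>R (c b *\<^sub>R (f' b (y + w + (s * c b) *\<^sub>R b) - f' b y)))) (at s within {0..1})"
      by (auto simp: has_vector_derivative_def scaleR_diff_right intro: has_derivative_at_withinI)
    have "norm (f' b (y + w + (s * c b) *\<^sub>R b) - f' b y) \<le> \<epsilon>"
      using insert.prems(4) s' by auto
    then show "onorm (\<lambda>h::real. h *\<^sub>R (c b *\<^sub>R (f' b (y + w + (s * c b) *\<^sub>R b) - f' b y))) \<le> \<epsilon> * \<bar>c b\<bar>"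
    proof (intro onorm_le)
      fix h :: real
      have "\<bar>h * c b\<bar> * norm (f' b (y + w + (s * c b) *\<^sub>R b) - f' b y) \<le> \<bar>h * c b\<bar> * \<epsilon>"
        if "norm (f' b (y + w + (s * c b) *\<^sub>R b) - f' b y) \<le> \<epsilon>"
        using that by (intro mult_left_mono) auto
      then show "norm (h *\<^sub>R (c b *\<^sub>R (f' b (y + w + (s * c b) *\<^sub>R b) - f' b y))) \<le> \<epsilon> * \<bar>c b\<bar> * norm h"
        using \<open>norm (f' b (y + w + (s * c b) *\<^sub>R b) - f' b y) \<le> \<epsilon>\<close>
        by (simp add: abs_mult mult_ac)
    qed
  qed auto
  then have "norm (f (y + w + c b *\<^sub>R b) - f (y + w) - c b *\<^sub>R f' b y) \<le> \<epsilon> * \<bar>c b\<bar>"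
    by (simp add: g_def algebra_simps)
  with IH have "norm ((f (y + w) - f y - (\<Sum>b\<in>B. c b *\<^sub>R f' b y)) +
       (f (y + w + c b *\<^sub>R b) - f (y + w) - c b *\<^sub>R f' b y)) \<le> \<epsilon> * (\<Sum>b\<in>B. \<bar>c b\<bar>) + \<epsilon> * \<bar>c b\<bar>"
    by (rule norm_triangle_mono)
  moreover have "(f (y + w) - f y - (\<Sum>b\<in>B. c b *\<^sub>R f' b y)) +
       (f (y + w + c b *\<^sub>R b) - f (y + w) - c b *\<^sub>R f' b y)
     = f (y + (\<Sum>b\<in>insert b B. c b *\<^sub>R b)) - f y - (\<Sum>b\<in>insert b B. c b *\<^sub>R f' b y)"
    using insert.hyps by (simp add: w_def algebra_simps)
  ultimately show ?case using insert.hyps by (simp add: algebra_simps)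
qed simp

text \<open>
  Only directional derivatives along \<open>V\<close> are given; the chain rule needs a total derivative, relative
  to the open subset \<open>S\<close> of \<open>V\<close>.
\<close>

lemma C1_has_derivative_within:
  fixes f :: "'e::euclidean_space \<Rightarrow> 'f::real_normed_vector"
  assumes V: "subspace V" "openin (top_of_set V) S" and f: "Ck_on (Suc 0) V S f" and y: "y \<in> S"
    and B: "B \<subseteq> V" "finite B" "pairwise orthogonal B" "\<And>b. b \<in> B \<Longrightarrow> norm b = 1" "span B = V"
  shows "(f has_derivative (\<lambda>w. \<Sum>b\<in>B. (w \<bullet> b) *\<^sub>R dir_deriv f b y)) (at y within S)"
  unfolding has_derivative_within_alt
proof (intro conjI allI impI)
  show "bounded_linear (\<lambda>w. \<Sum>b\<in>B. (w \<bullet> b) *\<^sub>R dir_deriv f b y)"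
    by (intro bounded_linear_sum bounded_linear_scaleR_const bounded_linear_inner_left)
  fix e :: real assume e: "e > 0"
  have yV: "y \<in> V" using V(2) y by (meson openin_imp_subset subsetD)
  have der: "has_dir_derivs V S f" and cont: "continuous_on S (dir_deriv f b)" if "b \<in> B" for b
    using f that B(1) unfolding Ck_on_Suc[OF V] by auto
  obtain T where T: "open T" "S = V \<inter> T" using V(2) by (auto simp: openin_open)
  define \<epsilon> where "\<epsilon> = e / (card B + 1)"
  have \<epsilon>: "\<epsilon> > 0" using e by (simp add: \<epsilon>_def)
  have "\<forall>\<^sub>F x in at y within S. dist (dir_deriv f b x) (dir_deriv f b y) < \<epsilon>" if "b \<in> B" for b
    using cont[OF that] y \<epsilon> by (auto simp: continuous_on_def intro: tendstoD)
  then have "\<forall>\<^sub>F x in at y within S. \<forall>b\<in>B. dist (dir_deriv f b x) (dir_deriv f b y) < \<epsilon>"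
    by (intro eventually_ball_finite) (use B in auto)
  moreover have "\<forall>\<^sub>F x in nhds y. x \<in> T" using T y by (intro eventually_nhds_in_open) auto
  ultimately have "\<forall>\<^sub>F x in nhds y. (x \<in> S \<longrightarrow> x \<noteq> y \<longrightarrow> (\<forall>b\<in>B. dist (dir_deriv f b x) (dir_deriv f b y) < \<epsilon>)) \<and> x \<in> T"
    unfolding eventually_at_filter by eventually_elim auto
  then obtain r where r: "r > 0" "\<And>x. x \<in> S \<Longrightarrow> dist x y < r \<Longrightarrow> x \<noteq> y \<Longrightarrow>
      \<forall>b\<in>B. dist (dir_deriv f b x) (dir_deriv f b y) < \<epsilon>" "\<And>x. dist x y < r \<Longrightarrow> x \<in> T"
    unfolding eventually_nhds_metric by blast
  have ball: "ball y r \<inter> V \<subseteq> S" using r(3) T by (auto simp: dist_commute)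
  show "\<exists>d>0. \<forall>x\<in>S. norm (x - y) < d \<longrightarrow>
     norm (f x - f y - (\<Sum>b\<in>B. ((x - y) \<bullet> b) *\<^sub>R dir_deriv f b y)) \<le> e * norm (x - y)"
  proof (intro exI conjI ballI impI)
    show "r / (card B + 1) > 0" using r by simp
    fix x assume x: "x \<in> S" "norm (x - y) < r / (card B + 1)"
    have "x - y \<in> span B" using B(5) V yV x T by (auto intro: subspace_diff)
    then have exp: "y + (\<Sum>b\<in>B. ((x - y) \<bullet> b) *\<^sub>R b) = x"
      using orthonormal_expansion[OF B(2,3,4), of "x - y"] by simp
    have sum: "(\<Sum>b\<in>B. \<bar>(x - y) \<bullet> b\<bar>) \<le> (card B + 1) * norm (x - y)"
    proof -
      have "(\<Sum>b\<in>B. \<bar>(x - y) \<bullet> b\<bar>) \<le> of_nat (card B) * norm (x - y)"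
        using Cauchy_Schwarz_ineq2[of "x - y"] B(4) by (intro sum_bounded_above) (metis mult.right_neutral)
      also have "\<dots> \<le> (card B + 1) * norm (x - y)"
        by (intro mult_right_mono) auto
      finally show ?thesis .
    qed
    have "norm (f (y + (\<Sum>b\<in>B. ((x - y) \<bullet> b) *\<^sub>R b)) - f y - (\<Sum>b\<in>B. ((x - y) \<bullet> b) *\<^sub>R dir_deriv f b y))
      \<le> \<epsilon> * (\<Sum>b\<in>B. \<bar>(x - y) \<bullet> b\<bar>)"
    proof (rule partial_increments_bound[OF B(2,4,1) V(1) ball yV])
      show "(\<Sum>b\<in>B. \<bar>(x - y) \<bullet> b\<bar>) < r"
        using sum x(2) by (simp add: field_simps)
      show "((\<lambda>t. f (x + t *\<^sub>R b)) has_vector_derivative dir_deriv f b x) (at 0)"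
        if "b \<in> B" "x \<in> S" for b x
        using der that B(1) unfolding has_dir_derivs_def by blast
      show "norm (dir_deriv f b x - dir_deriv f b y) \<le> \<epsilon>" if "b \<in> B" "x \<in> ball y r \<inter> V" for b x
      proof (cases "x = y")
        case False
        then have "dist (dir_deriv f b x) (dir_deriv f b y) < \<epsilon>"
          using r(2)[of x] that subsetD[OF ball that(2)] by (auto simp: dist_commute)
        then show ?thesis by (simp add: dist_norm)
      qed (use \<epsilon> in simp)
    qed auto
    also have "\<dots> \<le> \<epsilon> * ((card B + 1) * norm (x - y))"
      using sum \<epsilon> by (intro mult_left_mono) auto
    also have "\<dots> = e * norm (x - y)" by (simp add: \<epsilon>_def)
    finally show "norm (f x - f y - (\<Sum>b\<in>B. ((x - y) \<bullet> b) *\<^sub>R dir_deriv f b y)) \<le> e * norm (x - y)"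
      unfolding exp .
  qed
qed

lemma obtain_orthonormal_basis:
  fixes V :: "'e::euclidean_space set"
  assumes "subspace V"
  obtains B where "B \<subseteq> V" "finite B" "pairwise orthogonal B" "\<And>b. b \<in> B \<Longrightarrow> norm b = 1" "span B = V"
  using orthonormal_basis_subspace[OF assms] by (metis independent_imp_finite)

lemma line_derivative_chain:
  fixes f :: "'b::euclidean_space \<Rightarrow> 'f::real_normed_vector"
    and F :: "'a::euclidean_space \<Rightarrow> 'b"
  assumes V: "subspace V" "openin (top_of_set V) S" and x: "x \<in> S" "v \<in> V"
    and sub: "F ` S \<subseteq> T"
    and f: "(f has_derivative D) (at (F x) within T)"
    and F: "((\<lambda>t. F (x + t *\<^sub>R v)) has_vector_derivative F') (at 0)"
  shows "((\<lambda>t. f (F (x + t *\<^sub>R v))) has_vector_derivative D F') (at 0)"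
proof -
  define J where "J = {t::real. x + t *\<^sub>R v \<in> S}"
  have J: "open J" "0 \<in> J"
    using eventually_line_in_openin[OF V x] x by (auto simp: J_def)
  have "((\<lambda>t. F (x + t *\<^sub>R v)) has_derivative (\<lambda>t. t *\<^sub>R F')) (at 0 within J)"
    using F unfolding has_vector_derivative_def by (rule has_derivative_at_withinI)
  moreover have "(f has_derivative D) (at (F (x + 0 *\<^sub>R v)) within (\<lambda>t. F (x + t *\<^sub>R v)) ` J)"
    using f by (simp, rule has_derivative_subset) (use sub in \<open>auto simp: J_def\<close>)
  ultimately have "((\<lambda>t. f (F (x + t *\<^sub>R v))) has_derivative (\<lambda>t. D (t *\<^sub>R F'))) (at 0 within J)"
    by (rule has_derivative_in_compose)
  then have "((\<lambda>t. f (F (x + t *\<^sub>R v))) has_derivative (\<lambda>t. D (t *\<^sub>R F'))) (at 0)"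
    unfolding at_within_open[OF J(2,1)] .
  moreover have "D (t *\<^sub>R F') = t *\<^sub>R D F'" for t
    using f by (intro linear_scale has_derivative_linear)
  ultimately show ?thesis by (simp add: has_vector_derivative_def)
qed

text \<open>
  By the chain rule the derivative of the composition along \<open>v\<close> is a sum of products of a coordinate
  of the derivative of \<open>F\<close> and a partial derivative of \<open>f\<close> composed with \<open>F\<close>, to which the induction
  hypothesis applies.
\<close>

lemma Ck_on_compose:
  fixes f :: "'b::euclidean_space \<Rightarrow> real" and F :: "'a::euclidean_space \<Rightarrow> 'b"
  assumes V: "subspace V" "openin (top_of_set V) S" and W: "subspace W" "openin (top_of_set W) T"
    and sub: "F ` S \<subseteq> T"
  shows "Ck_on k V S F \<Longrightarrow> Ck_on k W T f \<Longrightarrow> Ck_on k V S (\<lambda>x. f (F x))"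
proof (induction k arbitrary: f)
  case 0
  then show ?case using sub by (auto intro: continuous_on_compose2)
next
  case (Suc k)
  obtain B where B: "B \<subseteq> W" "finite B" "pairwise orthogonal B" "\<And>b. b \<in> B \<Longrightarrow> norm b = 1" "span B = W"
    using obtain_orthonormal_basis[OF W(1)] by metis
  show ?case
  proof (rule Ck_on_SucI)
    show "continuous_on S (\<lambda>x. f (F x))"
      using Suc.prems[THEN Ck_on_imp_continuous_on] sub by (auto intro: continuous_on_compose2)
    fix v assume v: "v \<in> V"
    obtain F' where F': "\<And>x. x \<in> S \<Longrightarrow> ((\<lambda>t. F (x + t *\<^sub>R v)) has_vector_derivative F' x) (at 0)" "Ck_on k V S F'"
      using Ck_on_SucE[OF Suc.prems(1) v] by blast
    have f1: "Ck_on (Suc 0) W T f"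
      using Suc.prems(2) by (induction k) (auto intro: Ck_on_SucD simp del: Ck_on.simps)
    have der: "((\<lambda>t. f (F (x + t *\<^sub>R v))) has_vector_derivative (\<Sum>b\<in>B. (F' x \<bullet> b) *\<^sub>R dir_deriv f b (F x))) (at 0)"
      if x: "x \<in> S" for x
      using line_derivative_chain[OF V x v sub C1_has_derivative_within[OF W f1 _ B] F'(1)[OF x]]
        x sub by blast
    have Ck: "Ck_on k V S (\<lambda>x. \<Sum>b\<in>B. (F' x \<bullet> b) *\<^sub>R dir_deriv f b (F x))"
    proof (rule Ck_on_sum[OF B(2)])
      fix b assume b: "b \<in> B"
      have "Ck_on k W T (dir_deriv f b)"
        using Suc.prems(2) b B(1) unfolding Ck_on_Suc[OF W] by blast
      then have "Ck_on k V S (\<lambda>x. dir_deriv f b (F x))"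
        by (intro Suc.IH Ck_on_SucD[OF Suc.prems(1)])
      moreover have "Ck_on k V S (\<lambda>x. F' x \<bullet> b)"
        by (rule Ck_on_bounded_linear[OF bounded_linear_inner_left F'(2)])
      ultimately show "Ck_on k V S (\<lambda>x. (F' x \<bullet> b) *\<^sub>R dir_deriv f b (F x))"
        by (simp add: Ck_on_mult)
    qed
    show "\<exists>f'. (\<forall>x\<in>S. ((\<lambda>t. f (F (x + t *\<^sub>R v))) has_vector_derivative f' x) (at 0)) \<and> Ck_on k V S f'"
      by (intro exI[of _ "\<lambda>x. \<Sum>b\<in>B. (F' x \<bullet> b) *\<^sub>R dir_deriv f b (F x)"] conjI ballI der Ck)
  qed
qed

lemma Ck_on_slice_snd:
  fixes F :: "'a::euclidean_space \<times> 'b::euclidean_space \<Rightarrow> 'f::real_normed_vector"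
  assumes "0 \<in> V"
  shows "Ck_on k (V \<times> W) S F \<Longrightarrow> Ck_on k W {b. (a, b) \<in> S} (\<lambda>b. F (a, b))"
proof (induction k arbitrary: F)
  case 0
  then show ?case by (auto intro!: continuous_on_compose2[of S F] continuous_intros)
next
  case (Suc k)
  show ?case
  proof (rule Ck_on_SucI)
    show "continuous_on {b. (a, b) \<in> S} (\<lambda>b. F (a, b))"
      using Ck_on_imp_continuous_on[OF Suc.prems]
      by (auto intro!: continuous_on_compose2[of S F] continuous_intros)
    fix w assume w: "w \<in> W"
    have "(0, w) \<in> V \<times> W" using w assms by simp
    from Ck_on_SucE[OF Suc.prems this] obtain F' where
      F': "\<And>x. x \<in> S \<Longrightarrow> ((\<lambda>t. F (x + t *\<^sub>R (0, w))) has_vector_derivative F' x) (at 0)" "Ck_on k (V \<times> W) S F'"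
      by blast
    show "\<exists>f'. (\<forall>x\<in>{b. (a, b) \<in> S}. ((\<lambda>t. F (a, x + t *\<^sub>R w)) has_vector_derivative f' x) (at 0)) \<and>
       Ck_on k W {b. (a, b) \<in> S} f'"
      using F'(1)[of "(a, _)"] Suc.IH[OF F'(2)] by (intro exI[of _ "\<lambda>b. F' (a, b)"]) auto
  qed
qed

lemma Ck_on_slice_fst:
  fixes F :: "'a::euclidean_space \<times> 'b::euclidean_space \<Rightarrow> 'f::real_normed_vector"
  assumes "0 \<in> W"
  shows "Ck_on k (V \<times> W) S F \<Longrightarrow> Ck_on k V {a. (a, b) \<in> S} (\<lambda>a. F (a, b))"
proof (induction k arbitrary: F)
  case 0
  then show ?case by (auto intro!: continuous_on_compose2[of S F] continuous_intros)
next
  case (Suc k)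
  show ?case
  proof (rule Ck_on_SucI)
    show "continuous_on {a. (a, b) \<in> S} (\<lambda>a. F (a, b))"
      using Ck_on_imp_continuous_on[OF Suc.prems]
      by (auto intro!: continuous_on_compose2[of S F] continuous_intros)
    fix v assume v: "v \<in> V"
    have "(v, 0) \<in> V \<times> W" using v assms by simp
    from Ck_on_SucE[OF Suc.prems this] obtain F' where
      F': "\<And>x. x \<in> S \<Longrightarrow> ((\<lambda>t. F (x + t *\<^sub>R (v, 0))) has_vector_derivative F' x) (at 0)" "Ck_on k (V \<times> W) S F'"
      by blast
    show "\<exists>f'. (\<forall>x\<in>{a. (a, b) \<in> S}. ((\<lambda>t. F (x + t *\<^sub>R v, b)) has_vector_derivative f' x) (at 0)) \<and>
       Ck_on k V {a. (a, b) \<in> S} f'"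
      using F'(1)[of "(_, b)"] Suc.IH[OF F'(2)] by (intro exI[of _ "\<lambda>a. F' (a, b)"]) auto
  qed
qed


section \<open>Manifolds and Lie groups\<close>

lemma Ck_on_linear:
  assumes L: "bounded_linear L" shows "Ck_on k V S L"
proof (cases k)
  case 0
  then show ?thesis using L by (simp add: linear_continuous_on)
next
  case (Suc k')
  have "((\<lambda>t. L (x + t *\<^sub>R v)) has_vector_derivative L v) (at 0)" for x v
  proof (rule bounded_linear.has_vector_derivative[OF L])
    show "((\<lambda>t. x + t *\<^sub>R v) has_vector_derivative v) (at 0)"
      by (auto intro!: derivative_eq_intros)
  qed
  then have "\<exists>f'. (\<forall>x\<in>S. ((\<lambda>t. L (x + t *\<^sub>R v)) has_vector_derivative f' x) (at 0)) \<and> Ck_on k' V S f'" for v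
    by (intro exI[of _ "\<lambda>_. L v"] conjI ballI Ck_on_const)
  then have "Ck_on (Suc k') V S L"
    by (intro Ck_on_SucI linear_continuous_on[OF L])
  then show ?thesis using Suc by simp
qed

lemma Ck_on_snd_compose:
  fixes m :: "'b::euclidean_space \<Rightarrow> 'f::real_normed_vector" and S :: "'a::euclidean_space set"
  shows "Ck_on k W T m \<Longrightarrow> Ck_on k (V \<times> W) (S \<times> T) (\<lambda>p. m (snd p))"
proof (induction k arbitrary: m)
  case 0
  then show ?case by (auto intro!: continuous_on_compose2[of T m] continuous_intros)
next
  case (Suc k)
  show ?case
  proof (rule Ck_on_SucI)
    show "continuous_on (S \<times> T) (\<lambda>p. m (snd p))"
      using Ck_on_imp_continuous_on[OF Suc.prems]
      by (auto intro!: continuous_on_compose2[of T m] continuous_intros)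
    fix v assume "v \<in> V \<times> W"
    then have "snd v \<in> W" by auto
    from Ck_on_SucE[OF Suc.prems this] obtain m' where
      m': "\<And>x. x \<in> T \<Longrightarrow> ((\<lambda>t. m (x + t *\<^sub>R snd v)) has_vector_derivative m' x) (at 0)" "Ck_on k W T m'"
      by blast
    show "\<exists>f'. (\<forall>x\<in>S \<times> T. ((\<lambda>t. m (snd (x + t *\<^sub>R v))) has_vector_derivative f' x) (at 0)) \<and>
       Ck_on k (V \<times> W) (S \<times> T) f'"
      using m'(1) Suc.IH[OF m'(2)] by (intro exI[of _ "\<lambda>p. m' (snd p)"]) auto
  qed
qed

lemma smooth_manifold_chart:
  assumes M: "smooth_manifold M" and c: "(U, \<phi>) \<in> atlas M"
  shows "open U" "openin (top_of_set (model_space M)) (\<phi> ` U)"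
    "homeomorphism U (\<phi> ` U) \<phi> (inv_into U \<phi>)" "inj_on \<phi> U"
proof -
  show *: "open U" "openin (top_of_set (model_space M)) (\<phi> ` U)"
    "homeomorphism U (\<phi> ` U) \<phi> (inv_into U \<phi>)"
    using assms unfolding smooth_manifold_def by fast+
  show "inj_on \<phi> U" using *(3) by (auto simp: homeomorphism_def intro: inj_on_inverseI)
qed

lemma smooth_manifold_covers:
  assumes M: "smooth_manifold M" obtains U \<phi> where "(U, \<phi>) \<in> atlas M" "x \<in> U"
proof -
  have "x \<in> (\<Union>(U, \<phi>)\<in>atlas M. U)" using M unfolding smooth_manifold_def by simp
  then show ?thesis using that by auto
qed

lemma smooth_manifold_subspace: "smooth_manifold M \<Longrightarrow> subspace (model_space M)"
  by (simp add: smooth_manifold_def)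

lemma chart_image_openin:
  assumes M: "smooth_manifold M" and c: "(U, \<phi>) \<in> atlas M" and Op: "open Op"
  shows "openin (top_of_set (model_space M)) (\<phi> ` (U \<inter> Op))"
proof -
  note chart = smooth_manifold_chart[OF M c]
  have "openin (top_of_set U) (U \<inter> Op)" using Op by (rule openin_open_Int)
  from homeomorphism_imp_open_map[OF chart(3) this] chart(2) show ?thesis
    by (rule openin_trans)
qed

lemma manifold_compact_neighbourhood:
  fixes M :: "('x::{second_countable_topology,t2_space}, 'e::euclidean_space) manifold"
  assumes M: "smooth_manifold M"
  shows "\<exists>U K. open U \<and> compact K \<and> (x :: 'x) \<in> U \<and> U \<subseteq> K"
proof -
  obtain C \<phi> where c: "(C, \<phi>) \<in> atlas M" and x: "x \<in> C" using smooth_manifold_covers[OF M] .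
  note chart = smooth_manifold_chart[OF M c]
  obtain T where T: "open T" "\<phi> ` C = model_space M \<inter> T" using chart(2) by (auto simp: openin_open)
  then obtain e where e: "e > 0" "cball (\<phi> x) e \<subseteq> T"
    using x open_contains_cball by (metis Int_iff imageI)
  let ?K = "cball (\<phi> x) e \<inter> model_space M"
  have K: "?K \<subseteq> \<phi> ` C" using e T by auto
  have "closed (model_space M)" by (intro closed_subspace smooth_manifold_subspace M)
  then have "compact ?K" by (intro compact_Int_closed) auto
  then have "compact (inv_into C \<phi> ` ?K)"
    using chart(3) K by (intro compact_continuous_image) (auto simp: homeomorphism_def intro: continuous_on_subset)
  moreover have "open (C \<inter> \<phi> -` ball (\<phi> x) e)"
    using chart(1,3) by (intro continuous_open_preimage) (auto simp: homeomorphism_def)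
  moreover have "C \<inter> \<phi> -` ball (\<phi> x) e \<subseteq> inv_into C \<phi> ` ?K"
  proof
    fix y assume y: "y \<in> C \<inter> \<phi> -` ball (\<phi> x) e"
    then have "\<phi> y \<in> ?K" using T by (auto simp: dist_commute)
    then show "y \<in> inv_into C \<phi> ` ?K" using y chart(4) by (intro image_eqI[of _ _ "\<phi> y"]) auto
  qed
  ultimately show ?thesis using x e(1) by (intro exI[of _ "C \<inter> \<phi> -` ball (\<phi> x) e"] exI[of _ "inv_into C \<phi> ` ?K"]) auto
qed

lemma manifold_compact_closure:
  fixes M :: "('x::{second_countable_topology,t2_space}, 'e::euclidean_space) manifold"
  assumes M: "smooth_manifold M"
  shows "\<exists>U. open U \<and> (x :: 'x) \<in> U \<and> compact (closure U)"
proof -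
  obtain U K where U: "open U" "compact K" "x \<in> U" "U \<subseteq> K"
    using manifold_compact_neighbourhood[OF M] by blast
  have "closure U \<subseteq> K" using U by (intro closure_minimal compact_imp_closed)
  then have "compact (closure U)" using compact_Int_closed[OF U(2) closed_closure[of U]] by (simp add: inf.absorb2)
  then show ?thesis using U by blast
qed

lemma manifold_regular_space:
  fixes M :: "('x::{second_countable_topology,t2_space}, 'e::euclidean_space) manifold"
  assumes M: "smooth_manifold M"
  shows "regular_space (euclidean :: 'x topology)"
proof (rule locally_compact_Hausdorff_imp_regular_space)
  show "locally_compact_space (euclidean :: 'x topology)"
    using manifold_compact_neighbourhood[OF M] by (auto simp: locally_compact_space_def)
  show "Hausdorff_space (euclidean :: 'x topology)"
    using hausdorff[where 'a='x] by (auto simp: Hausdorff_space_def disjnt_def)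
qed

lemma lie_group_continuous:
  assumes "lie_group G M"
  shows "continuous_on UNIV (\<lambda>(g, h). g \<otimes>\<^bsub>G\<^esub> h)" "continuous_on UNIV (\<lambda>g. inv\<^bsub>G\<^esub> g)"
  using assms by (auto simp: lie_group_def smooth_map_def)

lemma lie_group_translation_continuous:
  assumes "lie_group G M"
  shows "continuous_on UNIV (\<lambda>g. h \<otimes>\<^bsub>G\<^esub> g)" "continuous_on UNIV (\<lambda>g. g \<otimes>\<^bsub>G\<^esub> h)"
proof -
  have "continuous_on UNIV (\<lambda>g. (h, g))" "continuous_on UNIV (\<lambda>g. (g, h))"
    by (intro continuous_on_Pair continuous_on_const continuous_on_id)+
  from this[THEN continuous_on_compose2[OF lie_group_continuous(1)[OF assms]]]
  show "continuous_on UNIV (\<lambda>g. h \<otimes>\<^bsub>G\<^esub> g)" "continuous_on UNIV (\<lambda>g. g \<otimes>\<^bsub>G\<^esub> h)" by simp_all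
qed

lemma inv_into_map_prod:
  assumes "inj_on \<phi> U" "inj_on \<psi> U'" "a \<in> \<phi> ` U" "b \<in> \<psi> ` U'"
  shows "inv_into (U \<times> U') (map_prod \<phi> \<psi>) (a, b) = (inv_into U \<phi> a, inv_into U' \<psi> b)"
  using assms by (intro inv_into_f_eq) (auto simp: map_prod_inj_on f_inv_into_f inv_into_into)

text \<open>
  This is smoothness of the multiplication in a product chart, with the inverse of the product
  chart written as a pair of inverses.
\<close>

lemma lie_group_mult_in_charts:
  assumes G: "lie_group G M" and c: "(U, \<phi>) \<in> atlas M" "(U', \<psi>) \<in> atlas M" "(U'', \<rho>) \<in> atlas M"
  shows "Ck_on k (model_space M \<times> model_space M)
    (map_prod \<phi> \<psi> ` {(g, h). g \<in> U \<and> h \<in> U' \<and> g \<otimes>\<^bsub>G\<^esub> h \<in> U''})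
    (\<lambda>(a, b). \<rho> (inv_into U \<phi> a \<otimes>\<^bsub>G\<^esub> inv_into U' \<psi> b))"
proof -
  let ?V = "model_space M"
  have M: "smooth_manifold M" using G by (simp add: lie_group_def)
  note chart = smooth_manifold_chart[OF M c(1)] smooth_manifold_chart[OF M c(2)]
  have prod: "(U \<times> U', map_prod \<phi> \<psi>) \<in> atlas (product_manifold M M)"
    using c by (auto simp: product_manifold_def)
  let ?m = "\<lambda>(g, h). g \<otimes>\<^bsub>G\<^esub> h"
  let ?S = "map_prod \<phi> \<psi> ` (U \<times> U' \<inter> ?m -` U'')"
  have S: "?S = map_prod \<phi> \<psi> ` {(g, h). g \<in> U \<and> h \<in> U' \<and> g \<otimes>\<^bsub>G\<^esub> h \<in> U''}" by auto
  have ms: "model_space (product_manifold M M) = ?V \<times> ?V" by (simp add: product_manifold_def)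
  have Ck: "Ck_on k (?V \<times> ?V) ?S (\<rho> \<circ> ?m \<circ> inv_into (U \<times> U') (map_prod \<phi> \<psi>))"
    using G prod c(3) unfolding lie_group_def smooth_map_def smooth_rel_def ms[symmetric] by blast
  have hom: "homeomorphism (U \<times> U') (\<phi> ` U \<times> \<psi> ` U') (map_prod \<phi> \<psi>) (map_prod (inv_into U \<phi>) (inv_into U' \<psi>))"
  proof -
    have cont: "continuous_on (A \<times> A') (map_prod f f')"
      if "continuous_on A f" "continuous_on A' f'" for f f' A A'
      unfolding map_prod_def split_beta
      by (intro continuous_on_Pair continuous_on_compose2[OF that(1)] continuous_on_compose2[OF that(2)]
          continuous_on_fst continuous_on_snd continuous_on_id) auto
    have im: "map_prod f f' ` (A \<times> A') = f ` A \<times> f' ` A'" for f f' A A' by auto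
    show ?thesis
      using chart(3,7) unfolding homeomorphism_def im by (auto intro: cont)
  qed
  have "open (?m -` U'')"
    using smooth_manifold_chart(1)[OF M c(3)] lie_group_continuous(1)[OF G] open_vimage by blast
  then have "openin (top_of_set (U \<times> U')) (U \<times> U' \<inter> ?m -` U'')" by (rule openin_open_Int)
  from homeomorphism_imp_open_map[OF hom this] have "openin (top_of_set (\<phi> ` U \<times> \<psi> ` U')) ?S" .
  then have open_S: "openin (top_of_set (?V \<times> ?V)) ?S"
    by (rule openin_trans) (use chart(2,6) in \<open>simp add: openin_Times\<close>)
  have sub: "subspace (?V \<times> ?V)" by (intro subspace_Times smooth_manifold_subspace M)
  show ?thesis unfolding S[symmetric]
  proof (rule Ck_on_cong[OF sub open_S _ Ck], rule ballI)
    fix p assume "p \<in> ?S"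
    then obtain a b where "p = (a, b)" "a \<in> \<phi> ` U" "b \<in> \<psi> ` U'" by auto
    then show "(\<rho> \<circ> ?m \<circ> inv_into (U \<times> U') (map_prod \<phi> \<psi>)) p =
       (\<lambda>(a, b). \<rho> (inv_into U \<phi> a \<otimes>\<^bsub>G\<^esub> inv_into U' \<psi> b)) p"
      using inv_into_map_prod[OF chart(4) chart(8)] by simp
  qed
qed

text \<open>
  A translation is the multiplication with one of its arguments kept fixed, and partial smoothness
  in the other argument follows from \<open>Ck_on_slice_snd\<close> and \<open>Ck_on_slice_fst\<close>.
\<close>

lemma lie_group_translations_in_charts:
  assumes G: "lie_group G M" and c: "(U', \<psi>) \<in> atlas M" "(U'', \<rho>) \<in> atlas M"
  shows left_translation_in_charts:
      "Ck_on k (model_space M) (\<psi> ` (U' \<inter> {g. h \<otimes>\<^bsub>G\<^esub> g \<in> U''})) (\<lambda>b. \<rho> (h \<otimes>\<^bsub>G\<^esub> inv_into U' \<psi> b))"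
    and right_translation_in_charts:
      "Ck_on k (model_space M) (\<psi> ` (U' \<inter> {g. g \<otimes>\<^bsub>G\<^esub> h \<in> U''})) (\<lambda>b. \<rho> (inv_into U' \<psi> b \<otimes>\<^bsub>G\<^esub> h))"
proof -
  have M: "smooth_manifold M" using G by (simp add: lie_group_def)
  obtain U \<phi> where c0: "(U, \<phi>) \<in> atlas M" and h: "h \<in> U" using smooth_manifold_covers[OF M] .
  have inj: "inj_on \<phi> U" using smooth_manifold_chart[OF M c0] by simp
  have 0: "0 \<in> model_space M" by (intro subspace_0 smooth_manifold_subspace M)
  have "{b. (\<phi> h, b) \<in> map_prod \<phi> \<psi> ` {(g, k). g \<in> U \<and> k \<in> U' \<and> g \<otimes>\<^bsub>G\<^esub> k \<in> U''}}
    = \<psi> ` (U' \<inter> {g. h \<otimes>\<^bsub>G\<^esub> g \<in> U''})"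
    using h inj by (fastforce simp: image_iff inj_on_eq_iff)
  with Ck_on_slice_snd[OF 0 lie_group_mult_in_charts[OF G c0 c], of k "\<phi> h"]
  show "Ck_on k (model_space M) (\<psi> ` (U' \<inter> {g. h \<otimes>\<^bsub>G\<^esub> g \<in> U''})) (\<lambda>b. \<rho> (h \<otimes>\<^bsub>G\<^esub> inv_into U' \<psi> b))"
    using inj h by simp
  have "{b. (b, \<phi> h) \<in> map_prod \<psi> \<phi> ` {(g, k). g \<in> U' \<and> k \<in> U \<and> g \<otimes>\<^bsub>G\<^esub> k \<in> U''}}
    = \<psi> ` (U' \<inter> {g. g \<otimes>\<^bsub>G\<^esub> h \<in> U''})"
    using h inj by (fastforce simp: image_iff inj_on_eq_iff)
  with Ck_on_slice_fst[OF 0 lie_group_mult_in_charts[OF G c(1) c0 c(2)], of k "\<phi> h"]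
  show "Ck_on k (model_space M) (\<psi> ` (U' \<inter> {g. g \<otimes>\<^bsub>G\<^esub> h \<in> U''})) (\<lambda>b. \<rho> (inv_into U' \<psi> b \<otimes>\<^bsub>G\<^esub> h))"
    using inj h by simp
qed

text \<open>
  Near a point \<open>(x, g)\<close> a chart at \<open>h g\<close> can be used for the argument of \<open>f\<close>; in these coordinates
  \<open>act G h f\<close> is the composition of \<open>f\<close> with \<open>(a, b) \<mapsto> (a, m b)\<close>, where \<open>m\<close> is the translation by \<open>h\<close>.
\<close>

lemma smooth_function_act:
  fixes MX :: "('x::{second_countable_topology,t2_space}, 'm::euclidean_space) manifold"
    and MG :: "('g::{second_countable_topology,t2_space}, 'n::euclidean_space) manifold"
  assumes MX: "smooth_manifold MX" and G: "lie_group G MG"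
    and f: "smooth_function (product_manifold MX MG) f"
  shows "smooth_function (product_manifold MX MG) (act G h f)"
  unfolding smooth_function_def smooth_rel_def
proof (intro ballI allI, clarify)
  fix UU \<Phi> k assume "(UU, \<Phi>) \<in> atlas (product_manifold MX MG)"
  then obtain U \<phi> U' \<psi> where c: "(U, \<phi>) \<in> atlas MX" "(U', \<psi>) \<in> atlas MG"
    and UU: "UU = U \<times> U'" "\<Phi> = map_prod \<phi> \<psi>"
    by (auto simp: product_manifold_def)
  have MG: "smooth_manifold MG" using G by (simp add: lie_group_def)
  note chart = smooth_manifold_chart[OF MX c(1)] smooth_manifold_chart[OF MG c(2)]
  let ?V = "model_space MX" and ?W = "model_space MG"
  have sub: "subspace ?V" "subspace ?W" "subspace (?V \<times> ?W)"
    by (intro subspace_Times smooth_manifold_subspace MX MG)+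
  let ?S = "\<phi> ` U \<times> \<psi> ` U'"
  have S: "\<Phi> ` UU = ?S" by (auto simp: UU)
  have open_S: "openin (top_of_set (?V \<times> ?W)) ?S" using chart by (simp add: openin_Times)
  have "Ck_on k (?V \<times> ?W) ?S (act G h f \<circ> inv_into UU \<Phi>)"
  proof (rule Ck_on_local[OF sub(3) open_S])
    fix p assume "p \<in> ?S"
    then obtain x g where p: "p = (\<phi> x, \<psi> g)" "x \<in> U" "g \<in> U'" by auto
    obtain U'' \<rho> where c'': "(U'', \<rho>) \<in> atlas MG" and hg: "h \<otimes>\<^bsub>G\<^esub> g \<in> U''"
      using smooth_manifold_covers[OF MG] .
    note chart'' = smooth_manifold_chart[OF MG c'']
    let ?T = "\<psi> ` (U' \<inter> {g. h \<otimes>\<^bsub>G\<^esub> g \<in> U''})"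
    define m where "m = (\<lambda>b. \<rho> (h \<otimes>\<^bsub>G\<^esub> inv_into U' \<psi> b))"
    have m: "Ck_on k ?W ?T m"
      unfolding m_def by (rule left_translation_in_charts[OF G c(2) c''])
    have "open {g. h \<otimes>\<^bsub>G\<^esub> g \<in> U''}"
      using open_vimage[OF chart''(1) lie_group_translation_continuous(1)[OF G]] by (simp add: vimage_def)
    then have T: "openin (top_of_set ?W) ?T" by (rule chart_image_openin[OF MG c(2)])
    have open_S': "openin (top_of_set (?V \<times> ?W)) (\<phi> ` U \<times> ?T)"
      using chart(2) T by (simp add: openin_Times)
    \<comment> \<open>A sum of compositions with bounded linear maps, to which the rules for \<open>Ck_on\<close> apply.\<close>
    define F where "F = (\<lambda>p :: 'm \<times> 'n. (fst p, 0 :: 'n) + (0 :: 'm, m (snd p)))"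
    have F: "Ck_on k (?V \<times> ?W) (\<phi> ` U \<times> ?T) F"
      unfolding F_def
      by (intro Ck_on_add Ck_on_linear Ck_on_bounded_linear[of "\<lambda>c. (0, c)"] Ck_on_snd_compose m
          bounded_linear_Pair bounded_linear_fst bounded_linear_zero bounded_linear_ident)
    let ?T2 = "\<phi> ` U \<times> \<rho> ` U''"
    have T2: "openin (top_of_set (?V \<times> ?W)) ?T2"
      using chart(2) chart''(2) by (simp add: openin_Times)
    have F_sub: "F ` (\<phi> ` U \<times> ?T) \<subseteq> ?T2"
      using chart(8) by (auto simp: F_def m_def)
    have prod: "(U \<times> U'', map_prod \<phi> \<rho>) \<in> atlas (product_manifold MX MG)"
      using c(1) c'' by (auto simp: product_manifold_def)
    have "Ck_on k (model_space (product_manifold MX MG)) (map_prod \<phi> \<rho> ` (U \<times> U''))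
       (f \<circ> inv_into (U \<times> U'') (map_prod \<phi> \<rho>))"
      using f prod unfolding smooth_function_def smooth_rel_def by blast
    moreover have "map_prod \<phi> \<rho> ` (U \<times> U'') = ?T2" by auto
    ultimately have "Ck_on k (?V \<times> ?W) ?T2 (f \<circ> inv_into (U \<times> U'') (map_prod \<phi> \<rho>))"
      by (simp add: product_manifold_def)
    then have Ck: "Ck_on k (?V \<times> ?W) (\<phi> ` U \<times> ?T) (\<lambda>p. (f \<circ> inv_into (U \<times> U'') (map_prod \<phi> \<rho>)) (F p))"
      by (rule Ck_on_compose[OF sub(3) open_S' sub(3) T2 F_sub F])
    have "Ck_on k (?V \<times> ?W) (\<phi> ` U \<times> ?T) (act G h f \<circ> inv_into UU \<Phi>)"
    proof (rule Ck_on_cong[OF sub(3) open_S' _ Ck], rule ballI)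
      fix p assume "p \<in> \<phi> ` U \<times> ?T"
      then obtain x g where p: "p = (\<phi> x, \<psi> g)" "x \<in> U" "g \<in> U'" "h \<otimes>\<^bsub>G\<^esub> g \<in> U''" by auto
      have "F p = (\<phi> x, \<rho> (h \<otimes>\<^bsub>G\<^esub> g))" using p chart(8) by (simp add: F_def m_def)
      then have "inv_into (U \<times> U'') (map_prod \<phi> \<rho>) (F p) = (x, h \<otimes>\<^bsub>G\<^esub> g)"
        using inv_into_map_prod[OF chart(4) chart''(4)] p chart chart'' by simp
      moreover have "inv_into UU \<Phi> p = (x, g)"
        unfolding UU using inv_into_map_prod[OF chart(4) chart(8)] p chart by simp
      ultimately show "(f \<circ> inv_into (U \<times> U'') (map_prod \<phi> \<rho>)) (F p) = (act G h f \<circ> inv_into UU \<Phi>) p"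
        by (simp add: act_def)
    qed
    then show "\<exists>S'. p \<in> S' \<and> S' \<subseteq> ?S \<and> openin (top_of_set (?V \<times> ?W)) S' \<and>
        Ck_on k (?V \<times> ?W) S' (act G h f \<circ> inv_into UU \<Phi>)"
      using open_S' p hg by (intro exI[of _ "\<phi> ` U \<times> ?T"]) auto
  qed
  then show "Ck_on k (model_space (product_manifold MX MG)) (\<Phi> ` UU) (act G h f \<circ> inv_into UU \<Phi>)"
    unfolding S by (simp add: product_manifold_def)
qed


section \<open>A quasi-invariant measure on a Lie group\<close>

text \<open>
  Composition with \<open>p\<close> extends maps from the model space to the ambient Euclidean space, where
  Lebesgue measure is available.
\<close>

lemma orthogonal_retraction:
  fixes V :: "'e::euclidean_space set"
  assumes V: "subspace V"
  obtains p :: "'e \<Rightarrow> 'e" where "bounded_linear p" "range p \<subseteq> V" "\<And>x. x \<in> V \<Longrightarrow> p x = x"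
proof -
  obtain B where B: "B \<subseteq> V" "finite B" "pairwise orthogonal B" "\<And>b. b \<in> B \<Longrightarrow> norm b = 1" "span B = V"
    using obtain_orthonormal_basis[OF V] by metis
  show ?thesis
  proof (rule that[of "\<lambda>x. \<Sum>b\<in>B. (x \<bullet> b) *\<^sub>R b"])
    show "bounded_linear (\<lambda>x. \<Sum>b\<in>B. (x \<bullet> b) *\<^sub>R b)"
      by (intro bounded_linear_sum bounded_linear_scaleR_const bounded_linear_inner_left)
    show "range (\<lambda>x. \<Sum>b\<in>B. (x \<bullet> b) *\<^sub>R b) \<subseteq> V"
      using B(1) by (auto intro!: subspace_sum[OF V] subspace_scale[OF V])
    show "(\<Sum>b\<in>B. (x \<bullet> b) *\<^sub>R b) = x" if "x \<in> V" for x
      using orthonormal_expansion[OF B(2,3,4)] that B(5) by auto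
  qed
qed

lemma countable_atlas:
  fixes M :: "('x::{second_countable_topology,t2_space}, 'e::euclidean_space) manifold"
  assumes M: "smooth_manifold M"
  obtains c :: "nat \<Rightarrow> 'x set \<times> ('x \<Rightarrow> 'e)" where "\<And>i. c i \<in> atlas M" "(\<Union>i. fst (c i)) = UNIV"
proof -
  let ?F = "fst ` atlas M"
  have "open S" if "S \<in> ?F" for S using smooth_manifold_chart(1)[OF M] that by auto
  then obtain F' where F': "F' \<subseteq> ?F" "countable F'" "\<Union>F' = \<Union>?F"
    using Lindelof by metis
  have cov: "\<Union>?F = UNIV"
    using smooth_manifold_covers[OF M] by (metis UNIV_eq_I UnionI fst_conv imageI)
  have ne: "F' \<noteq> {}" using F'(3) cov by auto
  have "\<exists>c. c \<in> atlas M \<and> fst c = from_nat_into F' i" for i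
    using subsetD[OF F'(1) from_nat_into[OF ne, of i]] by (metis imageE)
  then obtain c where c: "\<And>i. c i \<in> atlas M \<and> fst (c i) = from_nat_into F' i" by metis
  have "(\<Union>i. fst (c i)) = \<Union>F'"
    using c range_from_nat_into[OF ne F'(2)] by simp
  then show ?thesis using c F' cov that[of c] by simp
qed

text \<open>
  Only the null sets matter.  On the disjoint union of the domains \<open>S i\<close>, Lebesgue measure is
  sigma-finite, so multiplying it by a strictly positive integrable density makes it finite
  without changing the null sets.
\<close>

lemma finite_measure_from_charts:
  fixes S :: "nat \<Rightarrow> 'e::euclidean_space set" and \<Psi> :: "nat \<Rightarrow> 'e \<Rightarrow> 'g::topological_space"
  assumes S: "\<And>i. open (S i)" "S i0 \<noteq> {}" and cont: "\<And>i. continuous_on (S i) (\<Psi> i)"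
  obtains \<nu> :: "'g measure" where "prob_space \<nu>" "sets \<nu> = sets borel"
    "\<And>N. N \<in> sets borel \<Longrightarrow> N \<in> null_sets \<nu> \<longleftrightarrow> (\<forall>i. {y \<in> S i. \<Psi> i y \<in> N} \<in> null_sets lborel)"
proof -
  define M where "M = (count_space (UNIV :: nat set) \<Otimes>\<^sub>M (lborel :: 'e measure))"
  interpret C: sigma_finite_measure "count_space (UNIV :: nat set)"
    by (rule sigma_finite_measure_count_space)
  interpret CL: pair_sigma_finite "count_space (UNIV :: nat set)" "lborel :: 'e measure" ..
  interpret M: sigma_finite_measure M unfolding M_def ..
  obtain h where h: "h \<in> borel_measurable M" "integral\<^sup>N M h \<noteq> \<infinity>" "\<And>z. z \<in> space M \<Longrightarrow> 0 < h z \<and> h z < \<infinity>"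
    using M.Ex_finite_integrable_function by auto
  have spM: "space M = UNIV" by (simp add: M_def space_pair_measure)
  define D where "D = {z. snd z \<in> S (fst z)}"
  define P where "P z = (if snd z \<in> S (fst z) then \<Psi> (fst z) (snd z) else undefined)" for z
  have Pm: "P \<in> M \<rightarrow>\<^sub>M borel"
    unfolding M_def
  proof (rule measurable_pair_measure_countable1)
    fix i :: nat
    have "(\<lambda>y. if y \<in> S i then \<Psi> i y else undefined) \<in> borel_measurable borel"
      using S(1) cont by (intro borel_measurable_continuous_on_if) auto
    then show "(\<lambda>y. P (i, y)) \<in> borel_measurable lborel"
      unfolding P_def fst_conv snd_conv by simp
  qed simp
  have section_measurable: "{z. (fst z, snd z) \<in> Collect (case_prod Q)} \<in> sets M"
    if "\<And>i. {y. Q i y} \<in> sets borel" for Q :: "nat \<Rightarrow> 'e \<Rightarrow> bool"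
  proof -
    have "(\<lambda>z. case_prod Q z) \<in> M \<rightarrow>\<^sub>M count_space UNIV" unfolding M_def
      by (rule measurable_pair_measure_countable1) (use that in \<open>auto simp: pred_def\<close>)
    then show ?thesis by (auto simp: pred_def spM split_beta)
  qed
  have DM: "D \<in> sets M"
    using section_measurable[of "\<lambda>i y. y \<in> S i"] S(1) by (auto simp: D_def split_beta)
  define w where "w z = h z * indicator D z" for z
  have w: "w \<in> borel_measurable M" unfolding w_def using h(1) DM by measurable
  define \<nu>1 where "\<nu>1 = distr (density M w) borel P"
  have null: "emeasure \<nu>1 N = 0 \<longleftrightarrow> (\<forall>i. {y \<in> S i. \<Psi> i y \<in> N} \<in> null_sets lborel)" if N: "N \<in> sets borel" for N
  proof -
    have PN: "P -` N \<in> sets M" using measurable_sets[OF Pm N] by (simp add: spM)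
    have sec: "{y. (i, y) \<in> D \<inter> P -` N} = {y \<in> S i. \<Psi> i y \<in> N}" for i
      by (auto simp: D_def P_def)
    have secm: "{y \<in> S i. \<Psi> i y \<in> N} \<in> sets borel" for i
      using sets_Pair1[of "D \<inter> P -` N" "count_space UNIV" lborel i] DM PN sec[of i]
      by (simp add: M_def vimage_def)
    have "emeasure \<nu>1 N = emeasure (density M w) (P -` N)"
      unfolding \<nu>1_def using Pm N by (subst emeasure_distr) (simp_all add: spM)
    also have "\<dots> = 0 \<longleftrightarrow> P -` N \<in> null_sets (density M w)"
      using PN by (auto simp: null_sets_def)
    also have "\<dots> \<longleftrightarrow> (AE z in M. z \<in> P -` N \<longrightarrow> w z = 0)"
      using PN by (simp add: null_sets_density_iff[OF w])
    also have "\<dots> \<longleftrightarrow> (AE z in M. z \<notin> D \<inter> P -` N)"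
      using h(3) by (intro AE_cong) (auto simp: w_def indicator_def less_le)
    also have "\<dots> \<longleftrightarrow> emeasure M (D \<inter> P -` N) = 0"
      using DM PN by (subst AE_iff_null_sets[symmetric]) auto
    also have "emeasure M (D \<inter> P -` N) = (\<integral>\<^sup>+i. emeasure lborel {y \<in> S i. \<Psi> i y \<in> N} \<partial>count_space UNIV)"
      unfolding M_def
      using DM PN lborel.emeasure_pair_measure_alt[of "D \<inter> P -` N" "count_space UNIV"] sec
      by (simp add: M_def vimage_def)
    also have "\<dots> = 0 \<longleftrightarrow> (\<forall>i. {y \<in> S i. \<Psi> i y \<in> N} \<in> null_sets lborel)"
      using secm by (subst nn_integral_0_iff_AE) (auto simp: AE_count_space null_sets_def)
    finally show ?thesis .
  qed
  have sp1: "space \<nu>1 = UNIV" "sets \<nu>1 = sets borel" by (simp_all add: \<nu>1_def)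
  have ne0: "emeasure \<nu>1 UNIV \<noteq> 0"
  proof
    assume "emeasure \<nu>1 UNIV = 0"
    then have "S i0 \<in> null_sets lborel" using null[of UNIV] by simp
    then have "negligible (S i0)" by (auto simp: negligible_iff_null_sets null_sets_completionI)
    then show False using open_not_negligible[OF S] by simp
  qed
  have fin: "emeasure \<nu>1 UNIV \<noteq> \<infinity>"
  proof -
    have "emeasure \<nu>1 UNIV = emeasure (density M w) UNIV"
      unfolding \<nu>1_def using Pm by (subst emeasure_distr) (simp_all add: spM)
    also have "\<dots> = (\<integral>\<^sup>+z. w z \<partial>M)"
      using w sets.top[of M] by (simp add: emeasure_density spM)
    also have "\<dots> \<le> integral\<^sup>N M h"
      by (intro nn_integral_mono) (auto simp: w_def indicator_def)
    finally show ?thesis using h(2) by (auto simp: top_unique)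
  qed
  let ?\<nu> = "uniform_measure \<nu>1 UNIV"
  show ?thesis
  proof (rule that[of ?\<nu>])
    show "prob_space ?\<nu>" using ne0 fin by (intro prob_space_uniform_measure)
    show "sets ?\<nu> = sets borel" using sp1 by simp
    fix N :: "'g set" assume N: "N \<in> sets borel"
    have "N \<in> null_sets ?\<nu> \<longleftrightarrow> emeasure \<nu>1 N = 0"
      using N sp1 fin by (auto simp: null_sets_def emeasure_uniform_measure ennreal_divide_eq_0_iff)
    then show "N \<in> null_sets ?\<nu> \<longleftrightarrow> (\<forall>i. {y \<in> S i. \<Psi> i y \<in> N} \<in> null_sets lborel)"
      using null[OF N] by simp
  qed
qed

text \<open>
  The null sets are those whose preimages are Lebesgue null in all charts.  They are stable under
  translations because translations are differentiable in charts, and differentiable maps preserve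
  Lebesgue null sets.  The orthogonal complement of the model space is added to the coordinates, so
  that Lebesgue measure of the ambient space can be used whatever the dimension of the group.
\<close>

lemma quasi_invariant_measure:
  fixes M :: "('g::{second_countable_topology,t2_space}, 'e::euclidean_space) manifold"
  assumes G: "lie_group G M"
  obtains \<nu> :: "'g measure" where "prob_space \<nu>" "sets \<nu> = sets borel"
    "\<And>U. open U \<Longrightarrow> U \<noteq> {} \<Longrightarrow> U \<notin> null_sets \<nu>"
    "\<And>N g. N \<in> null_sets \<nu> \<Longrightarrow> {k. k \<otimes>\<^bsub>G\<^esub> g \<in> N} \<in> null_sets \<nu>"
proof -
  let ?V = "model_space M"
  have M: "smooth_manifold M" and grp: "group G" and UN: "carrier G = UNIV" using G by (auto simp: lie_group_def)
  interpret group G by fact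
  have V: "subspace ?V" by (rule smooth_manifold_subspace[OF M])
  obtain p where p: "bounded_linear p" "range p \<subseteq> ?V" "\<And>x. x \<in> ?V \<Longrightarrow> p x = x"
    using orthogonal_retraction[OF V] by metis
  interpret p: bounded_linear p by (rule p(1))
  obtain c :: "nat \<Rightarrow> 'g set \<times> ('g \<Rightarrow> 'e)" where
    c: "\<And>i. c i \<in> atlas M" "(\<Union>i. fst (c i)) = UNIV"
    using countable_atlas[OF M] by metis
  define U where "U i = fst (c i)" for i
  define \<phi> where "\<phi> i = snd (c i)" for i
  have atl: "(U i, \<phi> i) \<in> atlas M" for i using c(1)[of i] by (simp add: U_def \<phi>_def)
  note chart = smooth_manifold_chart[OF M atl]
  have U: "\<exists>i. g \<in> U i" for g using c(2) by (auto simp: U_def)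
  define S where "S i = p -` (\<phi> i ` U i)" for i
  define \<Psi> where "\<Psi> i y = inv_into (U i) (\<phi> i) (p y)" for i y
  have pV: "p y \<in> ?V" for y using p(2) by auto
  have S: "open (S i)" for i
  proof -
    obtain T where T: "open T" "\<phi> i ` U i = ?V \<inter> T" using chart(2)[of i] by (auto simp: openin_open)
    have "S i = p -` T" using T(2) pV by (auto simp: S_def)
    then show ?thesis using T(1) open_vimage[OF _ p.continuous_on[OF continuous_on_id]] by simp
  qed
  have contp: "continuous_on A p" for A using p.continuous_on[OF continuous_on_id] by simp
  have \<Psi>: "continuous_on (S i) (\<Psi> i)" for i
    unfolding \<Psi>_def using chart(3)[of i]
    by (intro continuous_on_compose2[OF _ contp, of "\<phi> i ` U i"]) (auto simp: homeomorphism_def S_def)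
  have \<phi>V: "\<phi> i g \<in> ?V" if "g \<in> U i" for i g
    using openin_imp_subset[OF chart(2)[of i]] that by auto
  have \<Psi>U: "\<Psi> i y \<in> U i" "\<phi> i (\<Psi> i y) = p y" if "y \<in> S i" for i y
    using that by (auto simp: S_def \<Psi>_def inv_into_into f_inv_into_f)
  have \<Psi>_eq: "y \<in> S i" "\<Psi> i y = g" if "g \<in> U i" "p y = \<phi> i g" for i g y
    using that chart(4)[of i] by (auto simp: S_def \<Psi>_def)
  obtain i0 where i0: "\<one>\<^bsub>G\<^esub> \<in> U i0" using U by blast
  have "\<phi> i0 \<one>\<^bsub>G\<^esub> \<in> S i0" using i0 \<phi>V p(3) by (simp add: S_def)
  then have ne: "S i0 \<noteq> {}" by auto
  obtain \<nu> :: "'g measure" where \<nu>: "prob_space \<nu>" "sets \<nu> = sets borel"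
    "\<And>N. N \<in> sets borel \<Longrightarrow> N \<in> null_sets \<nu> \<longleftrightarrow> (\<forall>i. {y \<in> S i. \<Psi> i y \<in> N} \<in> null_sets lborel)"
    using finite_measure_from_charts[of S i0 \<Psi>, OF S ne \<Psi>] by metis
  show ?thesis
  proof (rule that[OF \<nu>(1,2)])
    fix W :: "'g set" assume W: "open W" "W \<noteq> {}"
    show "W \<notin> null_sets \<nu>"
    proof
      assume "W \<in> null_sets \<nu>"
      then have *: "{y \<in> S i. \<Psi> i y \<in> W} \<in> null_sets lborel" for i using \<nu>(3)[of W] W by auto
      obtain g i where g: "g \<in> W" "g \<in> U i" using W U by blast
      have "open (S i \<inter> \<Psi> i -` W)" using S \<Psi> W by (intro continuous_open_preimage) auto
      moreover have "\<phi> i g \<in> S i \<inter> \<Psi> i -` W"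
        using \<Psi>_eq[OF g(2), of "\<phi> i g"] p(3)[OF \<phi>V[OF g(2)]] g by simp
      moreover have "negligible {y \<in> S i. \<Psi> i y \<in> W}"
        using *[of i] by (simp add: negligible_iff_null_sets null_sets_completionI)
      then have "negligible (S i \<inter> \<Psi> i -` W)" by (simp add: Int_def vimage_def)
      ultimately show False using open_not_negligible by blast
    qed
  next
    fix N g assume N: "N \<in> null_sets \<nu>"
    then have Nb: "N \<in> sets borel" using \<nu>(2) by auto
    have N0: "negligible {y \<in> S i. \<Psi> i y \<in> N}" for i
      using N \<nu>(3)[OF Nb] by (simp add: negligible_iff_null_sets null_sets_completionI)
    define N' where "N' = {k. k \<otimes>\<^bsub>G\<^esub> g \<in> N}"
    have "(\<lambda>k. k \<otimes>\<^bsub>G\<^esub> g) \<in> borel \<rightarrow>\<^sub>M borel"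
      using lie_group_translation_continuous(2)[OF G] by (rule borel_measurable_continuous_onI)
    from measurable_sets[OF this Nb] have N'b: "N' \<in> sets borel" by (simp add: N'_def vimage_def)
    have "{y \<in> S i. \<Psi> i y \<in> N'} \<in> null_sets lborel" for i
    proof -
      let ?X = "{y \<in> S i. \<Psi> i y \<in> N'}"
      define O' where "O' j = {y \<in> S j. \<Psi> j y \<in> N \<and> \<Psi> j y \<otimes>\<^bsub>G\<^esub> inv\<^bsub>G\<^esub> g \<in> U i}" for j
      \<comment> \<open>\<open>R j\<close> is the inverse right translation in the charts \<open>j\<close> and \<open>i\<close>, extended by the identity on the orthogonal complement.\<close>
      define R where "R j y = \<phi> i (\<Psi> j y \<otimes>\<^bsub>G\<^esub> inv\<^bsub>G\<^esub> g) + (y - p y)" for j y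
      have "negligible (R j ` O' j)" for j
      proof (rule negligible_differentiable_image_negligible)
        show "negligible (O' j)" by (rule negligible_subset[OF N0[of j]]) (auto simp: O'_def)
        define r where "r = (\<lambda>b. \<phi> i (inv_into (U j) (\<phi> j) b \<otimes>\<^bsub>G\<^esub> inv\<^bsub>G\<^esub> g))"
        let ?T = "\<phi> j ` (U j \<inter> {k. k \<otimes>\<^bsub>G\<^esub> inv\<^bsub>G\<^esub> g \<in> U i})"
        have r: "Ck_on (Suc 0) ?V ?T r"
          unfolding r_def by (rule right_translation_in_charts[OF G atl atl])
        have "open {k. k \<otimes>\<^bsub>G\<^esub> inv\<^bsub>G\<^esub> g \<in> U i}"
          using open_vimage[OF chart(1) lie_group_translation_continuous(2)[OF G]] by (simp add: vimage_def)
        then have T: "openin (top_of_set ?V) ?T" by (rule chart_image_openin[OF M atl])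
        have sub: "p ` O' j \<subseteq> ?T"
        proof
          fix b assume "b \<in> p ` O' j"
          then obtain y where y: "y \<in> O' j" "b = p y" by auto
          then have "b = \<phi> j (\<Psi> j y)" "\<Psi> j y \<in> U j" using \<Psi>U[of y j] by (auto simp: O'_def)
          then show "b \<in> ?T" using y by (auto simp: O'_def)
        qed
        obtain B where B: "B \<subseteq> ?V" "finite B" "pairwise orthogonal B" "\<And>b. b \<in> B \<Longrightarrow> norm b = 1" "span B = ?V"
          using obtain_orthonormal_basis[OF V] by metis
        show "R j differentiable_on O' j"
          unfolding differentiable_on_def
        proof
          fix y assume y: "y \<in> O' j"
          have "p y \<in> ?T" using sub y by auto
          note C1 = C1_has_derivative_within[OF V T r this B]
          have pd: "(p has_derivative p) (at y within O' j)"
            by (rule bounded_linear_imp_has_derivative[OF p(1)])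
          have "((\<lambda>y. r (p y)) has_derivative (\<lambda>h. \<Sum>b\<in>B. (p h \<bullet> b) *\<^sub>R dir_deriv r b (p y))) (at y within O' j)"
            by (rule has_derivative_in_compose[OF pd has_derivative_subset[OF C1 sub]])
          then have "(\<lambda>y. r (p y)) differentiable (at y within O' j)"
            unfolding differentiable_def by blast
          moreover have "p differentiable (at y within O' j)"
            using pd unfolding differentiable_def by blast
          ultimately show "R j differentiable (at y within O' j)"
            unfolding R_def r_def \<Psi>_def by (intro differentiable_add differentiable_diff) auto
        qed
      qed simp
      then have "negligible (\<Union>j. R j ` O' j)" by (intro negligible_countable_Union) auto
      moreover have "?X \<subseteq> (\<Union>j. R j ` O' j)"
      proof
        fix y assume y: "y \<in> ?X"
        define k where "k = \<Psi> i y \<otimes>\<^bsub>G\<^esub> g"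
        have k: "k \<in> N" using y by (simp add: N'_def k_def)
        have kg: "k \<otimes>\<^bsub>G\<^esub> inv\<^bsub>G\<^esub> g = \<Psi> i y" by (simp add: k_def m_assoc UN)
        obtain j where j: "k \<in> U j" using U by blast
        define y' where "y' = \<phi> j k + (y - p y)"
        have py': "p y' = \<phi> j k"
          by (simp add: y'_def p.add p.diff p(3) pV \<phi>V[OF j])
        note y'S = \<Psi>_eq[OF j py']
        have "y' \<in> O' j" using y'S k kg \<Psi>U[of y i] y by (simp add: O'_def)
        moreover have "R j y' = y"
          using \<Psi>U[of y i] y by (simp add: R_def y'S kg py') (simp add: y'_def)
        ultimately show "y \<in> (\<Union>j. R j ` O' j)" by (metis UNIV_I UN_I imageI)
      qed
      ultimately have "negligible ?X" by (rule negligible_subset)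
      moreover have "?X \<in> sets borel"
      proof -
        have "\<Psi> i \<in> borel_measurable (restrict_space borel (S i))"
          using \<Psi> by (rule borel_measurable_continuous_on_restrict)
        from measurable_sets[OF this N'b] S show ?thesis
          by (subst (asm) sets_restrict_space_iff) (auto simp: space_restrict_space vimage_def Int_def conj_commute)
      qed
      ultimately show ?thesis
        by (simp add: negligible_iff_null_sets null_sets_completion_iff)
    qed
    then show "{k. k \<otimes>\<^bsub>G\<^esub> g \<in> N} \<in> null_sets \<nu>"
      using \<nu>(3)[OF N'b] by (simp add: N'_def)
  qed
qed


section \<open>Path space\<close>

lemma regular_space_closure:
  assumes "regular_space (euclidean :: 'z::topological_space topology)" "open U" "z \<in> (U :: 'z set)"
  obtains V where "open V" "z \<in> V" "closure V \<subseteq> U"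
proof -
  have "closedin euclidean (- U)" "z \<in> topspace euclidean - (- U)"
    using assms by (auto simp: closed_closedin[symmetric])
  then obtain V W where VW: "open V" "open W" "z \<in> V" "- U \<subseteq> W" "disjnt V W"
    using assms(1) unfolding regular_space_def by (metis open_openin)
  then have "V \<subseteq> - W" "closed (- W)" by (auto simp: disjnt_def)
  then have "closure V \<subseteq> - W" by (rule closure_minimal)
  with VW show ?thesis by (intro that[of V]) auto
qed

lemma countable_basis_closure:
  assumes reg: "regular_space (euclidean :: 'z::second_countable_topology topology)"
  obtains \<B> :: "'z::second_countable_topology set set" where "countable \<B>" "\<And>B. B \<in> \<B> \<Longrightarrow> open B"
    "\<And>U z. open U \<Longrightarrow> z \<in> U \<Longrightarrow> \<exists>B\<in>\<B>. z \<in> B \<and> closure B \<subseteq> U"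
proof -
  obtain \<B> :: "'z set set" where \<B>: "countable \<B>" "topological_basis \<B>"
    using ex_countable_basis by auto
  show ?thesis
  proof (rule that[OF \<B>(1)])
    show "open B" if "B \<in> \<B>" for B using topological_basis_open[OF \<B>(2) that] .
    fix U and z :: 'z assume "open U" "z \<in> U"
    then obtain V where V: "open V" "z \<in> V" "closure V \<subseteq> U"
      using regular_space_closure[OF reg] by blast
    then obtain B where "B \<in> \<B>" "z \<in> B" "B \<subseteq> V"
      using topological_basisE[OF \<B>(2)] by blast
    then show "\<exists>B\<in>\<B>. z \<in> B \<and> closure B \<subseteq> U" using V closure_mono by blast
  qed
qed

lemma path_continuous: "\<omega> \<in> paths \<Longrightarrow> continuous_on {0..} \<omega>"
  by (simp add: paths_def)

lemma openin_path_topology_subset: "openin path_topology A \<Longrightarrow> A \<subseteq> paths"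
  using openin_subset[of path_topology A]
  by (auto simp: path_topology_def topology_generated_by_topspace)

lemma space_path_space [simp]: "space path_space = paths"
  unfolding path_space_def by (rule space_measure_of) (use openin_path_topology_subset in auto)

lemma sets_path_space: "sets path_space = sigma_sets paths {A. openin path_topology A}"
  unfolding path_space_def by (rule sets_measure_of) (use openin_path_topology_subset in auto)

lemma space_observed [simp]: "space (observed \<pi> T) = paths"
  unfolding observed_def by (rule space_measure_of) auto

lemma sets_observed:
  "sets (observed \<pi> T) = sigma_sets paths {{\<omega> \<in> paths. \<pi> (\<omega> s) \<in> B} | s B. s \<in> T \<and> B \<in> sets borel}"
  unfolding observed_def by (rule sets_measure_of) auto

lemma coordinate_measurable:
  fixes \<pi> :: "'z::topological_space \<Rightarrow> 'b::topological_space"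
  assumes "s \<in> T" shows "(\<lambda>\<omega>. \<pi> (\<omega> s)) \<in> observed \<pi> T \<rightarrow>\<^sub>M borel"
proof (rule measurableI)
  fix A assume "A \<in> sets (borel :: 'b measure)"
  moreover have "(\<lambda>\<omega>. \<pi> (\<omega> s)) -` A \<inter> space (observed \<pi> T) = {\<omega> \<in> paths. \<pi> (\<omega> s) \<in> A}" by auto
  ultimately show "(\<lambda>\<omega>. \<pi> (\<omega> s)) -` A \<inter> space (observed \<pi> T) \<in> sets (observed \<pi> T)"
    unfolding sets_observed using assms by (auto intro!: sigma_sets.Basic)
qed simp

lemma measurable_into_observed:
  assumes "\<And>\<omega>. \<omega> \<in> space N \<Longrightarrow> f \<omega> \<in> paths"
    and "\<And>s. s \<in> T \<Longrightarrow> (\<lambda>\<omega>. \<pi> (f \<omega> s)) \<in> N \<rightarrow>\<^sub>M borel"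
  shows "f \<in> N \<rightarrow>\<^sub>M observed \<pi> T"
proof (rule measurable_sigma_sets[OF sets_observed])
  fix y assume "y \<in> {{\<omega> \<in> paths. \<pi> (\<omega> s) \<in> B} | s B. s \<in> T \<and> B \<in> sets borel}"
  then obtain s B where y: "y = {\<omega> \<in> paths. \<pi> (\<omega> s) \<in> B}" "s \<in> T" "B \<in> sets borel" by auto
  have "f -` y \<inter> space N = (\<lambda>\<omega>. \<pi> (f \<omega> s)) -` B \<inter> space N" using assms(1) y by auto
  then show "f -` y \<inter> space N \<in> sets N" using measurable_sets[OF assms(2)[OF y(2)] y(3)] by simp
qed (use assms in auto)

lemma sets_observed_mono: "T \<subseteq> T' \<Longrightarrow> sets (observed \<pi> T) \<subseteq> sets (observed \<pi> T')"
  unfolding sets_observed by (intro sigma_sets_mono') auto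

lemma sets_observed_le_id:
  fixes \<pi> :: "'z::topological_space \<Rightarrow> 'y::topological_space"
  assumes "continuous_on UNIV \<pi>"
  shows "sets (observed \<pi> T) \<subseteq> sets (observed id T)"
proof -
  have \<pi>: "\<pi> \<in> borel \<rightarrow>\<^sub>M borel"
    using assms by (rule borel_measurable_continuous_onI)
  have "(\<lambda>\<omega>. \<omega>) \<in> observed id T \<rightarrow>\<^sub>M observed \<pi> T"
  proof (rule measurable_into_observed)
    fix s assume "s \<in> T"
    then show "(\<lambda>\<omega>. \<pi> (\<omega> s)) \<in> borel_measurable (observed id T)"
      using measurable_compose[OF coordinate_measurable[of s T id] \<pi>] by simp
  qed simp
  from measurable_sets[OF this] show ?thesis
    using sets.sets_into_space[of _ "observed \<pi> T"] by (auto simp: Int_absorb2)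
qed

text \<open>
  Take a path that maps a compact set \<open>K\<close> into an open set \<open>U\<close>.  By compactness \<open>K\<close> is covered by
  finitely many rational intervals that the path maps into basic open sets with closures in \<open>U\<close>, and
  every path with values in these closures on the intervals maps \<open>K\<close> into \<open>U\<close>.  So every open
  set of paths is a union of sets \<open>cap Q\<close>, and there are only countably many of them.  By continuity, having values in a closed set
  on an open interval is a condition on rational times.
\<close>

lemma sets_path_space_eq_observed:
  assumes reg: "regular_space (euclidean :: 'z::second_countable_topology topology)"
  shows "sets (path_space :: (real \<Rightarrow> 'z) measure) = sets (observed id {0..})"
proof
  let ?O = "observed id {0..} :: (real \<Rightarrow> 'z) measure"
  obtain \<B> :: "'z set set" where \<B>: "countable \<B>" "\<And>B. B \<in> \<B> \<Longrightarrow> open B"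
    "\<And>U z. open U \<Longrightarrow> z \<in> U \<Longrightarrow> \<exists>B\<in>\<B>. z \<in> B \<and> closure B \<subseteq> U"
    using countable_basis_closure[OF reg] by metis
  define I where "I = (\<rat> \<times> \<rat> :: (real \<times> real) set) \<times> \<B>"
  \<comment> \<open>The intervals are open, so that they cover the compact set, but the values lie in a closed set, so that rational times decide.\<close>
  define cyl where "cyl = (\<lambda>((a, b), B :: 'z set). {\<omega> \<in> paths. \<omega> ` ({a<..<b} \<inter> {0::real..}) \<subseteq> closure B})"
  define cap where "cap Q = paths \<inter> (\<Inter>i\<in>Q. cyl i)" for Q
  have I: "countable I" unfolding I_def using \<B>(1) by (intro countable_SIGMA countable_rat)
  have cyl: "cyl i \<in> sets ?O" for i
  proof -
    obtain a b B where i: "i = ((a, b), B)" by (metis surj_pair)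
    have "cyl i = paths \<inter> (\<Inter>q\<in>\<rat> \<inter> {a<..<b} \<inter> {0..}. {\<omega> \<in> paths. id (\<omega> q) \<in> closure B})"
    proof (intro equalityI subsetI)
      fix \<omega> assume \<omega>: "\<omega> \<in> paths \<inter> (\<Inter>q\<in>\<rat> \<inter> {a<..<b} \<inter> {0..}. {\<omega> \<in> paths. id (\<omega> q) \<in> closure B})"
      let ?S = "\<rat> \<inter> {a<..<b} \<inter> {0..}"
      have clS: "closure ?S \<subseteq> {0..}" by (intro closure_minimal) auto
      have "\<omega> ` closure ?S \<subseteq> closure B"
        using \<omega> by (intro image_closure_subset continuous_on_subset[OF path_continuous clS]) auto
      moreover have "t \<in> closure ?S" if t: "t \<in> {a<..<b} \<inter> {0..}" for t
        unfolding closure_approachable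
      proof (intro allI impI)
        fix e :: real assume "0 < e"
        then have "t < min (t + e) b" using t by auto
        then obtain q where "q \<in> \<rat>" "t < q" "q < min (t + e) b" using Rats_dense_in_real by blast
        then show "\<exists>y\<in>?S. dist y t < e" using t by (intro bexI[of _ q]) (auto simp: dist_real_def)
      qed
      ultimately show "\<omega> \<in> cyl i" using \<omega> by (auto simp: cyl_def i)
    qed (auto simp: cyl_def i)
    also have "\<dots> \<in> sets ?O"
    proof (cases "\<rat> \<inter> {a<..<b} \<inter> {0..} = {}")
      case False
      have "countable (\<rat> \<inter> {a<..<b} \<inter> {0::real..})"
        by (intro countable_Int1) (simp add: countable_rat)
      moreover have "{\<omega> \<in> paths. id (\<omega> q) \<in> closure B} \<in> sets ?O" if "0 \<le> q" for q
        unfolding sets_observed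
        by (rule sigma_sets.Basic) (use that in \<open>force intro!: exI[of _ q] exI[of _ "closure B"]\<close>)
      ultimately have "(\<Inter>q\<in>\<rat> \<inter> {a<..<b} \<inter> {0..}. {\<omega> \<in> paths. id (\<omega> q) \<in> closure B}) \<in> sets ?O"
        using False by (intro sets.countable_INT') auto
      then show ?thesis using sets.top[of ?O] by (intro sets.Int) simp_all
    qed (use sets.top[of ?O] in simp)
    finally show ?thesis .
  qed
  have local: "\<exists>Q. finite Q \<and> Q \<subseteq> I \<and> \<omega> \<in> cap Q \<and> cap Q \<subseteq> A"
    if "openin path_topology A" "\<omega> \<in> A" for A \<omega>
    using that unfolding path_topology_def openin_topology_generated_by_iff
  proof (induction A arbitrary: \<omega> rule: generate_topology_on.induct)
    case (Int A A')
    then obtain Q Q' where "finite Q" "Q \<subseteq> I" "\<omega> \<in> cap Q" "cap Q \<subseteq> A"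
      "finite Q'" "Q' \<subseteq> I" "\<omega> \<in> cap Q'" "cap Q' \<subseteq> A'" by (meson IntD1 IntD2)
    then show ?case by (intro exI[of _ "Q \<union> Q'"]) (auto simp: cap_def)
  next
    case (UN K)
    then show ?case by (meson UnionE Union_upper order_trans)
  next
    case (Basis A)
    then obtain K U where A: "A = {\<omega> \<in> paths. \<omega> ` K \<subseteq> U}" "compact K" "K \<subseteq> {0..}" "open U" by auto
    have \<omega>: "\<omega> \<in> paths" "\<omega> ` K \<subseteq> U" using Basis A by auto
    have ex: "\<exists>i\<in>I. t \<in> {fst (fst i)<..<snd (fst i)} \<and> \<omega> \<in> cyl i \<and> closure (snd i) \<subseteq> U" if t: "t \<in> K" for t
    proof -
      obtain B where B: "B \<in> \<B>" "\<omega> t \<in> B" "closure B \<subseteq> U" using \<B>(3) A(4) \<omega>(2) t by blast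
      have "continuous (at t within {0..}) \<omega>"
        using path_continuous[OF \<omega>(1)] t A(3) by (auto simp: continuous_on_eq_continuous_within)
      then have "\<forall>\<^sub>F u in at t within {0..}. \<omega> u \<in> B"
        using B(1,2) \<B>(2) unfolding continuous_within by (intro topological_tendstoD)
      then obtain d where d: "d > 0" "\<And>u. u \<ge> 0 \<Longrightarrow> dist u t < d \<Longrightarrow> u \<noteq> t \<Longrightarrow> \<omega> u \<in> B"
        unfolding eventually_at by auto
      obtain a where a: "a \<in> \<rat>" "t - d < a" "a < t" using Rats_dense_in_real[of "t - d" t] d by auto
      obtain b where b: "b \<in> \<rat>" "t < b" "b < t + d" using Rats_dense_in_real[of t "t + d"] d by auto
      have "\<omega> u \<in> B" if "u \<in> {a<..<b} \<inter> {0..}" for u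
        using d(2)[of u] B(2) that a b by (cases "u = t") (auto simp: dist_real_def)
      then have "\<omega> \<in> cyl ((a, b), B)" using \<omega> closure_subset by (fastforce simp: cyl_def)
      then show ?thesis using a b B by (intro bexI[of _ "((a, b), B)"]) (auto simp: I_def)
    qed
    then obtain i where i: "\<And>t. t \<in> K \<Longrightarrow> i t \<in> I \<and> t \<in> {fst (fst (i t))<..<snd (fst (i t))} \<and> \<omega> \<in> cyl (i t) \<and> closure (snd (i t)) \<subseteq> U"
      by metis
    obtain K' where K': "K' \<subseteq> K" "finite K'" "K \<subseteq> (\<Union>t\<in>K'. {fst (fst (i t))<..<snd (fst (i t))})"
      by (rule compactE_image[OF A(2), of K "\<lambda>t. {fst (fst (i t))<..<snd (fst (i t))}"]) (use i in auto)
    have "cap (i ` K') \<subseteq> A"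
    proof
      fix \<eta> assume \<eta>: "\<eta> \<in> cap (i ` K')"
      have "\<eta> u \<in> U" if u: "u \<in> K" for u
      proof -
        obtain t where t: "t \<in> K'" "u \<in> {fst (fst (i t))<..<snd (fst (i t))}" using K'(3) u by auto
        have "\<eta> \<in> cyl (i t)" using \<eta> t by (auto simp: cap_def)
        moreover obtain a b B where "i t = ((a, b), B)" by (metis surj_pair)
        moreover have "0 \<le> u" using u A(3) by auto
        ultimately have "\<eta> u \<in> closure (snd (i t))"
          using t(2) image_eqI[of "\<eta> u" \<eta> u "{a<..<b} \<inter> {0..}"] by (auto simp: cyl_def)
        then show ?thesis using i t(1) K'(1) by blast
      qed
      then show "\<eta> \<in> A" using \<eta> A by (auto simp: cap_def)
    qed
    then show ?case using K' i \<omega> by (intro exI[of _ "i ` K'"]) (auto simp: cap_def)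
  qed simp
  show "sets path_space \<subseteq> sets ?O"
    unfolding sets_path_space
  proof (rule sets.sigma_sets_subset[of _ ?O, simplified], rule subsetI)
    fix A :: "(real \<Rightarrow> 'z) set" assume "A \<in> {A. openin path_topology A}"
    then have A: "openin path_topology A" by simp
    let ?F = "{Q. finite Q \<and> Q \<subseteq> I \<and> cap Q \<subseteq> A}"
    have eq: "A = (\<Union>Q\<in>?F. cap Q)" using local[OF A] by blast
    have count: "countable ?F"
      by (rule countable_subset[OF _ countable_Collect_finite_subset[OF I]]) auto
    have cap: "cap Q \<in> sets ?O" if "finite Q" for Q
      unfolding cap_def using that
    proof (induction Q)
      case empty
      then show ?case using sets.top[of ?O] by (simp only: space_observed INT_empty Int_UNIV_right)
    next
      case (insert i Q)
      have "paths \<inter> (\<Inter>i\<in>insert i Q. cyl i) = cyl i \<inter> (paths \<inter> (\<Inter>i\<in>Q. cyl i))" by auto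
      then show ?case using sets.Int[OF cyl insert.IH] by (simp only:)
    qed
    show "A \<in> sets ?O"
      by (subst eq, rule sets.countable_UN'[OF count]) (auto intro: cap)
  qed
  show "sets ?O \<subseteq> sets path_space"
    unfolding sets_observed
  proof (rule sets.sigma_sets_subset[of _ path_space, simplified], rule subsetI)
    fix A assume "A \<in> {{\<omega> \<in> paths. id (\<omega> s) \<in> B} |s B. s \<in> {0..} \<and> B \<in> sets (borel :: 'z measure)}"
    then obtain s B where A: "A = {\<omega> \<in> paths. \<omega> s \<in> B}" "0 \<le> s" "B \<in> sets borel" by auto
    have "(\<lambda>\<omega>. \<omega> s) \<in> path_space \<rightarrow>\<^sub>M (borel :: 'z measure)"
    proof (rule borel_measurableI)
      fix U :: "'z set" assume U: "open U"
      have "(\<lambda>\<omega>. \<omega> s) -` U \<inter> space path_space = {\<omega> \<in> paths. \<omega> ` {s} \<subseteq> U}" by auto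
      moreover have "openin path_topology {\<omega> \<in> paths. \<omega> ` {s} \<subseteq> U}"
        unfolding path_topology_def using A(2) U
        by (intro topology_generated_by_Basis) (auto intro!: exI[of _ "{s}"] exI[of _ U])
      ultimately show "(\<lambda>\<omega>. \<omega> s) -` U \<inter> space path_space \<in> sets path_space"
        unfolding sets_path_space by (auto intro: sigma_sets.Basic)
    qed
    from measurable_sets[OF this A(3)] show "A \<in> sets path_space"
      by (auto simp: A(1) vimage_def Int_def conj_commute)
  qed
qed

lemma shift_in_paths:
  assumes "0 \<le> s" "\<omega> \<in> paths" shows "shift s \<omega> \<in> paths"
proof -
  have "continuous_on {0..} (\<lambda>t. \<omega> (t + s))"
    by (rule continuous_on_compose2[OF path_continuous[OF assms(2)]]) (use assms in \<open>auto intro!: continuous_intros\<close>)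
  then have "continuous_on {0..} (shift s \<omega>)"
    unfolding shift_def by (rule continuous_on_eq) simp
  then show ?thesis by (simp add: paths_def shift_def)
qed

lemma shift_apply [simp]: "0 \<le> t \<Longrightarrow> shift s \<omega> t = \<omega> (t + s)"
  by (simp add: shift_def)

lemma measurable_shift:
  assumes "0 \<le> s" "\<And>u. u \<in> T \<Longrightarrow> 0 \<le> u \<and> u + s \<in> T'"
  shows "shift s \<in> observed \<pi> T' \<rightarrow>\<^sub>M observed \<pi> T"
proof (rule measurable_into_observed)
  fix u assume "u \<in> T"
  with assms(2)[OF this] show "(\<lambda>\<omega>. \<pi> (shift s \<omega> u)) \<in> borel_measurable (observed \<pi> T')"
    by (simp add: coordinate_measurable)
qed (use assms shift_in_paths in auto)

text \<open>
  An invariant event \<open>A\<close> observed from time \<open>0\<close> equals its own preimage under the shift by \<open>t\<close>, which is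
  observed from time \<open>t\<close>, for every \<open>t\<close>; so it is a tail event.
\<close>

lemma inv_field_iff:
  "A \<in> inv_field \<pi> \<longleftrightarrow> A \<in> sets (observed \<pi> {0..}) \<and> (\<forall>s>0. shift s -` A \<inter> paths = A)"
proof
  assume "A \<in> inv_field \<pi>"
  then show "A \<in> sets (observed \<pi> {0..}) \<and> (\<forall>s>0. shift s -` A \<inter> paths = A)"
    by (auto simp: inv_field_def tail_field_def)
next
  assume A: "A \<in> sets (observed \<pi> {0..}) \<and> (\<forall>s>0. shift s -` A \<inter> paths = A)"
  have "A \<in> sets (observed \<pi> {t..})" if "0 \<le> t" for t
  proof (cases "t = 0")
    case False
    have "shift t \<in> observed \<pi> {t..} \<rightarrow>\<^sub>M observed \<pi> {0..}"
      by (rule measurable_shift) (use that in auto)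
    from measurable_sets[OF this, of A] A that False show ?thesis by simp
  qed (use A in simp)
  then show "A \<in> inv_field \<pi>" using A by (auto simp: inv_field_def tail_field_def)
qed

lemma inv_field_subset: "A \<in> inv_field \<pi> \<Longrightarrow> A \<subseteq> paths"
  using sets.sets_into_space[of A "observed \<pi> {0..}"] by (auto simp: inv_field_iff)

lemma sigma_algebra_inv_field: "sigma_algebra paths (inv_field \<pi>)"
  unfolding sigma_algebra_iff2
proof (intro conjI ballI allI impI)
  show "inv_field \<pi> \<subseteq> Pow paths" using inv_field_subset by blast
  show "{} \<in> inv_field \<pi>" by (simp add: inv_field_iff)
  fix A assume A: "A \<in> inv_field \<pi>"
  have "shift s -` (paths - A) \<inter> paths = paths - A" if s: "s > 0" for s
  proof -
    have "shift s -` A \<inter> paths = A" using A s by (simp add: inv_field_iff)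
    then show ?thesis using shift_in_paths[of s] s by auto
  qed
  then show "paths - A \<in> inv_field \<pi>"
    using A sets.compl_sets[of A "observed \<pi> {0..}"] by (simp add: inv_field_iff)
next
  fix A :: "nat \<Rightarrow> _" assume A: "range A \<subseteq> inv_field \<pi>"
  then have *: "A i \<in> sets (observed \<pi> {0..})" "s > 0 \<Longrightarrow> shift s -` A i \<inter> paths = A i" for i s
    by (auto simp: inv_field_iff image_subset_iff)
  have "shift s -` (\<Union> (range A)) \<inter> paths = \<Union> (range A)" if "s > 0" for s
  proof -
    have "shift s -` (\<Union> (range A)) \<inter> paths = (\<Union>i. shift s -` A i \<inter> paths)" by auto
    then show ?thesis using *(2)[OF that] by simp
  qed
  then show "\<Union> (range A) \<in> inv_field \<pi>"
    using *(1) by (auto simp: inv_field_iff)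
qed

lemma inv_field_subset_id:
  fixes \<pi> :: "'z::topological_space \<Rightarrow> 'y::topological_space"
  assumes "continuous_on UNIV \<pi>" shows "inv_field \<pi> \<subseteq> inv_field id"
  using sets_observed_le_id[OF assms, of "{0..}"] by (auto simp: inv_field_iff)


section \<open>The limit of the second component\<close>

definition returns_to :: "'g set \<Rightarrow> (real \<Rightarrow> 'x \<times> 'g) \<Rightarrow> bool" where
  "returns_to U \<omega> \<longleftrightarrow> (\<forall>n::nat. \<exists>t>real n. snd (\<omega> t) \<in> U)"

definition conv_paths :: "(real \<Rightarrow> 'x::topological_space \<times> 'g::topological_space) set" where
  "conv_paths = {\<omega> \<in> paths. \<exists>l. ((\<lambda>t. snd (\<omega> t)) \<longlongrightarrow> l) at_top}"

definition snd_limit :: "(real \<Rightarrow> 'x \<times> 'g::t2_space) \<Rightarrow> 'g" where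
  "snd_limit \<omega> = Lim at_top (\<lambda>t. snd (\<omega> t))"

lemma snd_limit_eq: "((\<lambda>t. snd (\<omega> t)) \<longlongrightarrow> (l::'g::t2_space)) at_top \<Longrightarrow> snd_limit \<omega> = l"
  unfolding snd_limit_def by (intro tendsto_Lim) auto

lemma conv_paths_tendsto:
  "\<omega> \<in> conv_paths \<Longrightarrow> ((\<lambda>t. snd (\<omega> t)) \<longlongrightarrow> (snd_limit \<omega> :: 'g::t2_space)) at_top"
  by (auto simp: conv_paths_def snd_limit_eq)

lemma returns_to_iff_frequently: "returns_to U \<omega> \<longleftrightarrow> (\<exists>\<^sub>F t in at_top. snd (\<omega> t) \<in> U)"
proof -
  have "\<not> returns_to U \<omega> \<longleftrightarrow> (\<forall>\<^sub>F t in at_top. snd (\<omega> t) \<notin> U)"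
    unfolding returns_to_def eventually_at_top_dense
    by (meson less_imp_le not_le order_le_less_trans real_arch_simple)
  then show ?thesis by (auto simp: frequently_def)
qed

lemma returns_to_measurable:
  fixes U :: "'g::topological_space set"
  assumes U: "open U"
  shows "{\<omega> \<in> paths. returns_to U \<omega>} \<in> sets (observed (snd :: 'x::topological_space \<times> 'g \<Rightarrow> 'g) {0..})"
proof -
  let ?M = "observed (snd :: 'x \<times> 'g \<Rightarrow> 'g) {0..}"
  have eq: "returns_to U \<omega> \<longleftrightarrow> (\<forall>n::nat. \<exists>q::rat. real n < of_rat q \<and> snd (\<omega> (of_rat q)) \<in> U)"
    if \<omega>: "\<omega> \<in> paths" for \<omega> :: "real \<Rightarrow> 'x \<times> 'g"
  proof -
    have "\<exists>q::rat. real n < of_rat q \<and> snd (\<omega> (of_rat q)) \<in> U" if t: "t > real n" "snd (\<omega> t) \<in> U" for n t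
    proof -
      have "continuous_on {real n<..} (\<lambda>t. snd (\<omega> t))"
        by (intro continuous_on_snd continuous_on_subset[OF path_continuous[OF \<omega>]]) auto
      then have "open ({real n<..} \<inter> (\<lambda>t. snd (\<omega> t)) -` U)"
        using U by (intro continuous_open_preimage) auto
      then obtain e where e: "e > 0" "ball t e \<subseteq> {real n<..} \<inter> (\<lambda>t. snd (\<omega> t)) -` U"
        using t openE by blast
      obtain q where "t < of_rat q" "of_rat q < t + e" using of_rat_dense[of t "t + e"] e(1) by auto
      then have "of_rat q \<in> ball t e" by (auto simp: dist_real_def)
      then show ?thesis using e(2) by blast
    qed
    then show ?thesis unfolding returns_to_def by blast
  qed
  have "{\<omega> \<in> space ?M. \<forall>n::nat. \<exists>q::rat. real n < of_rat q \<and> snd (\<omega> (of_rat q)) \<in> U} \<in> sets ?M"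
  proof (intro sets.sets_Collect_countable_All sets.sets_Collect_countable_Ex)
    fix n :: nat and q :: rat
    show "{\<omega> \<in> space ?M. real n < of_rat q \<and> snd (\<omega> (of_rat q)) \<in> U} \<in> sets ?M"
    proof (cases "real n < of_rat q")
      case True
      then have "real_of_rat q \<in> {0..}" using le_less_trans[OF of_nat_0_le_iff, of n "real_of_rat q"] by simp
      from measurable_sets[OF coordinate_measurable[OF this, of "snd :: 'x \<times> 'g \<Rightarrow> 'g"], of U] U True
      show ?thesis by (simp add: vimage_def Int_def conj_commute)
    qed simp
  qed
  moreover have "{\<omega> \<in> paths. returns_to U \<omega>} =
      {\<omega> \<in> space ?M. \<forall>n::nat. \<exists>q::rat. real n < of_rat q \<and> snd (\<omega> (of_rat q)) \<in> U}"
    using eq by auto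
  ultimately show ?thesis by (simp only:)
qed

text \<open>
  In a locally compact space a trajectory converges iff it finally stays in a compact set and has
  only one cluster point; a countable basis turns this into countably many conditions.
\<close>

lemma conv_paths_iff:
  fixes \<omega> :: "real \<Rightarrow> 'x::topological_space \<times> 'g::t2_space"
  assumes \<B>: "\<And>B. B \<in> \<B> \<Longrightarrow> open B"
    "\<And>U z. open U \<Longrightarrow> z \<in> U \<Longrightarrow> \<exists>B\<in>\<B>. z \<in> B \<and> closure B \<subseteq> U"
    and lc: "\<And>z::'g. \<exists>U. open U \<and> z \<in> U \<and> compact (closure U)"
  shows "(\<exists>l. ((\<lambda>t. snd (\<omega> t)) \<longlongrightarrow> l) at_top) \<longleftrightarrow>
    (\<exists>B\<in>\<B>. compact (closure B) \<and> \<not> returns_to (- closure B) \<omega>) \<and>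
    (\<forall>B\<in>\<B>. \<forall>C\<in>\<B>. closure B \<inter> closure C = {} \<longrightarrow> \<not> (returns_to B \<omega> \<and> returns_to C \<omega>))"
proof (intro iffI conjI)
  assume "\<exists>l. ((\<lambda>t. snd (\<omega> t)) \<longlongrightarrow> l) at_top"
  then obtain l where l: "((\<lambda>t. snd (\<omega> t)) \<longlongrightarrow> l) at_top" by blast
  obtain U where U: "open U" "l \<in> U" "compact (closure U)" using lc by blast
  then obtain B where B: "B \<in> \<B>" "l \<in> B" "closure B \<subseteq> U" using \<B> by blast
  have "compact (closure B)"
    using B U closure_subset[of U] compact_Int_closed[OF U(3) closed_closure[of B]]
    by (metis inf.absorb_iff2 order_trans)
  moreover have "\<forall>\<^sub>F t in at_top. snd (\<omega> t) \<in> B"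
    using topological_tendstoD[OF l] \<B>(1) B by blast
  then have "\<forall>\<^sub>F t in at_top. \<not> snd (\<omega> t) \<in> - closure B"
    by eventually_elim (use closure_subset in auto)
  ultimately show "\<exists>B\<in>\<B>. compact (closure B) \<and> \<not> returns_to (- closure B) \<omega>"
    using B by (auto simp: returns_to_iff_frequently frequently_def)
  have cl: "l \<in> closure C" if "returns_to C \<omega>" for C
  proof (rule ccontr)
    assume "l \<notin> closure C"
    then have "\<forall>\<^sub>F t in at_top. snd (\<omega> t) \<in> - closure C"
      by (intro topological_tendstoD[OF l]) auto
    then have "\<forall>\<^sub>F t in at_top. snd (\<omega> t) \<notin> C"
      by eventually_elim (use closure_subset in auto)
    with that show False by (auto simp: returns_to_iff_frequently frequently_def)
  qed
  then show "\<forall>B\<in>\<B>. \<forall>C\<in>\<B>. closure B \<inter> closure C = {} \<longrightarrow> \<not> (returns_to B \<omega> \<and> returns_to C \<omega>)"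
    by blast
next
  assume R: "(\<exists>B\<in>\<B>. compact (closure B) \<and> \<not> returns_to (- closure B) \<omega>) \<and>
    (\<forall>B\<in>\<B>. \<forall>C\<in>\<B>. closure B \<inter> closure C = {} \<longrightarrow> \<not> (returns_to B \<omega> \<and> returns_to C \<omega>))"
  then obtain K where K: "compact K" "\<forall>\<^sub>F t in at_top. snd (\<omega> t) \<in> K"
    by (auto simp: returns_to_iff_frequently frequently_def)
  define F where "F = filtermap (\<lambda>t. snd (\<omega> t)) at_top"
  have cluster: "\<exists>x\<in>K - U. \<forall>V. open V \<longrightarrow> x \<in> V \<longrightarrow> returns_to V \<omega>"
    if "open U" "\<exists>\<^sub>F t in at_top. snd (\<omega> t) \<notin> U" for U
  proof -
    let ?F = "inf F (principal (- U))"
    have KU: "compact (K - U)" using K(1) that(1) by (rule compact_diff)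
    have "?F \<noteq> bot"
      using that(2) by (auto simp: trivial_limit_def F_def eventually_inf_principal eventually_filtermap frequently_def)
    moreover have "\<forall>\<^sub>F x in ?F. x \<in> K - U"
      unfolding eventually_inf_principal F_def eventually_filtermap using K(2) by eventually_elim auto
    ultimately obtain x where x: "x \<in> K - U" "inf (nhds x) ?F \<noteq> bot"
      using KU unfolding compact_filter by blast
    have "returns_to V \<omega>" if V: "open V" "x \<in> V" for V
    proof (rule ccontr)
      assume "\<not> returns_to V \<omega>"
      then have "\<forall>\<^sub>F y in F. y \<notin> V"
        by (simp add: returns_to_iff_frequently not_frequently F_def eventually_filtermap)
      then have "\<forall>\<^sub>F y in ?F. y \<notin> V" by (rule filter_leD[rotated]) simp
      then have "\<forall>\<^sub>F y in inf (nhds x) ?F. y \<notin> V" by (rule filter_leD[OF inf_le2])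
      moreover have "\<forall>\<^sub>F y in nhds x. y \<in> V" using V by (intro eventually_nhds_in_open)
      then have "\<forall>\<^sub>F y in inf (nhds x) ?F. y \<in> V" by (rule filter_leD[OF inf_le1])
      ultimately have "\<forall>\<^sub>F y in inf (nhds x) ?F. False" by eventually_elim simp
      then show False using x(2) by (simp add: trivial_limit_def)
    qed
    then show ?thesis using x by blast
  qed
  have "\<exists>\<^sub>F t in at_top. snd (\<omega> t) \<notin> {}" by simp
  from cluster[OF _ this] obtain l where l: "\<And>V. open V \<Longrightarrow> l \<in> V \<Longrightarrow> returns_to V \<omega>" by auto
  have "((\<lambda>t. snd (\<omega> t)) \<longlongrightarrow> l) at_top"
  proof (rule topological_tendstoI, rule ccontr)
    fix U assume U: "open U" "l \<in> U" "\<not> (\<forall>\<^sub>F t in at_top. snd (\<omega> t) \<in> U)"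
    then obtain l' where l': "l' \<notin> U" "\<And>V. open V \<Longrightarrow> l' \<in> V \<Longrightarrow> returns_to V \<omega>"
      using cluster[of U] by (auto simp: frequently_def)
    obtain C where C: "C \<in> \<B>" "l \<in> C" "closure C \<subseteq> U" using \<B>(2)[OF U(1,2)] by blast
    have "open (- closure C)" "l' \<in> - closure C" using C l' by auto
    then obtain C' where C': "C' \<in> \<B>" "l' \<in> C'" "closure C' \<subseteq> - closure C" using \<B>(2) by blast
    have "returns_to C \<omega>" "returns_to C' \<omega>" using C C' l l' \<B>(1) by auto
    moreover have "closure C \<inter> closure C' = {}" using C'(3) by auto
    ultimately show False using R C(1) C'(1) by blast
  qed
  then show "\<exists>l. ((\<lambda>t. snd (\<omega> t)) \<longlongrightarrow> l) at_top" by blast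
qed

lemma pred_countable_Bex:
  assumes "countable X" "\<And>i. i \<in> X \<Longrightarrow> Measurable.pred M (P i)"
  shows "Measurable.pred M (\<lambda>x. \<exists>i\<in>X. P i x)"
proof -
  have "(\<Union>i\<in>X. {x \<in> space M. P i x}) \<in> sets M"
    using assms by (intro sets.countable_UN') (auto simp: pred_def)
  moreover have "{x \<in> space M. \<exists>i\<in>X. P i x} = (\<Union>i\<in>X. {x \<in> space M. P i x})" by auto
  ultimately show ?thesis by (simp add: pred_def)
qed

lemma pred_countable_Ball:
  assumes "countable X" "\<And>i. i \<in> X \<Longrightarrow> Measurable.pred M (P i)"
  shows "Measurable.pred M (\<lambda>x. \<forall>i\<in>X. P i x)"
proof -
  have "Measurable.pred M (\<lambda>x. \<not> (\<exists>i\<in>X. \<not> P i x))"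
    by (intro pred_intros_logic(2) pred_countable_Bex assms)
  then show ?thesis by simp
qed

lemma conv_paths_measurable:
  assumes reg: "regular_space (euclidean :: 'g::{second_countable_topology,t2_space} topology)"
    and lc: "\<And>z::'g. \<exists>U. open U \<and> z \<in> U \<and> compact (closure U)"
  shows "conv_paths \<in> sets (observed (snd :: 'x::topological_space \<times> 'g \<Rightarrow> 'g) {0..})"
    and "snd_limit \<in> restrict_space (observed (snd :: 'x::topological_space \<times> 'g \<Rightarrow> 'g) {0..}) conv_paths \<rightarrow>\<^sub>M borel"
proof -
  let ?M = "observed (snd :: 'x \<times> 'g \<Rightarrow> 'g) {0..}"
  obtain \<B> :: "'g set set" where \<B>: "countable \<B>" "\<And>B. B \<in> \<B> \<Longrightarrow> open B"
    "\<And>U z. open U \<Longrightarrow> z \<in> U \<Longrightarrow> \<exists>B\<in>\<B>. z \<in> B \<and> closure B \<subseteq> U"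
    using countable_basis_closure[OF reg] by metis
  note pred_Bex = pred_countable_Bex[OF \<B>(1)] and pred_Ball = pred_countable_Ball[OF \<B>(1)]
  have vis: "Measurable.pred ?M (returns_to U)" if "open U" for U
    using returns_to_measurable[OF that] by (simp add: pred_def)
  have "Measurable.pred ?M (\<lambda>\<omega>. (\<exists>B\<in>\<B>. compact (closure B) \<and> \<not> returns_to (- closure B) \<omega>) \<and>
    (\<forall>B\<in>\<B>. \<forall>C\<in>\<B>. closure B \<inter> closure C = {} \<longrightarrow> \<not> (returns_to B \<omega> \<and> returns_to C \<omega>)))"
    by (intro pred_intros_logic(2-5) pred_Bex pred_Ball measurable_const vis \<B>(2) open_Compl closed_closure) auto
  then have "Measurable.pred ?M (\<lambda>\<omega>. \<exists>l. ((\<lambda>t. snd (\<omega> t)) \<longlongrightarrow> l) at_top)"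
    by (subst conv_paths_iff[where \<B>=\<B>]) (use \<B>(2,3) lc in \<open>auto simp del: not_all\<close>)
  then show *: "conv_paths \<in> sets ?M"
    by (simp add: pred_def conv_paths_def)
  show "snd_limit \<in> restrict_space ?M conv_paths \<rightarrow>\<^sub>M borel"
  proof (rule borel_measurableI)
    fix U :: "'g set" assume U: "open U"
    have eq: "snd_limit \<omega> \<in> U \<longleftrightarrow> (\<exists>B\<in>\<B>. closure B \<subseteq> U \<and> \<not> returns_to (- closure B) \<omega>)"
      if "\<omega> \<in> conv_paths" for \<omega> :: "real \<Rightarrow> 'x \<times> 'g"
    proof
      note l = conv_paths_tendsto[OF that]
      assume "snd_limit \<omega> \<in> U"
      then obtain B where B: "B \<in> \<B>" "snd_limit \<omega> \<in> B" "closure B \<subseteq> U" using \<B>(3) U by blast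
      have "\<forall>\<^sub>F t in at_top. snd (\<omega> t) \<in> B"
        using topological_tendstoD[OF l] \<B>(2) B by blast
      then have "\<forall>\<^sub>F t in at_top. \<not> snd (\<omega> t) \<in> - closure B"
        by eventually_elim (use closure_subset in auto)
      then show "\<exists>B\<in>\<B>. closure B \<subseteq> U \<and> \<not> returns_to (- closure B) \<omega>"
        using B by (auto simp: returns_to_iff_frequently frequently_def)
    next
      note l = conv_paths_tendsto[OF that]
      assume "\<exists>B\<in>\<B>. closure B \<subseteq> U \<and> \<not> returns_to (- closure B) \<omega>"
      then obtain B where B: "closure B \<subseteq> U" "\<forall>\<^sub>F t in at_top. snd (\<omega> t) \<in> closure B"
        by (auto simp: returns_to_iff_frequently frequently_def)
      have "snd_limit \<omega> \<in> closure B"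
        by (rule Lim_in_closed_set[OF closed_closure B(2) _ l]) simp
      then show "snd_limit \<omega> \<in> U" using B by blast
    qed
    have "Measurable.pred ?M (\<lambda>\<omega>. \<exists>B\<in>\<B>. closure B \<subseteq> U \<and> \<not> returns_to (- closure B) \<omega>)"
      by (intro pred_intros_logic(2-5) pred_Bex pred_Ball measurable_const vis open_Compl closed_closure) auto
    then have "{\<omega> \<in> paths. \<exists>B\<in>\<B>. closure B \<subseteq> U \<and> \<not> returns_to (- closure B) \<omega>} \<in> sets ?M"
      by (simp add: pred_def)
    then have "conv_paths \<inter> {\<omega> \<in> paths. \<exists>B\<in>\<B>. closure B \<subseteq> U \<and> \<not> returns_to (- closure B) \<omega>} \<in> sets ?M"
      using * by (rule sets.Int[rotated])
    moreover have "snd_limit -` U \<inter> space (restrict_space ?M conv_paths) =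
      conv_paths \<inter> {\<omega> \<in> paths. \<exists>B\<in>\<B>. closure B \<subseteq> U \<and> \<not> returns_to (- closure B) \<omega>}"
      using eq by (auto simp: space_restrict_space conv_paths_def)
    ultimately show "snd_limit -` U \<inter> space (restrict_space ?M conv_paths) \<in> sets (restrict_space ?M conv_paths)"
      using sets.Int[OF * sets.top[of ?M]] by (subst sets_restrict_space_iff) (simp_all only: Int_lower1 simp_thms)
  qed
qed

section \<open>Time averages along a path\<close>

text \<open>
  The average of \<open>f\<close> over the window \<open>[n, 2 n]\<close>, with the window parametrised by \<open>[0, 1]\<close>.
\<close>

definition window_average :: "(real \<Rightarrow> real) \<Rightarrow> nat \<Rightarrow> real" where
  "window_average f n = (\<integral>s. f (real n * (1 + s)) \<partial>restrict_space lborel {0..1})"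

lemma window_average_eq:
  "window_average f n = (\<integral>s. indicator {0..1} s * f (real n * (1 + s)) \<partial>lborel)"
  unfolding window_average_def by (subst integral_restrict_space) auto

lemma window_average_cong:
  assumes "\<And>t. 0 \<le> t \<Longrightarrow> f t = g t" shows "window_average f n = window_average g n"
  unfolding window_average_eq
  by (intro Bochner_Integration.integral_cong refl) (auto simp: indicator_def intro!: assms)

text \<open>
  In the parametrisation by \<open>[0, 1]\<close>, the shift by \<open>u\<close> moves the window by \<open>u / n\<close>.
\<close>

lemma window_average_shift:
  assumes f: "f \<in> borel_measurable borel" "\<And>t. \<bar>f t\<bar> \<le> 1" and n: "n > 0" and u: "0 \<le> u"
  shows "\<bar>window_average (\<lambda>t. f (t + u)) n - window_average f n\<bar> \<le> 2 * u / n"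
proof -
  define c where "c = u / n"
  have c: "0 \<le> c" using u by (simp add: c_def)
  define F where "F s = f (real n * (1 + s))" for s
  have Fm[measurable]: "F \<in> borel_measurable borel" unfolding F_def using f(1) by measurable
  have F1: "\<bar>F s\<bar> \<le> 1" for s by (simp add: F_def f)
  have int: "integrable lborel (\<lambda>s. indicator {a..b} s * F s)" for a b
  proof -
    have "integrable lborel (\<lambda>s. indicator {a..b} s * (1::real))"
      by (simp, intro integrable_real_indicator) (auto simp: emeasure_lborel_Icc_eq)
    then show ?thesis
      by (rule Bochner_Integration.integrable_bound)
        (use F1 in \<open>auto simp: abs_mult indicator_def\<close>)
  qed
  have "window_average (\<lambda>t. f (t + u)) n = (\<integral>s. indicator {0..1} s * F (c + s) \<partial>lborel)"
    unfolding window_average_eq F_def using n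
    by (intro Bochner_Integration.integral_cong refl) (simp add: c_def algebra_simps)
  also have "\<dots> = (\<integral>s. indicator {c..1 + c} (c + 1 * s) * F (c + 1 * s) \<partial>lborel)"
    by (intro Bochner_Integration.integral_cong refl) (auto simp: indicator_def)
  also have "\<dots> = (\<integral>s. indicator {c..1 + c} s * F s \<partial>lborel)"
    using lborel_integral_real_affine[of 1 "\<lambda>s. indicator {c..1 + c} s * F s" c] by simp
  finally have "window_average (\<lambda>t. f (t + u)) n - window_average f n =
      (\<integral>s. indicator {c..1 + c} s * F s - indicator {0..1} s * F s \<partial>lborel)"
    unfolding window_average_eq F_def[symmetric] using int by simp
  also have "\<bar>\<dots>\<bar> \<le> (\<integral>s. indicator {0..c} s + indicator {1..1 + c} s \<partial>lborel)"
  proof (rule integral_abs_bound_integral)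
    show "integrable lborel (\<lambda>s. indicator {0..c} s + indicator {1..1 + c} s :: real)"
      by (intro Bochner_Integration.integrable_add integrable_real_indicator) (auto simp: emeasure_lborel_Icc_eq)
    fix s
    show "\<bar>indicator {c..1 + c} s * F s - indicator {0..1} s * F s\<bar> \<le> indicator {0..c} s + indicator {1..1 + c} s"
      using F1[of s] c by (auto simp: indicator_def)
  qed (use int in simp)
  also have "\<dots> = 2 * c" using c by simp
  finally show ?thesis by (simp add: c_def)
qed

text \<open>
  For a single path the value depends continuously on the time, so the time can be rounded to a
  multiple of \<open>1 / n\<close>; for rounded times only countably many coordinates occur.
\<close>

lemma path_time_measurable:
  fixes K :: "'y::topological_space \<Rightarrow> real" and \<pi> :: "'z::topological_space \<Rightarrow> 'y"
  assumes K: "continuous_on UNIV K" and \<pi>: "continuous_on UNIV \<pi>"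
  shows "(\<lambda>(\<omega>, t). K (\<pi> (\<omega> (max 0 t)))) \<in> borel_measurable (observed \<pi> {0..} \<Otimes>\<^sub>M borel)"
proof -
  \<comment> \<open>The time \<open>t\<close> rounded down to a multiple of \<open>1 / (n + 1)\<close>.\<close>
  define d where "d n t = real_of_int \<lfloor>real (Suc n) * t\<rfloor> / real (Suc n)" for n t
  have Km: "K \<in> borel_measurable borel" using K by (rule borel_measurable_continuous_onI)
  have "(\<lambda>z. K (\<pi> (fst z (max 0 (snd z))))) \<in> borel_measurable (observed \<pi> {0..} \<Otimes>\<^sub>M borel)"
  proof (rule borel_measurable_LIMSEQ_real)
    fix z :: "(real \<Rightarrow> 'z) \<times> real" assume "z \<in> space (observed \<pi> {0..} \<Otimes>\<^sub>M borel)"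
    then have \<omega>: "fst z \<in> paths" by (auto simp: space_pair_measure)
    have "continuous_on UNIV (\<lambda>t. K (\<pi> (fst z (max 0 t))))"
      by (rule continuous_on_compose2[OF K continuous_on_compose2[OF \<pi> continuous_on_compose2[OF path_continuous[OF \<omega>]]]])
        (auto intro!: continuous_intros)
    moreover have "(\<lambda>n. d n (snd z)) \<longlonglongrightarrow> snd z"
    proof (rule LIMSEQ_I)
      fix e :: real assume "e > 0"
      then obtain N where N: "inverse (real (Suc N)) < e" using reals_Archimedean by blast
      have "norm (d n (snd z) - snd z) < e" if "n \<ge> N" for n
      proof -
        have "\<bar>real_of_int \<lfloor>real (Suc n) * snd z\<rfloor> - real (Suc n) * snd z\<bar> \<le> 1" by linarith
        moreover have "d n (snd z) - snd z = (real_of_int \<lfloor>real (Suc n) * snd z\<rfloor> - real (Suc n) * snd z) / real (Suc n)"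
          by (simp add: d_def field_simps del: of_nat_Suc)
        ultimately have "\<bar>d n (snd z) - snd z\<bar> \<le> inverse (real (Suc n))"
          by (simp add: abs_divide divide_right_mono inverse_eq_divide del: of_nat_Suc)
        also have "\<dots> \<le> inverse (real (Suc N))" using that by (intro le_imp_inverse_le) auto
        finally show ?thesis using N by simp
      qed
      then show "\<exists>no. \<forall>n\<ge>no. norm (d n (snd z) - snd z) < e" by blast
    qed
    ultimately show "(\<lambda>n. K (\<pi> (fst z (max 0 (d n (snd z)))))) \<longlonglongrightarrow> K (\<pi> (fst z (max 0 (snd z))))"
      by (auto simp: continuous_on_eq_continuous_within continuous_within intro: tendsto_compose_filtermap isCont_tendsto_compose)
  next
    fix n
    have fl: "(\<lambda>z. \<lfloor>real (Suc n) * snd z\<rfloor>) \<in> observed \<pi> {0..} \<Otimes>\<^sub>M borel \<rightarrow>\<^sub>M count_space UNIV"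
      by (intro measurable_compose[OF _ measurable_real_floor]) measurable
    have "(\<lambda>z. K (\<pi> (fst z (max 0 (real_of_int i / real (Suc n)))))) \<in> borel_measurable (observed \<pi> {0..} \<Otimes>\<^sub>M borel)" for i
      by (intro measurable_compose[OF measurable_fst] measurable_compose[OF coordinate_measurable Km]) simp
    from measurable_compose_countable[OF this fl]
    show "(\<lambda>z. K (\<pi> (fst z (max 0 (d n (snd z)))))) \<in> borel_measurable (observed \<pi> {0..} \<Otimes>\<^sub>M borel)"
      by (simp add: d_def)
  qed
  then show ?thesis by (simp add: split_beta)
qed


section \<open>Equivariant Markov families\<close>

definition translate :: "'g monoid \<Rightarrow> 'g \<Rightarrow> (real \<Rightarrow> 'x \<times> 'g) \<Rightarrow> real \<Rightarrow> 'x \<times> 'g" where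
  "translate G h \<omega> = (\<lambda>t\<in>{0..}. (fst (\<omega> t), h \<otimes>\<^bsub>G\<^esub> snd (\<omega> t)))"

locale topological_group = group G for G :: "'g::{second_countable_topology,t2_space} monoid" (structure) +
  assumes carrier_UNIV [simp]: "carrier G = UNIV"
    and mult_continuous: "continuous_on UNIV (\<lambda>(g, h). g \<otimes> h)"
    and inv_continuous: "continuous_on UNIV (\<lambda>g. inv g)"
begin

abbreviation "transl \<equiv> translate G"

lemma translate_apply [simp]: "0 \<le> t \<Longrightarrow> transl h \<omega> t = (fst (\<omega> t), h \<otimes> snd (\<omega> t))"
  by (simp add: translate_def)

lemma mult_tendsto:
  assumes "(a \<longlongrightarrow> x) F" "(b \<longlongrightarrow> y) F" shows "((\<lambda>t. a t \<otimes> b t) \<longlongrightarrow> x \<otimes> y) F"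
proof -
  have "isCont (\<lambda>(g, h). g \<otimes> h) (x, y)"
    using mult_continuous by (simp add: continuous_on_eq_continuous_at)
  from isCont_tendsto_compose[OF this tendsto_Pair[OF assms]] show ?thesis by simp
qed

lemma mult_measurable: "(\<lambda>(g, h). g \<otimes> h) \<in> borel \<Otimes>\<^sub>M borel \<rightarrow>\<^sub>M borel"
  unfolding borel_prod using mult_continuous by (rule borel_measurable_continuous_onI)

lemma mult_measurable':
  "a \<in> N \<rightarrow>\<^sub>M borel \<Longrightarrow> b \<in> N \<rightarrow>\<^sub>M borel \<Longrightarrow> (\<lambda>z. a z \<otimes> b z) \<in> N \<rightarrow>\<^sub>M borel"
  using measurable_compose[OF measurable_Pair mult_measurable, of a N b] by simp

lemma inv_measurable: "(\<lambda>g. inv g) \<in> borel \<rightarrow>\<^sub>M borel"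
  using inv_continuous by (rule borel_measurable_continuous_onI)

lemma translate_in_paths:
  assumes "(\<omega> :: real \<Rightarrow> 'x::topological_space \<times> 'g) \<in> paths" shows "transl h \<omega> \<in> paths"
proof -
  note c = path_continuous[OF assms]
  have "continuous_on {0..} (\<lambda>t. h \<otimes> snd (\<omega> t))"
    using continuous_on_compose2[OF mult_continuous, of "{0..}" "\<lambda>t. (h, snd (\<omega> t))",
        OF continuous_on_Pair[OF continuous_on_const continuous_on_snd[OF c]]] by simp
  then have "continuous_on {0..} (\<lambda>t. (fst (\<omega> t), h \<otimes> snd (\<omega> t)))"
    using c by (intro continuous_intros)
  then have "continuous_on {0..} (transl h \<omega>)"
    unfolding translate_def by (rule continuous_on_eq) simp
  then show ?thesis by (simp add: paths_def translate_def)
qed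

lemma translate_translate: "transl h (transl k \<omega>) = transl (h \<otimes> k) \<omega>"
  by (auto simp: translate_def m_assoc)

lemma translate_one: "\<omega> \<in> paths \<Longrightarrow> transl \<one> \<omega> = \<omega>"
  by (auto simp: translate_def paths_def extensional_def)

lemma shift_translate: "0 \<le> s \<Longrightarrow> shift s (transl h \<omega>) = transl h (shift s \<omega>)"
  by (auto simp: translate_def shift_def)

lemma translate_measurable_pair:
  fixes T :: "real set"
  assumes "T \<subseteq> {0..}"
  shows "(\<lambda>z. transl (fst z) (snd z)) \<in> borel \<Otimes>\<^sub>M observed (id :: 'x::second_countable_topology \<times> 'g \<Rightarrow> _) T \<rightarrow>\<^sub>M observed id T"
proof (rule measurable_into_observed)
  let ?N = "borel \<Otimes>\<^sub>M observed (id :: 'x \<times> 'g \<Rightarrow> _) T"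
  fix s assume s: "s \<in> T"
  have c: "(\<lambda>z. snd z s) \<in> ?N \<rightarrow>\<^sub>M borel"
    using measurable_compose[OF measurable_snd coordinate_measurable[OF s, of id]] by simp
  have "(\<lambda>z. fst (snd z s)) \<in> ?N \<rightarrow>\<^sub>M borel" "(\<lambda>z. snd (snd z s)) \<in> ?N \<rightarrow>\<^sub>M borel"
    using c unfolding borel_prod[symmetric] by measurable
  then have "(\<lambda>z. (fst (snd z s), fst z \<otimes> snd (snd z s))) \<in> ?N \<rightarrow>\<^sub>M borel \<Otimes>\<^sub>M borel"
    by (intro measurable_Pair mult_measurable') simp_all
  then show "(\<lambda>z. id (transl (fst z) (snd z) s)) \<in> borel_measurable ?N"
    using s assms by (simp add: borel_prod subset_iff)
qed (auto simp: space_pair_measure translate_in_paths)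

lemma translate_measurable:
  fixes T :: "real set"
  assumes "T \<subseteq> {0..}"
  shows "transl h \<in> observed (id :: 'x::second_countable_topology \<times> 'g \<Rightarrow> _) T \<rightarrow>\<^sub>M observed id T"
  using measurable_compose[OF measurable_Pair1' translate_measurable_pair[OF assms], of h] by simp

lemma translate_vimage_inv_field:
  fixes A :: "(real \<Rightarrow> 'x::second_countable_topology \<times> 'g) set"
  assumes A: "A \<in> inv_field id" shows "transl h -` A \<inter> paths \<in> inv_field id"
  unfolding inv_field_iff
proof (intro conjI allI impI)
  show "transl h -` A \<inter> paths \<in> sets (observed id {0..})"
    using measurable_sets[OF translate_measurable[of "{0..}" h], of A] A by (simp add: inv_field_iff)
  fix s :: real assume s: "s > 0"
  have "shift s -` A \<inter> paths = A" using A s by (simp add: inv_field_iff)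
  then have "shift s \<omega> \<in> A \<longleftrightarrow> \<omega> \<in> A" if "\<omega> \<in> paths" for \<omega> using that by blast
  then show "shift s -` (transl h -` A \<inter> paths) \<inter> paths = transl h -` A \<inter> paths"
    using s by (auto simp: shift_translate[symmetric] shift_in_paths translate_in_paths)
qed

lemma conv_paths_translate:
  fixes \<omega> :: "real \<Rightarrow> 'x::topological_space \<times> 'g"
  assumes "\<omega> \<in> conv_paths"
  shows "transl h \<omega> \<in> conv_paths" "snd_limit (transl h \<omega>) = h \<otimes> snd_limit \<omega>"
proof -
  have "((\<lambda>t. h \<otimes> snd (\<omega> t)) \<longlongrightarrow> h \<otimes> snd_limit \<omega>) at_top"
    by (intro mult_tendsto tendsto_const conv_paths_tendsto assms)
  moreover have "\<forall>\<^sub>F t in at_top. h \<otimes> snd (\<omega> t) = snd (transl h \<omega> t)"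
    using eventually_ge_at_top[of 0] by eventually_elim simp
  ultimately have "((\<lambda>t. snd (transl h \<omega> t)) \<longlongrightarrow> h \<otimes> snd_limit \<omega>) at_top"
    by (rule Lim_transform_eventually)
  moreover have "transl h \<omega> \<in> paths" using assms by (auto simp: conv_paths_def intro: translate_in_paths)
  ultimately show "transl h \<omega> \<in> conv_paths" "snd_limit (transl h \<omega>) = h \<otimes> snd_limit \<omega>"
    by (auto simp: conv_paths_def intro: snd_limit_eq)
qed

end

lemma eventually_at_top_shift:
  "(\<forall>\<^sub>F t in at_top. P (t + s)) \<longleftrightarrow> (\<forall>\<^sub>F t::real in at_top. P t)"
proof
  assume "\<forall>\<^sub>F t in at_top. P (t + s)"
  then obtain N where "\<And>t. t \<ge> N \<Longrightarrow> P (t + s)" by (auto simp: eventually_at_top_linorder)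
  then have "P t" if "t \<ge> N + s" for t using that by (metis diff_add_cancel le_diff_eq)
  then show "\<forall>\<^sub>F t in at_top. P t" unfolding eventually_at_top_linorder by blast
next
  assume "\<forall>\<^sub>F t in at_top. P t"
  then obtain N where "\<And>t. t \<ge> N \<Longrightarrow> P t" by (auto simp: eventually_at_top_linorder)
  then have "P (t + s)" if "t \<ge> N - s" for t using that by simp
  then show "\<forall>\<^sub>F t in at_top. P (t + s)" unfolding eventually_at_top_linorder by blast
qed

lemma conv_paths_shift:
  fixes \<omega> :: "real \<Rightarrow> 'x::topological_space \<times> 'g::t2_space"
  assumes "0 \<le> s" "\<omega> \<in> paths"
  shows "shift s \<omega> \<in> conv_paths \<longleftrightarrow> \<omega> \<in> conv_paths" "snd_limit (shift s \<omega>) = snd_limit \<omega>"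
proof -
  have ev: "\<forall>\<^sub>F t in at_top. snd (\<omega> (t + s)) = snd (shift s \<omega> t)"
    using eventually_ge_at_top[of 0] by eventually_elim simp
  have *: "((\<lambda>t. snd (shift s \<omega> t)) \<longlongrightarrow> l) at_top \<longleftrightarrow> ((\<lambda>t. snd (\<omega> t)) \<longlongrightarrow> l) at_top" for l
  proof -
    have "((\<lambda>t. snd (shift s \<omega> t)) \<longlongrightarrow> l) at_top \<longleftrightarrow> ((\<lambda>t. snd (\<omega> (t + s))) \<longlongrightarrow> l) at_top"
      using ev by (intro tendsto_cong) (auto elim: eventually_mono)
    also have "\<dots> \<longleftrightarrow> ((\<lambda>t. snd (\<omega> t)) \<longlongrightarrow> l) at_top"
      by (simp only: tendsto_def eventually_at_top_shift[of "\<lambda>t. snd (\<omega> t) \<in> S" s for S])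
    finally show ?thesis .
  qed
  show "shift s \<omega> \<in> conv_paths \<longleftrightarrow> \<omega> \<in> conv_paths"
    using assms shift_in_paths[OF assms] by (auto simp: conv_paths_def *)
  show "snd_limit (shift s \<omega>) = snd_limit \<omega>"
    by (simp add: snd_limit_def Topological_Spaces.Lim_def *)
qed

text \<open>
  The properties of the laws and of the state space from which the description of the invariant
  sigma field is derived.  Generator and charts only serve to establish them: equivariance of the
  generator is replaced by \<open>equivariant\<close>, an identity between laws.
\<close>

locale equivariant_markov_family = topological_group G
  for G :: "'g::{second_countable_topology,t2_space} monoid" (structure) +
  fixes P :: "'x::{second_countable_topology,t2_space} \<times> 'g \<Rightarrow> (real \<Rightarrow> 'x \<times> 'g) measure"
  assumes regular_X: "regular_space (euclidean :: 'x topology)"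
    and regular_G: "regular_space (euclidean :: 'g topology)"
    and locally_compact_G: "\<And>k::'g. \<exists>U. open U \<and> k \<in> U \<and> compact (closure U)"
    and kernel: "P \<in> borel \<rightarrow>\<^sub>M prob_algebra path_space"
    and start: "\<And>z. AE \<omega> in P z. \<omega> 0 = z"
    and markov: "\<And>z t C B. 0 \<le> t \<Longrightarrow> C \<in> sets (observed id {0..t}) \<Longrightarrow> B \<in> sets path_space \<Longrightarrow>
      measure (P z) (C \<inter> (shift t -` B \<inter> paths)) = (\<integral>\<omega>. indicator C \<omega> * measure (P (\<omega> t)) B \<partial>P z)"
    and equivariant: "\<And>x g h. distr (P (x, g)) path_space (translate G h) = P (x, h \<otimes> g)"
    and convergent: "\<And>z. AE \<omega> in P z. \<omega> \<in> conv_paths"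
    and harmonic_continuous: "\<And>H. harmonic P H \<Longrightarrow> continuous_on UNIV H"
begin

lemma regular_XG: "regular_space (euclidean :: ('x \<times> 'g) topology)"
proof -
  have "regular_space (prod_topology (euclidean :: 'x topology) (euclidean :: 'g topology))"
    by (simp only: regular_space_prod_topology regular_X regular_G simp_thms)
  then show ?thesis by (simp only: prod_topology_euclidean)
qed

lemma prob_space_P: "prob_space (P z)" and sets_P': "sets (P z) = sets path_space"
  using measurable_space[OF kernel, of z] by (auto simp: space_prob_algebra)

lemma sets_P: "sets (P z) = sets (observed id {0..})"
  using sets_P' sets_path_space_eq_observed[OF regular_XG] by simp

lemma space_P [simp]: "space (P z) = paths"
  using sets_eq_imp_space_eq[OF sets_P[of z]] by simp

lemma inv_field_sets: "A \<in> inv_field id \<Longrightarrow> A \<in> sets (P z)"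
  by (simp add: inv_field_iff sets_P)

lemma sets_Int_paths: "A \<in> sets (P z) \<Longrightarrow> A \<inter> paths = A"
  using sets.sets_into_space[of A "P z"] by auto

lemma observed_sets: "T \<subseteq> {0..} \<Longrightarrow> C \<in> sets (observed id T) \<Longrightarrow> C \<in> sets (P z)"
  using sets_observed_mono[of T "{0..}" "id :: 'x \<times> 'g \<Rightarrow> _"] by (auto simp: sets_P)

lemma continuous_projections: "continuous_on UNIV (fst :: 'x \<times> 'g \<Rightarrow> 'x)" "continuous_on UNIV (snd :: 'x \<times> 'g \<Rightarrow> 'g)"
  by (intro continuous_intros)+

text \<open>
  For an invariant event \<open>A\<close> this is the bounded harmonic function that corresponds to \<open>A\<close>.
\<close>

definition event_prob :: "(real \<Rightarrow> 'x \<times> 'g) set \<Rightarrow> 'x \<times> 'g \<Rightarrow> real" where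
  "event_prob A z = measure (P z) A"

lemma event_prob_bounds: "0 \<le> event_prob A z" "event_prob A z \<le> 1"
  using prob_space.prob_le_1[OF prob_space_P] by (simp_all add: event_prob_def)

lemma event_prob_measurable: "A \<in> inv_field id \<Longrightarrow> event_prob A \<in> borel_measurable borel"
  unfolding event_prob_def
  by (rule measurable_compose[OF kernel measurable_measure_prob_algebra])
    (use inv_field_sets sets_P' in blast)

lemma markov_invariant_event:
  assumes A: "A \<in> inv_field id" and t: "0 \<le> t" and C: "C \<in> sets (observed id {0..t})"
  shows "measure (P z) (C \<inter> A) = (\<integral>\<omega>. indicator C \<omega> * event_prob A (\<omega> t) \<partial>P z)"
proof -
  have "shift t -` A \<inter> paths = A"
  proof (cases "t = 0")
    case True
    have "shift 0 \<omega> = \<omega>" if "\<omega> \<in> paths" for \<omega> :: "real \<Rightarrow> 'x \<times> 'g"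
      using that by (auto simp: shift_def paths_def extensional_def)
    then show ?thesis using True inv_field_subset[OF A] by auto
  qed (use A t in \<open>simp add: inv_field_iff\<close>)
  moreover have "A \<in> sets path_space" using inv_field_sets[OF A] sets_P' by blast
  ultimately show ?thesis using markov[OF t C, of A z] by (simp add: event_prob_def)
qed

lemma event_prob_expectation:
  assumes A: "A \<in> inv_field id" and t: "0 \<le> t"
  shows "event_prob A z = (\<integral>\<omega>. event_prob A (\<omega> t) \<partial>P z)"
proof -
  have "(\<integral>\<omega>. indicator paths \<omega> * event_prob A (\<omega> t) \<partial>P z) = (\<integral>\<omega>. event_prob A (\<omega> t) \<partial>P z)"
    by (intro Bochner_Integration.integral_cong refl) (simp add: indicator_def)
  then show ?thesis
    using markov_invariant_event[OF A t, of paths z] sets.top[of "observed id {0..t}"] inv_field_subset[OF A]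
    by (simp add: event_prob_def Int_absorb1)
qed

lemma event_prob_continuous:
  assumes A: "A \<in> inv_field id" shows "continuous_on UNIV (event_prob A)"
proof (rule harmonic_continuous)
  show "harmonic P (event_prob A)"
    unfolding harmonic_def
  proof (intro conjI allI impI)
    show "bounded (range (event_prob A))" using event_prob_bounds by (auto intro!: boundedI[of _ 1])
  qed (rule event_prob_measurable[OF A] event_prob_expectation[OF A], assumption?)+
qed

lemma coordinate_measurable_P: "0 \<le> t \<Longrightarrow> (\<lambda>\<omega>. \<omega> t) \<in> P z \<rightarrow>\<^sub>M borel"
  using coordinate_measurable[of t "{0..}" "id :: 'x \<times> 'g \<Rightarrow> _"]
  by (simp add: measurable_cong_sets[OF sets_P refl])

lemma event_prob_coordinate_measurable:
  "A \<in> inv_field id \<Longrightarrow> 0 \<le> t \<Longrightarrow> (\<lambda>\<omega>. event_prob A (\<omega> t)) \<in> borel_measurable (P z)"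
  by (rule measurable_compose[OF coordinate_measurable_P event_prob_measurable])

lemma integrable_bounded:
  fixes f :: "_ \<Rightarrow> real"
  assumes "f \<in> borel_measurable (P z)" "\<And>\<omega>. \<bar>f \<omega>\<bar> \<le> c" shows "integrable (P z) f"
proof -
  interpret prob_space "P z" by (rule prob_space_P)
  show ?thesis using assms by (intro integrable_const_bound[of _ c]) auto
qed

text \<open>
  The events that depend on a bounded time interval form an algebra that generates the sigma field
  of the path space.
\<close>

lemma finite_time_approximation:
  assumes D: "D \<in> sets (P z)" and e: "(e::real) > 0"
  obtains t C where "0 \<le> t" "C \<in> sets (observed id {0..t})" "measure (P z) (sym_diff D C) < e"
proof -
  interpret prob_space "P z" by (rule prob_space_P)
  let ?F = "\<lambda>n::nat. observed (id :: 'x \<times> 'g \<Rightarrow> _) {0..real n}"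
  let ?A = "\<Union>n. sets (?F n)"
  have mono: "sets (?F m) \<subseteq> sets (?F n)" if "m \<le> n" for m n using that by (intro sets_observed_mono) auto
  have "algebra (space (P z)) ?A"
    unfolding algebra_iff_Un
  proof (intro conjI ballI)
    show "?A \<subseteq> Pow (space (P z))" using sets.sets_into_space by (fastforce simp del: id_apply)
    show "{} \<in> ?A" by auto
    fix a assume "a \<in> ?A"
    then obtain m where m: "a \<in> sets (?F m)" by auto
    then show "space (P z) - a \<in> ?A" using sets.compl_sets[OF m] by auto
    fix b assume "b \<in> ?A"
    then obtain n where n: "b \<in> sets (?F n)" by auto
    have "a \<union> b \<in> sets (?F (max m n))" using m n mono[of m "max m n"] mono[of n "max m n"] by auto
    then show "a \<union> b \<in> ?A" by blast
  qed
  moreover have "sets (P z) = sigma_sets (space (P z)) ?A"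
  proof
    show "sigma_sets (space (P z)) ?A \<subseteq> sets (P z)"
    proof (rule sets.sigma_sets_subset, rule UN_least)
      show "sets (?F n) \<subseteq> sets (P z)" for n
        unfolding sets_P by (rule sets_observed_mono) auto
    qed
    have "sets (observed id {0..}) \<subseteq> sigma_sets (space (P z)) ?A"
      unfolding sets_observed[of id "{0..}"] space_P
    proof (rule sigma_sets_mono, rule subsetI)
      fix a assume "a \<in> {{\<omega> \<in> paths. id (\<omega> s) \<in> B} | s B. s \<in> {0..} \<and> B \<in> sets (borel :: ('x \<times> 'g) measure)}"
      then obtain s B where a: "a = {\<omega> \<in> paths. id (\<omega> s) \<in> B}" "0 \<le> s" "B \<in> sets borel" by auto
      obtain n where "s \<le> real n" using real_arch_simple by blast
      then have "a \<in> sets (?F n)" unfolding sets_observed using a by (intro sigma_sets.Basic) auto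
      then show "a \<in> sigma_sets paths ?A" by (intro sigma_sets.Basic) auto
    qed
    then show "sets (P z) \<subseteq> sigma_sets (space (P z)) ?A" by (simp only: sets_P)
  qed
  ultimately obtain C where "C \<in> ?A" "measure (P z) (sym_diff D C) < e"
    using approximation_by_algebra[OF _ _ D e] by blast
  then show ?thesis using that[of "real _" C] by auto
qed

lemma measure_Int_close:
  assumes "D \<in> sets (P z)" "C \<in> sets (P z)" "E \<in> sets (P z)"
  shows "measure (P z) (C \<inter> E) \<ge> measure (P z) (D \<inter> E) - measure (P z) (sym_diff D C)"
proof -
  interpret prob_space "P z" by (rule prob_space_P)
  have "measure (P z) (D \<inter> E) \<le> measure (P z) ((C \<inter> E) \<union> sym_diff D C)"
    using assms by (intro finite_measure_mono) auto
  also have "\<dots> \<le> measure (P z) (C \<inter> E) + measure (P z) (sym_diff D C)"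
    using assms by (intro measure_Un_le) auto
  finally show ?thesis by simp
qed

text \<open>
  By the Markov property \<open>event_prob A (\<omega> t)\<close> is the conditional probability of \<open>A\<close> given the past of
  \<open>t\<close>.  An event \<open>C\<close> of finite time that is close to \<open>A\<close> shows that it is close to the indicator of \<open>A\<close>, for all
  large \<open>t\<close>.
\<close>

lemma event_prob_converges_L1:
  assumes A: "A \<in> inv_field id" and e: "(e::real) > 0"
  shows "\<exists>t0\<ge>0. \<forall>t\<ge>t0. (\<integral>\<omega>. \<bar>event_prob A (\<omega> t) - indicator A \<omega>\<bar> \<partial>P z) \<le> e"
proof -
  interpret prob_space "P z" by (rule prob_space_P)
  have As: "A \<in> sets (P z)" by (rule inv_field_sets[OF A])
  obtain t0 C where C: "0 \<le> t0" "C \<in> sets (observed id {0..t0})" "measure (P z) (sym_diff A C) < e / 4"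
    using finite_time_approximation[OF As, of "e / 4"] e by auto
  have Cs: "C \<in> sets (P z)" by (rule observed_sets[OF _ C(2)]) auto
  have "(\<integral>\<omega>. \<bar>event_prob A (\<omega> t) - indicator A \<omega>\<bar> \<partial>P z) \<le> e" if t: "t \<ge> t0" for t
  proof -
    have t0: "0 \<le> t" using t C(1) by simp
    have Ct: "C \<in> sets (observed id {0..t})" using sets_observed_mono[of "{0..t0}" "{0..t}"] t C(2) by fastforce
    note hm = event_prob_coordinate_measurable[OF A t0, of z]
    have i1: "integrable (P z) (\<lambda>\<omega>. event_prob A (\<omega> t))"
      using hm event_prob_bounds by (intro integrable_bounded[of _ _ 1]) (auto simp: abs_of_nonneg)
    have i2: "integrable (P z) (\<lambda>\<omega>. indicator E \<omega> * event_prob A (\<omega> t))" if "E \<in> sets (P z)" for E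
      using integrable_mult_indicator[OF that i1] by simp
    have iE: "integrable (P z) (indicator E :: _ \<Rightarrow> real)" if "E \<in> sets (P z)" for E
      using that by (intro integrable_bounded[of _ _ 1]) (auto simp: indicator_def)
    have "(\<integral>\<omega>. \<bar>event_prob A (\<omega> t) - indicator A \<omega>\<bar> \<partial>P z) =
      (\<integral>\<omega>. event_prob A (\<omega> t) + indicator A \<omega> - 2 * (indicator A \<omega> * event_prob A (\<omega> t)) \<partial>P z)"
    proof (rule Bochner_Integration.integral_cong[OF refl])
      show "\<bar>event_prob A (\<omega> t) - indicator A \<omega>\<bar> = event_prob A (\<omega> t) + indicator A \<omega> - 2 * (indicator A \<omega> * event_prob A (\<omega> t))" for \<omega>
        using event_prob_bounds[of A "\<omega> t"] by (auto simp: indicator_def)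
    qed
    also have "\<dots> = (\<integral>\<omega>. event_prob A (\<omega> t) \<partial>P z) + measure (P z) A - 2 * (\<integral>\<omega>. indicator A \<omega> * event_prob A (\<omega> t) \<partial>P z)"
      using i1 i2[OF As] iE[OF As] sets_Int_paths[OF As] by simp
    also have "(\<integral>\<omega>. event_prob A (\<omega> t) \<partial>P z) = measure (P z) A"
      using event_prob_expectation[OF A t0, of z] by (simp add: event_prob_def)
    finally have eq: "(\<integral>\<omega>. \<bar>event_prob A (\<omega> t) - indicator A \<omega>\<bar> \<partial>P z) =
      2 * measure (P z) A - 2 * (\<integral>\<omega>. indicator A \<omega> * event_prob A (\<omega> t) \<partial>P z)" by simp
    have "(\<integral>\<omega>. indicator C \<omega> * event_prob A (\<omega> t) \<partial>P z) \<le>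
       (\<integral>\<omega>. indicator A \<omega> * event_prob A (\<omega> t) + indicator (sym_diff A C) \<omega> \<partial>P z)"
    proof (rule integral_mono[OF i2[OF Cs]])
      show "integrable (P z) (\<lambda>\<omega>. indicator A \<omega> * event_prob A (\<omega> t) + indicator (sym_diff A C) \<omega>)"
        using i2[OF As] iE[of "sym_diff A C"] As Cs by auto
      show "indicator C \<omega> * event_prob A (\<omega> t) \<le> indicator A \<omega> * event_prob A (\<omega> t) + indicator (sym_diff A C) \<omega>" for \<omega>
        using event_prob_bounds[of A "\<omega> t"] by (auto simp: indicator_def)
    qed
    also have "\<dots> = (\<integral>\<omega>. indicator A \<omega> * event_prob A (\<omega> t) \<partial>P z) + measure (P z) (sym_diff A C)"
      using i2[OF As] iE[of "sym_diff A C"] As Cs sets_Int_paths[of "sym_diff A C" z]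
      by (simp del: Int_Un_distrib2)
    also have "(\<integral>\<omega>. indicator C \<omega> * event_prob A (\<omega> t) \<partial>P z) = measure (P z) (C \<inter> A)"
      using markov_invariant_event[OF A t0 Ct, of z] by simp
    finally have "measure (P z) (C \<inter> A) - measure (P z) (sym_diff A C) \<le> (\<integral>\<omega>. indicator A \<omega> * event_prob A (\<omega> t) \<partial>P z)"
      by simp
    moreover have "measure (P z) (C \<inter> A) \<ge> measure (P z) A - measure (P z) (sym_diff A C)"
      using measure_Int_close[OF As Cs As] by simp
    ultimately show ?thesis using eq C(3) by simp
  qed
  then show ?thesis using C(1) by blast
qed

lemma measure_translate:
  assumes "A \<in> sets path_space"
  shows "measure (P (x, h \<otimes> g)) A = measure (P (x, g)) (transl h -` A \<inter> paths)"
proof -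
  have "transl h \<in> P (x, g) \<rightarrow>\<^sub>M path_space"
    using translate_measurable[of "{0..}" h] sets_P[of "(x, g)"] sets_path_space_eq_observed[OF regular_XG]
    by (simp cong: measurable_cong_sets)
  from measure_distr[OF this assms] show ?thesis by (simp add: equivariant)
qed

lemma event_prob_translate:
  assumes A: "A \<in> inv_field id"
  shows "event_prob (transl h -` A \<inter> paths) (x, g) = event_prob A (x, h \<otimes> g)"
  using measure_translate[of A] inv_field_sets[OF A, of "(x, g)"] by (simp add: event_prob_def sets_P')

text \<open>
  By equivariance the probability of \<open>E\<close> is a function \<open>K\<close> of the first coordinate of the starting point, so that
  \<open>K (x\<^sub>t)\<close> converges to the indicator of \<open>E\<close> in \<open>L\<^sup>1\<close>.  A subsequence would give an almost sure limit that is a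
  function of the first component, but not one that is invariant under every shift.  Averages of \<open>K (x\<^sub>t)\<close>
  over the windows \<open>[n, 2 n]\<close> have the same limit, and their limit does not change under shifts.
\<close>

lemma translation_invariant_event:
  assumes E: "E \<in> inv_field id" and T: "\<And>h. transl h -` E \<inter> paths = E"
  shows "\<exists>B\<in>inv_field fst. AE \<omega> in P z. \<omega> \<in> E \<longleftrightarrow> \<omega> \<in> B"
proof -
  interpret prob_space "P z" by (rule prob_space_P)
  let ?M = "observed (fst :: 'x \<times> 'g \<Rightarrow> 'x) {0..}"
  define L where "L = restrict_space (lborel :: real measure) {0..1}"
  interpret L: prob_space L unfolding L_def
    by (rule prob_space_restrict_space) simp_all
  interpret PL: pair_prob_space "P z" L ..
  define K where "K x = event_prob E (x, \<one>)" for x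
  have K: "event_prob E y = K (fst y)" for y
    using event_prob_translate[OF E, of "snd y" "fst y" \<one>] T by (simp add: K_def)
  have K01: "\<bar>K x\<bar> \<le> 1" for x using event_prob_bounds by (simp add: K_def abs_of_nonneg)
  have Kc: "continuous_on UNIV K"
    unfolding K_def
    by (rule continuous_on_compose2[OF event_prob_continuous[OF E]]) (auto intro!: continuous_intros)
  have Es: "E \<in> sets (P z)" by (rule inv_field_sets[OF E])
  have sub: "sets ?M \<subseteq> sets (P z)"
    using sets_observed_le_id[OF continuous_projections(1), of "{0..}"] sets_P by simp
  \<comment> \<open>The cut-off at \<open>0\<close> makes \<open>k \<omega>\<close> continuous on the whole line; averages only use nonnegative times.\<close>
  define k where "k \<omega> t = K (fst (\<omega> (max 0 t)))" for \<omega> :: "real \<Rightarrow> 'x \<times> 'g" and t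
  have km: "(\<lambda>(\<omega>, t). k \<omega> t) \<in> borel_measurable (?M \<Otimes>\<^sub>M borel)"
    unfolding k_def by (rule path_time_measurable[OF Kc continuous_projections(1)])
  have km': "(\<lambda>(\<omega>, s). k \<omega> (real n * (1 + s))) \<in> borel_measurable (?M \<Otimes>\<^sub>M L)" for n
  proof -
    have "(\<lambda>(\<omega>, s). (\<omega>, real n * (1 + s))) \<in> ?M \<Otimes>\<^sub>M L \<rightarrow>\<^sub>M ?M \<Otimes>\<^sub>M borel"
    proof -
      have "(\<lambda>s. real n * (1 + s)) \<in> L \<rightarrow>\<^sub>M borel"
        unfolding L_def by (rule measurable_restrict_space1) simp
      then show ?thesis by measurable
    qed
    from measurable_compose[OF this km] show ?thesis by (simp add: split_beta)
  qed
  have km'': "(\<lambda>(\<omega>, s). k \<omega> (real n * (1 + s))) \<in> borel_measurable (P z \<Otimes>\<^sub>M L)" for n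
  proof -
    have "subalgebra (P z) ?M" using sub by (simp add: subalgebra_def)
    then have "(\<lambda>z. (fst z, snd z)) \<in> P z \<Otimes>\<^sub>M L \<rightarrow>\<^sub>M ?M \<Otimes>\<^sub>M L"
      by (intro measurable_Pair measurable_snd measurable_compose[OF measurable_fst measurable_from_subalg[OF _ measurable_ident_sets[OF refl]]])
    from measurable_compose[OF this km'[of n]] show ?thesis by (simp add: split_beta)
  qed
  have k1: "\<bar>k \<omega> t\<bar> \<le> 1" for \<omega> t by (simp add: k_def K01)
  define U where "U n \<omega> = window_average (k \<omega>) n" for n \<omega>
  have U_L: "U n \<omega> = (\<integral>s. k \<omega> (real n * (1 + s)) \<partial>L)" for n \<omega>
    by (simp add: U_def window_average_def L_def)
  have Um: "U n \<in> borel_measurable ?M" for n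
    unfolding U_L using km'[of n] by (intro L.borel_measurable_lebesgue_integral)
  have UmP: "U n \<in> borel_measurable (P z)" for n
    using Um sub by (intro measurable_from_subalg[of "P z" ?M]) (auto simp: subalgebra_def)
  have U1: "\<bar>U n \<omega>\<bar> \<le> 1" if "\<omega> \<in> paths" for n \<omega>
  proof -
    have "(\<lambda>s. k \<omega> (real n * (1 + s))) \<in> borel_measurable L"
      using measurable_compose[OF measurable_Pair1'[of \<omega> ?M L] km'[of n]] that by simp
    then have "integrable L (\<lambda>s. k \<omega> (real n * (1 + s)))"
      using k1 by (intro L.integrable_const_bound[of _ 1]) auto
    then have "\<bar>U n \<omega>\<bar> \<le> (\<integral>s. 1 \<partial>L)"
      unfolding U_L using k1 by (intro integral_abs_bound_integral) auto
    then show ?thesis by (simp add: L.prob_space)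
  qed
  have Ei: "integrable (P z) (indicator E :: _ \<Rightarrow> real)"
    using Es by (intro integrable_bounded[of _ _ 1]) (auto simp: indicator_def)
  have Ui: "integrable (P z) (U n)" for n
    using UmP U1 by (intro integrable_const_bound[of _ 1]) (auto intro: AE_I2)
  have L1: "(\<lambda>n. \<integral>\<omega>. norm (U n \<omega> - indicator E \<omega>) \<partial>P z) \<longlonglongrightarrow> 0"
  proof (rule LIMSEQ_I)
    fix e :: real assume e: "e > 0"
    obtain t0 where t0: "t0 \<ge> 0" "\<And>t. t \<ge> t0 \<Longrightarrow> (\<integral>\<omega>. \<bar>event_prob E (\<omega> t) - indicator E \<omega>\<bar> \<partial>P z) \<le> e / 2"
      using event_prob_converges_L1[OF E, of "e / 2" z] e by auto
    have "(\<integral>\<omega>. norm (U n \<omega> - indicator E \<omega>) \<partial>P z) \<le> e / 2" if n: "real n \<ge> t0" for n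
    proof -
      let ?f = "\<lambda>\<omega> s. \<bar>k \<omega> (real n * (1 + s)) - indicator E \<omega>\<bar>"
      have fm: "(\<lambda>(\<omega>, s). ?f \<omega> s) \<in> borel_measurable (P z \<Otimes>\<^sub>M L)"
      proof -
        have "(\<lambda>y. indicator E (fst y) :: real) \<in> borel_measurable (P z \<Otimes>\<^sub>M L)"
          using Es by measurable
        then show ?thesis using km''[of n] by (simp add: split_beta)
      qed
      have fb: "?f \<omega> s \<le> 2" for \<omega> s using k1[of \<omega> "real n * (1 + s)"] by (auto simp: indicator_def)
      have fi: "integrable (P z \<Otimes>\<^sub>M L) (\<lambda>(\<omega>, s). ?f \<omega> s)"
        using fm fb by (intro PL.integrable_const_bound[of _ 2]) auto
      have step: "norm (U n \<omega> - indicator E \<omega>) \<le> (\<integral>s. ?f \<omega> s \<partial>L)" if "\<omega> \<in> paths" for \<omega>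
      proof -
        have m: "(\<lambda>s. k \<omega> (real n * (1 + s))) \<in> borel_measurable L"
          using measurable_compose[OF measurable_Pair1'[of \<omega> ?M L] km'[of n]] that by simp
        then have i: "integrable L (\<lambda>s. k \<omega> (real n * (1 + s)))"
          using k1 by (intro L.integrable_const_bound[of _ 1]) auto
        have "U n \<omega> - indicator E \<omega> = (\<integral>s. k \<omega> (real n * (1 + s)) - indicator E \<omega> \<partial>L)"
          using i by (simp add: U_L L.prob_space)
        then show ?thesis using integral_norm_bound[of L "\<lambda>s. k \<omega> (real n * (1 + s)) - indicator E \<omega>"] by simp
      qed
      have "(\<integral>\<omega>. norm (U n \<omega> - indicator E \<omega>) \<partial>P z) \<le> (\<integral>\<omega>. (\<integral>s. ?f \<omega> s \<partial>L) \<partial>P z)"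
        using Ui Ei PL.integrable_fst[OF fi] step by (intro integral_mono) auto
      also have "\<dots> = (\<integral>s. (\<integral>\<omega>. ?f \<omega> s \<partial>P z) \<partial>L)"
        by (rule PL.Fubini_integral[OF fi, symmetric])
      also have "\<dots> \<le> (\<integral>s. e / 2 \<partial>L)"
      proof (intro integral_mono PL.integrable_snd[OF fi])
        fix s assume "s \<in> space L"
        then have s: "0 \<le> s" by (auto simp: L_def space_restrict_space)
        have "real n * 1 \<le> real n * (1 + s)" using s by (intro mult_left_mono) auto
        then have "(\<integral>\<omega>. \<bar>event_prob E (\<omega> (real n * (1 + s))) - indicator E \<omega>\<bar> \<partial>P z) \<le> e / 2"
          using n by (intro t0(2)) simp
        then show "(\<integral>\<omega>. ?f \<omega> s \<partial>P z) \<le> e / 2" using s by (simp add: k_def K)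
      qed simp
      also have "\<dots> = e / 2" by (simp add: L.prob_space)
      finally show ?thesis .
    qed
    moreover obtain N :: nat where "t0 \<le> real N" using real_arch_simple by blast
    ultimately have "norm ((\<integral>\<omega>. norm (U n \<omega> - indicator E \<omega>) \<partial>P z) - 0) < e" if "n \<ge> N" for n
    proof -
      have "real n \<ge> t0" using that \<open>t0 \<le> real N\<close> by linarith
      then show ?thesis
        using \<open>\<And>n. real n \<ge> t0 \<Longrightarrow> (\<integral>\<omega>. norm (U n \<omega> - indicator E \<omega>) \<partial>P z) \<le> e / 2\<close>[of n] e
        by (simp add: abs_of_nonneg)
    qed
    then show "\<exists>no. \<forall>n\<ge>no. norm ((\<integral>\<omega>. norm (U n \<omega> - indicator E \<omega>) \<partial>P z) - 0) < e" by blast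
  qed
  have "integrable (P z) (\<lambda>\<omega>. U n \<omega> - indicator E \<omega>)" for n using Ui Ei by simp
  from tendsto_L1_AE_subseq[OF this L1] obtain r where r: "strict_mono r"
    "AE \<omega> in P z. (\<lambda>n. U (r n) \<omega> - indicator E \<omega>) \<longlonglongrightarrow> 0" by blast
  \<comment> \<open>A shift changes the averages by a null sequence, so their convergence to \<open>1\<close> is exactly invariant under shifts.\<close>
  define B where "B = {\<omega> \<in> paths. (\<lambda>n. U (r n) \<omega>) \<longlonglongrightarrow> 1}"
  have BM: "B \<in> sets ?M"
  proof -
    have "{\<omega> \<in> space ?M. \<forall>m. \<exists>N. \<forall>n. N \<le> n \<longrightarrow> \<bar>U (r n) \<omega> - 1\<bar> < inverse (real (Suc m))} \<in> sets ?M"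
      using Um by measurable
    moreover have lim_iff: "(\<lambda>n. U (r n) \<omega>) \<longlonglongrightarrow> 1 \<longleftrightarrow>
        (\<forall>m. \<exists>N. \<forall>n. N \<le> n \<longrightarrow> \<bar>U (r n) \<omega> - 1\<bar> < inverse (real (Suc m)))" for \<omega>
    proof
      assume lim: "(\<lambda>n. U (r n) \<omega>) \<longlonglongrightarrow> 1"
      show "\<forall>m. \<exists>N. \<forall>n. N \<le> n \<longrightarrow> \<bar>U (r n) \<omega> - 1\<bar> < inverse (real (Suc m))"
      proof
        fix m
        show "\<exists>N. \<forall>n. N \<le> n \<longrightarrow> \<bar>U (r n) \<omega> - 1\<bar> < inverse (real (Suc m))"
          using LIMSEQ_D[OF lim, of "inverse (real (Suc m))"] by simp
      qed
    next
      assume R: "\<forall>m. \<exists>N. \<forall>n. N \<le> n \<longrightarrow> \<bar>U (r n) \<omega> - 1\<bar> < inverse (real (Suc m))"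
      show "(\<lambda>n. U (r n) \<omega>) \<longlonglongrightarrow> 1"
      proof (rule LIMSEQ_I)
        fix e :: real assume "e > 0"
        then obtain m where "inverse (real (Suc m)) < e" using reals_Archimedean by blast
        then show "\<exists>no. \<forall>n\<ge>no. norm (U (r n) \<omega> - 1) < e" using R by (metis order_less_trans real_norm_def)
      qed
    qed
    ultimately show ?thesis by (simp only: B_def lim_iff space_observed)
  qed
  have U_shift: "\<bar>U n (shift u \<omega>) - U n \<omega>\<bar> \<le> 2 * u / n" if "\<omega> \<in> paths" "0 \<le> u" "n > 0" for n u \<omega>
  proof -
    have "U n (shift u \<omega>) = window_average (\<lambda>t. k \<omega> (t + u)) n"
      unfolding U_def using that by (intro window_average_cong) (simp add: k_def)
    moreover have "k \<omega> \<in> borel_measurable borel"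
      using measurable_compose[OF measurable_Pair1'[of \<omega> ?M borel] km] that by simp
    ultimately show ?thesis
      using window_average_shift[of "k \<omega>" n u] k1 that by (simp add: U_def)
  qed
  have "shift u -` B \<inter> paths = B" if u: "u > 0" for u
  proof -
    have "(\<lambda>n. U (r n) (shift u \<omega>)) \<longlonglongrightarrow> 1 \<longleftrightarrow> (\<lambda>n. U (r n) \<omega>) \<longlonglongrightarrow> 1" if \<omega>: "\<omega> \<in> paths" for \<omega>
    proof -
      have lim: "(\<lambda>n. U (r n) (shift u \<omega>) - U (r n) \<omega>) \<longlonglongrightarrow> 0"
      proof (rule Lim_null_comparison)
        have "(\<lambda>n. 2 * u / real n) \<longlonglongrightarrow> 0" by (rule lim_const_over_n)
        from LIMSEQ_subseq_LIMSEQ[OF this r(1)] show "(\<lambda>n. 2 * u / real (r n)) \<longlonglongrightarrow> 0" by (simp add: o_def)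
        have "norm (U (r n) (shift u \<omega>) - U (r n) \<omega>) \<le> 2 * u / real (r n)" if "n > 0" for n
          using U_shift[OF \<omega>, of u "r n"] u seq_suble[OF r(1), of n] that by simp
        then show "\<forall>\<^sub>F n in sequentially. norm (U (r n) (shift u \<omega>) - U (r n) \<omega>) \<le> 2 * u / real (r n)"
          by (intro eventually_sequentiallyI[of 1]) simp
      qed
      show ?thesis
      proof
        assume "(\<lambda>n. U (r n) (shift u \<omega>)) \<longlonglongrightarrow> 1"
        from tendsto_diff[OF this lim] show "(\<lambda>n. U (r n) \<omega>) \<longlonglongrightarrow> 1" by simp
      next
        assume "(\<lambda>n. U (r n) \<omega>) \<longlonglongrightarrow> 1"
        from tendsto_add[OF this lim] show "(\<lambda>n. U (r n) (shift u \<omega>)) \<longlonglongrightarrow> 1" by simp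
      qed
    qed
    then show ?thesis using u by (auto simp: B_def shift_in_paths)
  qed
  with BM have "B \<in> inv_field fst" by (simp add: inv_field_iff)
  moreover have "AE \<omega> in P z. \<omega> \<in> E \<longleftrightarrow> \<omega> \<in> B"
    using r(2) AE_space
  proof eventually_elim
    fix \<omega> assume \<omega>: "(\<lambda>n. U (r n) \<omega> - indicator E \<omega>) \<longlonglongrightarrow> 0" "\<omega> \<in> space (P z)"
    then have "(\<lambda>n. U (r n) \<omega>) \<longlonglongrightarrow> indicator E \<omega>" by (simp add: LIM_zero_iff)
    then show "\<omega> \<in> E \<longleftrightarrow> \<omega> \<in> B"
      using LIMSEQ_unique \<omega>(2) by (fastforce simp: B_def indicator_def split: if_splits)
  qed
  ultimately show ?thesis by blast
qed


section \<open>The invariant sigma field\<close>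

text \<open>
  The section at \<open>k\<close> is the set of paths that belong to \<open>A\<close> after the translation that moves their
  limit to \<open>k\<close>.
\<close>

definition recentred :: "(real \<Rightarrow> 'x \<times> 'g) set \<Rightarrow> ('g \<times> (real \<Rightarrow> 'x \<times> 'g)) set" where
  "recentred A = {(k, \<omega>). \<omega> \<in> conv_paths \<and> transl (k \<otimes> inv (snd_limit \<omega>)) \<omega> \<in> A}"

lemma conv_paths_sets: "conv_paths \<in> sets (observed (id :: 'x \<times> 'g \<Rightarrow> _) {0..})"
  using conv_paths_measurable(1)[OF regular_G locally_compact_G]
    sets_observed_le_id[OF continuous_projections(2), of "{0..}"] by blast

lemma snd_limit_measurable:
  "snd_limit \<in> restrict_space (observed (id :: 'x \<times> 'g \<Rightarrow> _) {0..}) conv_paths \<rightarrow>\<^sub>M borel"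
proof -
  let ?M = "observed (id :: 'x \<times> 'g \<Rightarrow> _) {0..}" and ?N = "observed (snd :: 'x \<times> 'g \<Rightarrow> _) {0..}"
  have "sets (restrict_space ?N conv_paths) \<subseteq> sets (restrict_space ?M conv_paths)"
    using sets_observed_le_id[OF continuous_projections(2), of "{0..}"] by (auto simp: sets_restrict_space)
  then have "subalgebra (restrict_space ?M conv_paths) (restrict_space ?N conv_paths)"
    by (simp add: subalgebra_def space_restrict_space)
  from measurable_from_subalg[OF this conv_paths_measurable(2)[OF regular_G locally_compact_G]]
  show ?thesis .
qed

lemma snd_limit_inv_field:
  assumes C: "C \<in> sets (borel :: 'g measure)"
  shows "{\<omega> \<in> conv_paths. snd_limit \<omega> \<in> C} \<in> inv_field (id :: 'x \<times> 'g \<Rightarrow> _)"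
  unfolding inv_field_iff
proof (intro conjI allI impI)
  let ?M = "observed (id :: 'x \<times> 'g \<Rightarrow> _) {0..}"
  have "snd_limit -` C \<inter> space (restrict_space ?M conv_paths) \<in> sets (restrict_space ?M conv_paths)"
    using snd_limit_measurable C by (rule measurable_sets)
  moreover have "conv_paths \<inter> space ?M \<in> sets ?M" by (intro sets.Int conv_paths_sets sets.top)
  ultimately have "snd_limit -` C \<inter> (conv_paths \<inter> paths) \<in> sets ?M"
    by (simp add: sets_restrict_space_iff space_restrict_space)
  moreover have "snd_limit -` C \<inter> (conv_paths \<inter> paths) = {(\<omega> :: real \<Rightarrow> 'x \<times> 'g). \<omega> \<in> conv_paths \<and> snd_limit \<omega> \<in> C}"
    by (auto simp: conv_paths_def)
  ultimately show "{\<omega> \<in> conv_paths. snd_limit \<omega> \<in> C} \<in> sets ?M" by (simp only:)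
  fix s :: real assume s: "s > 0"
  have "shift s \<omega> \<in> conv_paths \<and> snd_limit (shift s \<omega>) \<in> C \<longleftrightarrow> \<omega> \<in> conv_paths \<and> snd_limit \<omega> \<in> C"
    if "\<omega> \<in> paths" for \<omega> :: "real \<Rightarrow> 'x \<times> 'g"
    using conv_paths_shift[OF less_imp_le[OF s] that] by simp
  moreover have "\<omega> \<in> paths" if "\<omega> \<in> conv_paths" for \<omega> :: "real \<Rightarrow> 'x \<times> 'g"
    using that by (simp add: conv_paths_def)
  ultimately show "shift s -` {\<omega> \<in> conv_paths. snd_limit \<omega> \<in> C} \<inter> paths =
      {(\<omega> :: real \<Rightarrow> 'x \<times> 'g). \<omega> \<in> conv_paths \<and> snd_limit \<omega> \<in> C}"
    by blast
qed

lemma recentred_measurable: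
  assumes A: "A \<in> inv_field id"
  shows "recentred A \<in> sets (borel \<Otimes>\<^sub>M observed id {0..})"
proof -
  let ?M = "observed (id :: 'x \<times> 'g \<Rightarrow> _) {0..}"
  define \<gamma> where "\<gamma> \<omega> = (if \<omega> \<in> conv_paths then snd_limit \<omega> else \<one>)" for \<omega> :: "real \<Rightarrow> 'x \<times> 'g"
  have \<gamma>: "\<gamma> \<in> ?M \<rightarrow>\<^sub>M borel"
    unfolding \<gamma>_def using snd_limit_measurable sets.Int[OF conv_paths_sets sets.top[of ?M]]
    by (subst measurable_restrict_space_iff[symmetric]) simp_all
  have \<gamma>_eq: "\<gamma> \<omega> = snd_limit \<omega>" if "\<omega> \<in> conv_paths" for \<omega> using that by (simp add: \<gamma>_def)
  have conv_sub: "\<omega> \<in> paths" if "\<omega> \<in> conv_paths" for \<omega> :: "real \<Rightarrow> 'x \<times> 'g"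
    using that by (simp add: conv_paths_def)
  have "(\<lambda>z. fst z \<otimes> inv (\<gamma> (snd z))) \<in> borel \<Otimes>\<^sub>M ?M \<rightarrow>\<^sub>M borel"
    by (intro mult_measurable' measurable_compose[OF _ inv_measurable] measurable_compose[OF measurable_snd \<gamma>] measurable_fst)
  from measurable_compose[OF measurable_Pair[OF this measurable_snd] translate_measurable_pair[of "{0..}"]]
  have T: "(\<lambda>z. transl (fst z \<otimes> inv (\<gamma> (snd z))) (snd z)) \<in> borel \<Otimes>\<^sub>M ?M \<rightarrow>\<^sub>M ?M"
    by simp
  have "A \<in> sets ?M" using A by (simp only: inv_field_iff)
  from measurable_sets[OF T this]
  have "((\<lambda>z. transl (fst z \<otimes> inv (\<gamma> (snd z))) (snd z)) -` A \<inter> space (borel \<Otimes>\<^sub>M ?M)) \<inter> (UNIV \<times> conv_paths)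
     \<in> sets (borel \<Otimes>\<^sub>M ?M)"
    by (rule sets.Int) (intro pair_measureI conv_paths_sets, simp)
  moreover have "((\<lambda>z. transl (fst z \<otimes> inv (\<gamma> (snd z))) (snd z)) -` A \<inter> space (borel \<Otimes>\<^sub>M ?M)) \<inter> (UNIV \<times> conv_paths)
     = recentred A"
    using \<gamma>_eq conv_sub by (auto simp: recentred_def space_pair_measure)
  ultimately show ?thesis by (simp only:)
qed

text \<open>
  Moving the limit to \<open>k\<close> undoes a preceding translation of the path, and a time shift does not change
  the limit.
\<close>

lemma recentred_section:
  assumes A: "A \<in> inv_field id"
  shows "Pair k -` recentred A \<in> inv_field id" "transl h -` (Pair k -` recentred A) \<inter> paths = Pair k -` recentred A"
proof -
  have inA: "shift s \<omega> \<in> A \<longleftrightarrow> \<omega> \<in> A" if "s > 0" "\<omega> \<in> paths" for s \<omega>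
  proof -
    have "shift s -` A \<inter> paths = A" using A that by (simp add: inv_field_iff)
    then show ?thesis using that by blast
  qed
  have cp: "\<omega> \<in> paths" if "\<omega> \<in> conv_paths" for \<omega> :: "real \<Rightarrow> 'x \<times> 'g" using that by (simp add: conv_paths_def)
  have "shift s \<omega> \<in> Pair k -` recentred A \<longleftrightarrow> \<omega> \<in> Pair k -` recentred A" if s: "s > 0" "\<omega> \<in> paths" for s \<omega>
  proof -
    have "transl (k \<otimes> inv (snd_limit (shift s \<omega>))) (shift s \<omega>) = shift s (transl (k \<otimes> inv (snd_limit \<omega>)) \<omega>)"
      using s by (simp add: conv_paths_shift shift_translate)
    then show ?thesis
      using s inA[OF s(1) translate_in_paths[OF s(2)]] by (simp add: recentred_def conv_paths_shift)
  qed
  moreover have "Pair k -` recentred A \<subseteq> paths" using cp by (auto simp: recentred_def)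
  ultimately have "\<forall>s>0. shift s -` (Pair k -` recentred A) \<inter> paths = Pair k -` recentred A" by blast
  then show "Pair k -` recentred A \<in> inv_field id"
    using sets_Pair1[OF recentred_measurable[OF A]] by (simp add: inv_field_iff)
  have conv: "transl h \<omega> \<in> conv_paths \<longleftrightarrow> \<omega> \<in> conv_paths" if "\<omega> \<in> paths" for h and \<omega> :: "real \<Rightarrow> 'x \<times> 'g"
  proof
    assume "transl h \<omega> \<in> conv_paths"
    from conv_paths_translate(1)[OF this, of "inv h"] show "\<omega> \<in> conv_paths"
      using that by (simp add: translate_translate translate_one)
  qed (rule conv_paths_translate)
  have "transl h \<omega> \<in> Pair k -` recentred A \<longleftrightarrow> \<omega> \<in> Pair k -` recentred A" if "\<omega> \<in> paths" for \<omega>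
  proof (cases "\<omega> \<in> conv_paths")
    case True
    have "transl (k \<otimes> inv (h \<otimes> snd_limit \<omega>)) (transl h \<omega>) = transl (k \<otimes> inv (snd_limit \<omega>)) \<omega>"
      by (simp add: translate_translate inv_mult_group m_assoc)
    then show ?thesis using True conv_paths_translate[OF True, of h] by (simp add: recentred_def)
  qed (use conv[OF that] in \<open>simp add: recentred_def\<close>)
  then show "transl h -` (Pair k -` recentred A) \<inter> paths = Pair k -` recentred A"
    using cp by (auto simp: recentred_def)
qed

text \<open>
  For an event \<open>C\<close> of finite time \<open>t\<close>, the probability of \<open>C\<close> and the translate of \<open>A\<close> is the integral
  over \<open>C\<close> of \<open>event_prob A\<close> at the translate of \<open>\<omega> t\<close>, which is continuous in the translation because
  \<open>event_prob A\<close> is a continuous function.  Choosing for \<open>C\<close> an approximation of \<open>A\<close>, the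
  translates of \<open>A\<close> almost contain \<open>A\<close>; since their probabilities converge to that of \<open>A\<close>, the
  symmetric differences are small.
\<close>

lemma translate_continuous_in_probability:
  assumes A: "A \<in> inv_field id" and k: "\<kappa> \<longlonglongrightarrow> \<one>" and e: "(e::real) > 0"
  shows "\<forall>\<^sub>F n in sequentially. measure (P z) (sym_diff A (transl (\<kappa> n) -` A \<inter> paths)) < e"
proof -
  interpret prob_space "P z" by (rule prob_space_P)
  define T where "T n = transl (\<kappa> n) -` A \<inter> paths" for n
  have T: "T n \<in> inv_field id" for n unfolding T_def by (rule translate_vimage_inv_field[OF A])
  note Ts = inv_field_sets[OF T, of _ z] and As = inv_field_sets[OF A, of z]
  have hT: "event_prob (T n) y = event_prob A (fst y, \<kappa> n \<otimes> snd y)" for n y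
    unfolding T_def using event_prob_translate[OF A, of "\<kappa> n" "fst y" "snd y"] by simp
  have lim: "(\<lambda>n. event_prob (T n) y) \<longlonglongrightarrow> event_prob A y" for y
  proof -
    have "isCont (event_prob A) (fst y, \<one> \<otimes> snd y)"
      using event_prob_continuous[OF A] unfolding continuous_on_eq_continuous_at[OF open_UNIV] by blast
    from isCont_tendsto_compose[OF this tendsto_Pair[OF tendsto_const mult_tendsto[OF k tendsto_const]]]
    show ?thesis by (simp add: hT)
  qed
  have lim_C: "(\<lambda>n. measure (P z) (C \<inter> T n)) \<longlonglongrightarrow> measure (P z) (C \<inter> A)"
    if t: "0 \<le> t" and C: "C \<in> sets (observed id {0..t})" for t C
  proof -
    have Cs: "C \<in> sets (P z)" by (rule observed_sets[OF _ C]) auto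
    have "(\<lambda>n. \<integral>\<omega>. indicator C \<omega> * event_prob (T n) (\<omega> t) \<partial>P z) \<longlonglongrightarrow> (\<integral>\<omega>. indicator C \<omega> * event_prob A (\<omega> t) \<partial>P z)"
    proof (rule integral_dominated_convergence[where w="\<lambda>_. 1"])
      show "(\<lambda>\<omega>. indicator C \<omega> * event_prob (T n) (\<omega> t)) \<in> borel_measurable (P z)" for n
        using Cs event_prob_coordinate_measurable[OF T t] by measurable
      show "(\<lambda>\<omega>. indicator C \<omega> * event_prob A (\<omega> t)) \<in> borel_measurable (P z)"
        using Cs event_prob_coordinate_measurable[OF A t] by measurable
      show "AE \<omega> in P z. (\<lambda>n. indicator C \<omega> * event_prob (T n) (\<omega> t)) \<longlonglongrightarrow> indicator C \<omega> * event_prob A (\<omega> t)"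
        by (intro AE_I2 tendsto_mult tendsto_const lim)
      show "AE \<omega> in P z. norm (indicator C \<omega> * event_prob (T n) (\<omega> t)) \<le> 1" for n
      proof (rule AE_I2)
        fix \<omega> show "norm (indicator C \<omega> * event_prob (T n) (\<omega> t)) \<le> 1"
          using event_prob_bounds[of "T n" "\<omega> t"] by (simp add: indicator_def)
      qed
    qed simp
    then show ?thesis by (simp only: markov_invariant_event[OF T t C] markov_invariant_event[OF A t C])
  qed
  obtain t C where C: "0 \<le> t" "C \<in> sets (observed id {0..t})" "measure (P z) (sym_diff A C) < e / 8"
    using finite_time_approximation[OF As, of "e / 8"] e by auto
  have Cs: "C \<in> sets (P z)" by (rule observed_sets[OF _ C(2)]) auto
  have paths: "paths \<in> sets (observed (id :: 'x \<times> 'g \<Rightarrow> _) {0..0})"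
    using sets.top[of "observed (id :: 'x \<times> 'g \<Rightarrow> _) {0..0}"] by simp
  have "(\<lambda>n. measure (P z) (T n)) \<longlonglongrightarrow> measure (P z) A"
    using lim_C[OF order_refl paths] sets_Int_paths[OF Ts] sets_Int_paths[OF As] by (simp add: Int_commute)
  then have "\<forall>\<^sub>F n in sequentially. measure (P z) (T n) < measure (P z) A + e / 8"
    using e by (intro order_tendstoD) auto
  moreover have "\<forall>\<^sub>F n in sequentially. measure (P z) (C \<inter> T n) > measure (P z) (C \<inter> A) - e / 8"
    using lim_C[OF C(1,2)] e by (intro order_tendstoD) auto
  ultimately show ?thesis
  proof eventually_elim
    fix n assume n: "measure (P z) (T n) < measure (P z) A + e / 8"
      "measure (P z) (C \<inter> T n) > measure (P z) (C \<inter> A) - e / 8"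
    have "sym_diff C A = sym_diff A C" by auto
    then have "measure (P z) (A \<inter> T n) \<ge> measure (P z) (C \<inter> T n) - measure (P z) (sym_diff A C)"
      using measure_Int_close[OF Cs As Ts[of n]] by simp
    moreover have "measure (P z) (C \<inter> A) \<ge> measure (P z) A - measure (P z) (sym_diff A C)"
      using measure_Int_close[OF As Cs As] by simp
    moreover have "measure (P z) (sym_diff A (T n)) = measure (P z) (A - T n) + measure (P z) (T n - A)"
      using As Ts by (intro finite_measure_Union) auto
    moreover have "measure (P z) (A - T n) = measure (P z) A - measure (P z) (A \<inter> T n)"
      using As Ts by (simp add: finite_measure_Diff')
    moreover have "measure (P z) (T n - A) = measure (P z) (T n) - measure (P z) (A \<inter> T n)"
      using As Ts by (simp add: finite_measure_Diff' Int_commute)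
    ultimately show "measure (P z) (sym_diff A (transl (\<kappa> n) -` A \<inter> paths)) < e"
      unfolding T_def[symmetric] using n C(3) e by linarith
  qed
qed

definition limit_field :: "((real \<Rightarrow> 'x \<times> 'g) \<Rightarrow> 'g) \<Rightarrow> (real \<Rightarrow> 'x \<times> 'g) set set" where
  "limit_field \<gamma> = sigma_sets paths (inv_field fst \<union> sets (vimage_algebra paths \<gamma> borel))"

lemma limit_field_generators: "inv_field fst \<union> sets (vimage_algebra paths \<gamma> borel) \<subseteq> Pow paths"
proof (intro Un_least subsetI PowI)
  show "y \<in> paths" if "x \<in> inv_field fst" "y \<in> x" for x y using inv_field_subset that by blast
  show "y \<in> paths" if "x \<in> sets (vimage_algebra paths \<gamma> borel)" "y \<in> x" for x y
    using sets.sets_into_space[OF that(1)] that(2) by auto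
qed

lemma sigma_algebra_limit_field: "sigma_algebra paths (limit_field \<gamma>)"
  unfolding limit_field_def by (rule sigma_algebra_sigma_sets[OF limit_field_generators])

lemma limit_field_subset:
  assumes "is_group_limit (P z) \<gamma>"
  shows "limit_field \<gamma> \<subseteq> sets (P z)"
proof -
  have "\<gamma> -` C \<inter> paths \<in> sets (P z)" if "C \<in> sets borel" for C
    using assms that measurable_sets[of \<gamma> path_space borel C] by (simp add: is_group_limit_def sets_P')
  moreover have "inv_field fst \<subseteq> sets (P z)"
    using inv_field_subset_id[OF continuous_projections(1)] inv_field_sets by blast
  ultimately have "inv_field fst \<union> sets (vimage_algebra paths \<gamma> borel) \<subseteq> sets (P z)"
    by (auto simp: sets_vimage_algebra2)
  from sets.sigma_sets_subset[OF this] show ?thesis by (simp only: limit_field_def space_P)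
qed

lemma group_limit_AE:
  assumes "is_group_limit (P z) \<gamma>"
  shows "AE \<omega> in P z. \<omega> \<in> conv_paths \<and> snd_limit \<omega> = \<gamma> \<omega>"
proof -
  have "AE \<omega> in P z. ((\<lambda>t. snd (\<omega> t)) \<longlongrightarrow> \<gamma> \<omega>) at_top" using assms by (simp add: is_group_limit_def)
  with AE_space show ?thesis
    by eventually_elim (auto simp: conv_paths_def snd_limit_eq)
qed

text \<open>
  For \<open>\<omega>\<close> with limit \<open>\<gamma> \<omega>\<close>, the path \<open>transl k \<omega>\<close> is in \<open>A\<close> iff \<open>(k \<gamma>(\<omega>), \<omega>)\<close> is in \<open>recentred A\<close>.
  For fixed \<open>\<omega>\<close> the map \<open>k \<mapsto> k \<gamma>(\<omega>)\<close> preserves the null sets of \<open>\<nu>\<close>, so \<open>recentred A\<close> can be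
  replaced by its jointly measurable version \<open>S'\<close>.
\<close>

lemma almost_every_translate:
  assumes A: "A \<in> inv_field id" and \<gamma>: "is_group_limit (P z) \<gamma>"
    and \<nu>: "prob_space \<nu>" "sets \<nu> = sets borel"
      "\<And>N g. N \<in> null_sets \<nu> \<Longrightarrow> {k. k \<otimes> g \<in> N} \<in> null_sets \<nu>"
  shows "AE k in \<nu>. \<exists>B\<in>limit_field \<gamma>. AE \<omega> in P z. transl k \<omega> \<in> A \<longleftrightarrow> \<omega> \<in> B"
proof -
  interpret nu: prob_space \<nu> by (rule \<nu>(1))
  interpret prob_space "P z" by (rule prob_space_P)
  interpret nuP: pair_prob_space \<nu> "P z" ..
  have sp\<nu>: "space \<nu> = UNIV" using sets_eq_imp_space_eq[OF \<nu>(2)] by simp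
  define F where "F = sigma paths (inv_field (fst :: 'x \<times> 'g \<Rightarrow> 'x))"
  interpret I: sigma_algebra paths "inv_field (fst :: 'x \<times> 'g \<Rightarrow> 'x)" by (rule sigma_algebra_inv_field)
  have F: "space F = paths" "sets F = inv_field fst"
    using I.space_closed by (simp_all add: F_def I.sigma_sets_eq)
  have FP: "subalgebra (P z) F"
    using inv_field_subset_id[OF continuous_projections(1)] inv_field_sets[of _ z] F
    unfolding subalgebra_def space_P by blast
  have Q: "sets (\<nu> \<Otimes>\<^sub>M P z) = sets (borel \<Otimes>\<^sub>M observed id {0..})"
    by (intro sets_pair_measure_cong \<nu>(2) sets_P)
  have S: "recentred A \<in> sets (\<nu> \<Otimes>\<^sub>M P z)" using recentred_measurable[OF A] Q by simp
  have "\<exists>B\<in>sets F. AE \<omega> in P z. (k, \<omega>) \<in> recentred A \<longleftrightarrow> \<omega> \<in> B" for k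
    using translation_invariant_event[OF recentred_section[OF A], of k z] F(2) by simp
  from jointly_measurable_version[OF \<nu>(1) prob_space_axioms FP S this]
  obtain S' where S': "S' \<in> sets (\<nu> \<Otimes>\<^sub>M F)"
    "AE y in \<nu> \<Otimes>\<^sub>M P z. y \<in> recentred A \<longleftrightarrow> y \<in> S'" by blast
  have S'P: "S' \<in> sets (\<nu> \<Otimes>\<^sub>M P z)" using product_subalgebra[OF FP, of \<nu>] S'(1) by (auto simp: subalgebra_def)
  \<comment> \<open>The exceptional set, first null at almost every \<open>(k, \<omega>)\<close>, then after the substitution \<open>k \<mapsto> k \<gamma>(\<omega>)\<close>.\<close>
  define D where "D = sym_diff (recentred A) S'"
  have Ds: "D \<in> sets (\<nu> \<Otimes>\<^sub>M P z)" using S S'P by (simp add: D_def)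
  have spQ: "space (\<nu> \<Otimes>\<^sub>M P z) = UNIV \<times> paths" by (simp add: space_pair_measure sp\<nu>)
  have D0: "AE y in \<nu> \<Otimes>\<^sub>M P z. (fst y, snd y) \<notin> D" using S'(2) by eventually_elim (auto simp: D_def)
  have meas: "{y \<in> space (\<nu> \<Otimes>\<^sub>M P z). (fst y, snd y) \<notin> D} \<in> sets (\<nu> \<Otimes>\<^sub>M P z)"
    using Ds by simp
  have "AE k in \<nu>. AE \<omega> in P z. (k, \<omega>) \<notin> D"
    using nuP.AE_pair[OF D0] by simp
  then have AE1: "AE \<omega> in P z. AE k in \<nu>. (k, \<omega>) \<notin> D"
    using nuP.AE_commute[OF meas] by simp
  have \<gamma>m: "\<gamma> \<in> P z \<rightarrow>\<^sub>M borel" using \<gamma> by (simp add: is_group_limit_def measurable_cong_sets[OF sets_P' refl])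
  have \<theta>: "(\<lambda>y. (fst y \<otimes> \<gamma> (snd y), snd y)) \<in> \<nu> \<Otimes>\<^sub>M P z \<rightarrow>\<^sub>M \<nu> \<Otimes>\<^sub>M P z"
  proof -
    have "(\<lambda>y. fst y \<otimes> \<gamma> (snd y)) \<in> \<nu> \<Otimes>\<^sub>M P z \<rightarrow>\<^sub>M borel"
      by (intro mult_measurable' measurable_compose[OF measurable_snd \<gamma>m])
        (simp add: measurable_fst'' measurable_cong_sets[OF refl \<nu>(2)[symmetric]])
    then show ?thesis by (intro measurable_Pair) (simp_all add: measurable_cong_sets[OF refl \<nu>(2)])
  qed
  have "AE \<omega> in P z. AE k in \<nu>. (k \<otimes> \<gamma> \<omega>, \<omega>) \<notin> D"
    using AE1 AE_space
  proof eventually_elim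
    fix \<omega> assume \<omega>: "AE k in \<nu>. (k, \<omega>) \<notin> D" "\<omega> \<in> space (P z)"
    have "{k. (k, \<omega>) \<in> D} \<in> sets \<nu>"
      using sets_Pair2[OF Ds, of \<omega>] by (simp add: vimage_def)
    then have "{k. (k, \<omega>) \<in> D} \<in> null_sets \<nu>"
      using \<omega>(1) by (subst AE_iff_null_sets) simp_all
    from \<nu>(3)[OF this, of "\<gamma> \<omega>"] show "AE k in \<nu>. (k \<otimes> \<gamma> \<omega>, \<omega>) \<notin> D"
      by (auto dest: AE_not_in)
  qed
  moreover have "{y \<in> space (\<nu> \<Otimes>\<^sub>M P z). (fst y \<otimes> \<gamma> (snd y), snd y) \<notin> D} =
      (\<lambda>y. (fst y \<otimes> \<gamma> (snd y), snd y)) -` (space (\<nu> \<Otimes>\<^sub>M P z) - D) \<inter> space (\<nu> \<Otimes>\<^sub>M P z)"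
    by (auto simp: spQ)
  then have "{y \<in> space (\<nu> \<Otimes>\<^sub>M P z). (fst y \<otimes> \<gamma> (snd y), snd y) \<notin> D} \<in> sets (\<nu> \<Otimes>\<^sub>M P z)"
    using measurable_sets[OF \<theta> sets.compl_sets[OF Ds]] by (simp only:)
  ultimately have "AE k in \<nu>. AE \<omega> in P z. (k \<otimes> \<gamma> \<omega>, \<omega>) \<notin> D"
    using nuP.AE_commute[of "\<lambda>k \<omega>. (k \<otimes> \<gamma> \<omega>, \<omega>) \<notin> D"] by simp
  then show ?thesis
  proof eventually_elim
    fix k assume k: "AE \<omega> in P z. (k \<otimes> \<gamma> \<omega>, \<omega>) \<notin> D"
    define B where "B = {\<omega> \<in> paths. (k \<otimes> \<gamma> \<omega>, \<omega>) \<in> S'}"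
    define \<BB> where "\<BB> = sigma paths (inv_field (fst :: 'x \<times> 'g \<Rightarrow> 'x) \<union> sets (vimage_algebra paths \<gamma> borel))"
    have \<BB>: "space \<BB> = paths" "sets \<BB> = limit_field \<gamma>"
      unfolding \<BB>_def limit_field_def
      by (rule space_measure_of[OF limit_field_generators] sets_measure_of[OF limit_field_generators])+
    have "\<gamma> \<in> \<BB> \<rightarrow>\<^sub>M borel"
    proof (rule measurableI)
      fix C assume C: "C \<in> sets (borel :: 'g measure)"
      then have "\<gamma> -` C \<inter> paths \<in> sets (vimage_algebra paths \<gamma> borel)" by (rule in_vimage_algebra)
      then show "\<gamma> -` C \<inter> space \<BB> \<in> sets \<BB>"
        unfolding \<BB> limit_field_def by (intro sigma_sets.Basic UnI2)
    qed simp
    then have "(\<lambda>\<omega>. k \<otimes> \<gamma> \<omega>) \<in> \<BB> \<rightarrow>\<^sub>M \<nu>"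
      by (simp add: measurable_cong_sets[OF refl \<nu>(2)] mult_measurable')
    moreover have "(\<lambda>\<omega>. \<omega>) \<in> \<BB> \<rightarrow>\<^sub>M F"
    proof (rule measurableI)
      fix C assume "C \<in> sets F"
      then have C: "C \<in> inv_field fst" using F by simp
      then have "C \<in> sets \<BB>" unfolding \<BB> limit_field_def by (intro sigma_sets.Basic UnI1)
      then show "(\<lambda>\<omega>. \<omega>) -` C \<inter> space \<BB> \<in> sets \<BB>" by auto
    qed (simp add: \<BB> F)
    ultimately have "(\<lambda>\<omega>. (k \<otimes> \<gamma> \<omega>, \<omega>)) \<in> \<BB> \<rightarrow>\<^sub>M \<nu> \<Otimes>\<^sub>M F" by (rule measurable_Pair)
    from measurable_sets[OF this S'(1)] have "B \<in> limit_field \<gamma>"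
      by (simp add: \<BB> B_def vimage_def Int_def conj_commute)
    moreover have "AE \<omega> in P z. transl k \<omega> \<in> A \<longleftrightarrow> \<omega> \<in> B"
      using k group_limit_AE[OF \<gamma>] AE_space
    proof eventually_elim
      fix \<omega> assume \<omega>: "(k \<otimes> \<gamma> \<omega>, \<omega>) \<notin> D" "\<omega> \<in> conv_paths \<and> snd_limit \<omega> = \<gamma> \<omega>" "\<omega> \<in> space (P z)"
      have "transl k \<omega> \<in> A \<longleftrightarrow> (k \<otimes> \<gamma> \<omega>, \<omega>) \<in> recentred A"
        using \<omega>(2) by (simp add: recentred_def m_assoc)
      then show "transl k \<omega> \<in> A \<longleftrightarrow> \<omega> \<in> B" using \<omega> by (auto simp: D_def B_def)
    qed
    ultimately show "\<exists>B\<in>limit_field \<gamma>. AE \<omega> in P z. transl k \<omega> \<in> A \<longleftrightarrow> \<omega> \<in> B" by blast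
  qed
qed

lemma sym_diff_null_iff:
  assumes "A \<in> sets (P z)" "B \<in> sets (P z)"
  shows "sym_diff A B \<in> null_sets (P z) \<longleftrightarrow> (AE \<omega> in P z. \<omega> \<in> A \<longleftrightarrow> \<omega> \<in> B)"
proof -
  have "sym_diff A B \<in> null_sets (P z) \<longleftrightarrow> (AE \<omega> in P z. \<omega> \<notin> sym_diff A B)"
    using assms by (intro AE_iff_null_sets) auto
  also have "\<dots> \<longleftrightarrow> (AE \<omega> in P z. \<omega> \<in> A \<longleftrightarrow> \<omega> \<in> B)" by (intro AE_cong) auto
  finally show ?thesis .
qed

text \<open>
  Since \<open>\<nu>\<close> charges every neighbourhood of the unit, the property of almost every translate holds
  along a sequence of translations that converges to the unit.
\<close>

lemma invariant_event_in_limit_field: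
  assumes A: "A \<in> inv_field id" and \<gamma>: "is_group_limit (P z) \<gamma>"
    and \<nu>: "prob_space \<nu>" "sets \<nu> = sets borel"
      "\<And>N g. N \<in> null_sets \<nu> \<Longrightarrow> {k. k \<otimes> g \<in> N} \<in> null_sets \<nu>"
      "\<And>U. open U \<Longrightarrow> U \<noteq> {} \<Longrightarrow> U \<notin> null_sets \<nu>"
  shows "\<exists>B\<in>limit_field \<gamma>. sym_diff A B \<in> null_sets (P z)"
proof -
  interpret prob_space "P z" by (rule prob_space_P)
  have As: "A \<in> sets (P z)" by (rule inv_field_sets[OF A])
  let ?good = "\<lambda>k. \<exists>B\<in>limit_field \<gamma>. AE \<omega> in P z. transl k \<omega> \<in> A \<longleftrightarrow> \<omega> \<in> B"
  have AE: "AE k in \<nu>. ?good k" by (rule almost_every_translate[OF A \<gamma> \<nu>(1-3)])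
  obtain U :: "nat \<Rightarrow> 'g set" where U: "\<And>n. open (U n)" "\<And>n. \<one> \<in> U n"
    "\<And>S. open S \<Longrightarrow> \<one> \<in> S \<Longrightarrow> \<forall>\<^sub>F n in sequentially. U n \<subseteq> S"
    using countable_basis_at_decseq[of "\<one>"] by metis
  have "\<exists>k\<in>U n. ?good k" for n
  proof (rule ccontr)
    assume "\<not> (\<exists>k\<in>U n. ?good k)"
    then have "AE k in \<nu>. k \<notin> U n" using AE by (auto elim: eventually_mono)
    then have "U n \<in> null_sets \<nu>" using U(1) \<nu>(2) by (subst AE_iff_null_sets) auto
    then show False using \<nu>(4)[OF U(1)] U(2) by blast
  qed
  then have "\<forall>n. \<exists>k. k \<in> U n \<and> ?good k" unfolding Bex_def[of "U _"] by (rule allI)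
  from choice[OF this] obtain \<kappa> where "\<forall>n. \<kappa> n \<in> U n \<and> ?good (\<kappa> n)" ..
  then have \<kappa>: "\<And>n. \<kappa> n \<in> U n" "\<And>n. ?good (\<kappa> n)" by simp_all
  have lim: "\<kappa> \<longlonglongrightarrow> \<one>"
  proof (rule topological_tendstoI)
    fix S :: "'g set" assume "open S" "\<one> \<in> S"
    from U(3)[OF this] show "\<forall>\<^sub>F n in sequentially. \<kappa> n \<in> S"
      by eventually_elim (use \<kappa>(1) in blast)
  qed
  show ?thesis
  proof (rule limit_of_close_sets[OF _ limit_field_subset[OF \<gamma>] As])
    show "sigma_algebra (space (P z)) (limit_field \<gamma>)" by (simp add: sigma_algebra_limit_field)
    fix e :: real assume "e > 0"
    from translate_continuous_in_probability[OF A lim this, of z]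
    obtain n where n: "measure (P z) (sym_diff A (transl (\<kappa> n) -` A \<inter> paths)) < e"
      by (auto simp: eventually_sequentially)
    obtain B where B: "B \<in> limit_field \<gamma>" "AE \<omega> in P z. transl (\<kappa> n) \<omega> \<in> A \<longleftrightarrow> \<omega> \<in> B" using \<kappa>(2) by blast
    have Bs: "B \<in> sets (P z)" using B(1) limit_field_subset[OF \<gamma>] by blast
    have Ts: "transl (\<kappa> n) -` A \<inter> paths \<in> sets (P z)"
      by (intro inv_field_sets translate_vimage_inv_field A)
    have "measure (P z) (sym_diff A B) = measure (P z) (sym_diff A (transl (\<kappa> n) -` A \<inter> paths))"
    proof (rule measure_eq_AE)
      show "AE \<omega> in P z. \<omega> \<in> sym_diff A B \<longleftrightarrow> \<omega> \<in> sym_diff A (transl (\<kappa> n) -` A \<inter> paths)"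
        using B(2) AE_space by eventually_elim auto
    qed (use As Bs Ts in auto)
    then have "measure (P z) (sym_diff A B) < e" using n by (simp only:)
    then show "\<exists>B\<in>limit_field \<gamma>. measure (P z) (sym_diff A B) < e" using B(1) by (rule bexI)
  qed
qed

lemma limit_field_event_invariant:
  assumes \<gamma>: "is_group_limit (P z) \<gamma>" and B: "B \<in> limit_field \<gamma>"
  shows "\<exists>A\<in>inv_field id. AE \<omega> in P z. \<omega> \<in> A \<longleftrightarrow> \<omega> \<in> B"
proof -
  interpret I: sigma_algebra paths "inv_field (id :: 'x \<times> 'g \<Rightarrow> _)" by (rule sigma_algebra_inv_field)
  show ?thesis
    using B unfolding limit_field_def
  proof (induction rule: sigma_sets.induct)
    case (Basic B)
    then show ?case
    proof
      assume "B \<in> inv_field fst"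
      then have "B \<in> inv_field id" using inv_field_subset_id[OF continuous_projections(1)] by blast
      then show ?thesis by (intro bexI[of _ B] AE_I2 refl)
    next
      assume "B \<in> sets (vimage_algebra paths \<gamma> borel)"
      then obtain C where C: "C \<in> sets borel" "B = \<gamma> -` C \<inter> paths" by (auto simp: sets_vimage_algebra2)
      have "AE \<omega> in P z. \<omega> \<in> {\<omega> \<in> conv_paths. snd_limit \<omega> \<in> C} \<longleftrightarrow> \<omega> \<in> B"
        using group_limit_AE[OF \<gamma>] AE_space by eventually_elim (auto simp: C)
      then show ?thesis using snd_limit_inv_field[OF C(1)] by blast
    qed
  next
    case Empty
    then show ?case by (intro bexI[of _ "{}"] I.empty_sets AE_I2 refl)
  next
    case (Compl B)
    then obtain A where A: "A \<in> inv_field id" "AE \<omega> in P z. \<omega> \<in> A \<longleftrightarrow> \<omega> \<in> B" by blast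
    from A(2) have "AE \<omega> in P z. \<omega> \<in> paths - A \<longleftrightarrow> \<omega> \<in> paths - B" by eventually_elim auto
    then show ?case using I.compl_sets[OF A(1)] by blast
  next
    case (Union B)
    have "\<forall>i. \<exists>A. A \<in> inv_field id \<and> (AE \<omega> in P z. \<omega> \<in> A \<longleftrightarrow> \<omega> \<in> B i)"
      using Union.IH unfolding Bex_def by (rule allI)
    from choice[OF this] obtain A where
      "\<forall>i. A i \<in> inv_field id \<and> (AE \<omega> in P z. \<omega> \<in> A i \<longleftrightarrow> \<omega> \<in> B i)" ..
    then have A: "\<And>i. A i \<in> inv_field id" "\<And>i. AE \<omega> in P z. \<omega> \<in> A i \<longleftrightarrow> \<omega> \<in> B i" by simp_all
    have "AE \<omega> in P z. \<forall>i. \<omega> \<in> A i \<longleftrightarrow> \<omega> \<in> B i" using A(2) by (simp add: AE_all_countable)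
    then have "AE \<omega> in P z. \<omega> \<in> (\<Union>i. A i) \<longleftrightarrow> \<omega> \<in> (\<Union>i. B i)" by eventually_elim auto
    moreover have "(\<Union>i. A i) \<in> inv_field id" by (intro I.countable_nat_UN) (use A(1) in blast)
    ultimately show ?case by blast
  qed
qed

theorem invariant_field_eq_limit_field:
  assumes \<gamma>: "is_group_limit (P z) \<gamma>"
    and \<nu>: "prob_space \<nu>" "sets \<nu> = sets borel"
      "\<And>N g. N \<in> null_sets \<nu> \<Longrightarrow> {k. k \<otimes> g \<in> N} \<in> null_sets \<nu>"
      "\<And>U. open U \<Longrightarrow> U \<noteq> {} \<Longrightarrow> U \<notin> null_sets \<nu>"
  shows "eq_up_to_null (P z) (inv_field id) (limit_field \<gamma>)"
  unfolding eq_up_to_null_def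
proof (intro conjI ballI)
  fix A assume "A \<in> inv_field (id :: 'x \<times> 'g \<Rightarrow> _)"
  from invariant_event_in_limit_field[OF this \<gamma> \<nu>]
  show "\<exists>B\<in>limit_field \<gamma>. sym_diff A B \<in> null_sets (P z)" .
next
  fix B assume B: "B \<in> limit_field \<gamma>"
  from limit_field_event_invariant[OF \<gamma> B] obtain A where
    A: "A \<in> inv_field id" "AE \<omega> in P z. \<omega> \<in> A \<longleftrightarrow> \<omega> \<in> B" by blast
  moreover have "B \<in> sets (P z)" using limit_field_subset[OF \<gamma>] B by blast
  ultimately show "\<exists>A\<in>inv_field id. sym_diff A B \<in> null_sets (P z)"
    using sym_diff_null_iff[OF inv_field_sets] by blast
qed

end


section \<open>Diffusions\<close>

lemma natural_filtration_eq: "0 \<le> t \<Longrightarrow> natural_filtration (ennreal t) = observed id {0..t}"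
  unfolding natural_filtration_def by (rule arg_cong[where f="observed id"]) auto

lemma filtration_natural: "filtration paths (natural_filtration :: ennreal \<Rightarrow> (real \<Rightarrow> 'z::topological_space) measure)"
proof
  fix i j :: ennreal assume "i \<le> j"
  then show "sets (natural_filtration i) \<subseteq> sets (natural_filtration j :: (real \<Rightarrow> 'z) measure)"
    unfolding natural_filtration_def by (intro sets_observed_mono) (auto intro: order_trans)
qed (simp add: natural_filtration_def)

text \<open>
  A constant time is a stopping time, and \<open>C\<close> belongs to its past; integrating the conditional
  probability over \<open>C\<close> removes the conditional expectation from the Markov property.
\<close>

lemma strong_markov_fixed_time:
  fixes P :: "'z::{second_countable_topology,t2_space} \<Rightarrow> (real \<Rightarrow> 'z) measure"
  assumes reg: "regular_space (euclidean :: 'z topology)" and P: "strong_markov P"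
    and t: "0 \<le> t" and C: "C \<in> sets (observed id {0..t})" and B: "B \<in> sets path_space"
  shows "measure (P z) (C \<inter> (shift t -` B \<inter> paths)) = (\<integral>\<omega>. indicator C \<omega> * measure (P (\<omega> t)) B \<partial>P z)"
proof -
  interpret filtration paths "natural_filtration :: ennreal \<Rightarrow> (real \<Rightarrow> 'z) measure" by (rule filtration_natural)
  have ker: "P \<in> borel \<rightarrow>\<^sub>M prob_algebra path_space" using P by (simp add: strong_markov_def)
  have prob: "prob_space (P z)" and sets: "sets (P z) = sets path_space"
    using measurable_space[OF ker, of z] by (auto simp: space_prob_algebra)
  interpret prob_space "P z" by (rule prob)
  note obs = sets_path_space_eq_observed[OF reg]
  have sp: "space (P z) = paths" using sets_eq_imp_space_eq[OF sets] by simp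
  define T where "T = (\<lambda>\<omega> :: real \<Rightarrow> 'z. ennreal t)"
  have T: "stopping_time natural_filtration T" unfolding T_def by (rule stopping_time_const)
  have CT: "C \<in> sets (pre_sigma T)"
  proof (rule sets_pre_sigmaI[OF T])
    fix s show "{\<omega> \<in> C. T \<omega> \<le> s} \<in> sets (natural_filtration s)"
    proof (cases "ennreal t \<le> s")
      case True
      then have "sets (natural_filtration (ennreal t)) \<subseteq> sets (natural_filtration s :: (real \<Rightarrow> 'z) measure)"
        by (rule sets_F_mono)
      then show ?thesis using C True by (auto simp: T_def natural_filtration_eq[OF t])
    qed (simp add: T_def)
  qed
  have "sets (pre_sigma T) \<subseteq> sets (P z)"
  proof
    fix A assume "A \<in> sets (pre_sigma T)"
    from sets_pre_sigmaD[OF T this, of "ennreal t"] have "A \<in> sets (observed id {0..t})"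
      by (simp add: T_def natural_filtration_eq[OF t])
    then show "A \<in> sets (P z)"
      using sets_observed_mono[of "{0..t}" "{0..}" "id :: 'z \<Rightarrow> 'z"] by (auto simp: sets obs)
  qed
  then have sub: "subalgebra (P z) (pre_sigma T)" by (simp add: subalgebra_def sp space_pre_sigma)
  interpret S: finite_measure_subalgebra "P z" "pre_sigma T" by unfold_locales (rule sub)
  have Cs: "C \<in> sets (P z)" using CT sub by (auto simp: subalgebra_def)
  let ?E = "shift t -` B \<inter> paths"
  have "shift t \<in> observed id {0..} \<rightarrow>\<^sub>M observed (id :: 'z \<Rightarrow> 'z) {0..}"
    by (rule measurable_shift) (use t in auto)
  from measurable_sets[OF this, of B] B have E: "?E \<in> sets (P z)" by (simp add: sets obs)
  have Eeq: "{\<omega> \<in> paths. T \<omega> < \<infinity> \<and> shift (enn2real (T \<omega>)) \<omega> \<in> B} = ?E"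
    using t by (auto simp: T_def)
  have AE: "AE \<omega> in P z. real_cond_exp (P z) (pre_sigma T) (indicator ?E) \<omega> = measure (P (\<omega> t)) B"
  proof -
    have "AE \<omega> in P z. T \<omega> < \<infinity> \<longrightarrow>
           real_cond_exp (P z) (pre_sigma T)
             (indicator {\<omega> \<in> paths. T \<omega> < \<infinity> \<and> shift (enn2real (T \<omega>)) \<omega> \<in> B}) \<omega>
           = measure (P (\<omega> (enn2real (T \<omega>)))) B"
      using P T B unfolding strong_markov_def by blast
    then show ?thesis unfolding Eeq using t by (simp add: T_def)
  qed
  have int: "integrable (P z) (indicator ?E :: _ \<Rightarrow> real)" using E by (simp add: emeasure_eq_measure)
  have cm: "(\<lambda>\<omega>. \<omega> t) \<in> P z \<rightarrow>\<^sub>M borel"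
    using coordinate_measurable[of t "{0..}" "id :: 'z \<Rightarrow> 'z"] t
    by (simp add: measurable_cong_sets[OF sets refl] measurable_cong_sets[OF obs refl])
  have m: "(\<lambda>\<omega>. measure (P (\<omega> t)) B) \<in> borel_measurable (P z)"
    by (rule measurable_compose[OF measurable_compose[OF cm ker] measurable_measure_prob_algebra[OF B]])
  have "measure (P z) (C \<inter> ?E) = (\<integral>\<omega>. indicator (C \<inter> ?E) \<omega> \<partial>P z)"
    using Cs E by (simp add: sp) (metis Int_absorb2 inf_assoc inf_le2)
  also have "\<dots> = set_lebesgue_integral (P z) C (indicator ?E)"
    by (simp add: set_lebesgue_integral_def indicator_inter_arith)
  also have "\<dots> = set_lebesgue_integral (P z) C (real_cond_exp (P z) (pre_sigma T) (indicator ?E))"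
    by (rule S.real_cond_exp_intA[OF int CT])
  also have "\<dots> = (\<integral>\<omega>. indicator C \<omega> * measure (P (\<omega> t)) B \<partial>P z)"
    unfolding set_lebesgue_integral_def
  proof (rule integral_cong_AE)
    show "(\<lambda>\<omega>. indicator C \<omega> *\<^sub>R real_cond_exp (P z) (pre_sigma T) (indicator ?E) \<omega>) \<in> borel_measurable (P z)"
      using Cs by (intro borel_measurable_scaleR borel_measurable_indicator borel_measurable_cond_exp2)
    show "(\<lambda>\<omega>. indicator C \<omega> * measure (P (\<omega> t)) B) \<in> borel_measurable (P z)"
      using Cs m by (intro borel_measurable_times borel_measurable_indicator)
    show "AE \<omega> in P z. indicator C \<omega> *\<^sub>R real_cond_exp (P z) (pre_sigma T) (indicator ?E) \<omega>
        = indicator C \<omega> * measure (P (\<omega> t)) B"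
      using AE by eventually_elim simp
  qed
  finally show ?thesis .
qed

text \<open>
  The support of \<open>act G h f\<close> is contained in the image of the support of \<open>f\<close> under the inverse
  translation, which is compact.
\<close>

lemma (in topological_group) test_function_act:
  fixes MX :: "('x::{second_countable_topology,t2_space}, 'm::euclidean_space) manifold"
    and MG :: "('g, 'n::euclidean_space) manifold"
  assumes MX: "smooth_manifold MX" and MG: "lie_group G MG"
    and f: "test_function (product_manifold MX MG) f"
  shows "test_function (product_manifold MX MG) (act G h f)"
  unfolding test_function_def
proof
  show "smooth_function (product_manifold MX MG) (act G h f)"
    using f by (intro smooth_function_act[OF MX MG]) (simp add: test_function_def)
  define \<tau> where "\<tau> = (\<lambda>z :: 'x \<times> 'g. (fst z, inv h \<otimes> snd z))"
  let ?K = "closure {z. f z \<noteq> 0}"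
  have "continuous_on UNIV \<tau>"
    unfolding \<tau>_def
    by (intro continuous_on_Pair continuous_on_fst continuous_on_id
        continuous_on_compose2[OF lie_group_translation_continuous(1)[OF MG] continuous_on_snd]) simp_all
  moreover have "compact ?K" using f by (simp add: test_function_def)
  ultimately have K: "compact (\<tau> ` ?K)" by (intro compact_continuous_image) (auto intro: continuous_on_subset)
  have "{z. act G h f z \<noteq> 0} \<subseteq> \<tau> ` ?K"
  proof
    fix z assume "z \<in> {z. act G h f z \<noteq> 0}"
    then have "f (fst z, h \<otimes> snd z) \<noteq> 0" by (simp add: act_def split_beta)
    then have "(fst z, h \<otimes> snd z) \<in> ?K" by (intro subsetD[OF closure_subset]) simp
    moreover have "z = \<tau> (fst z, h \<otimes> snd z)" by (simp add: \<tau>_def m_assoc[symmetric])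
    ultimately show "z \<in> \<tau> ` ?K" by (rule rev_image_eqI)
  qed
  then have "closure {z. act G h f z \<noteq> 0} \<subseteq> \<tau> ` ?K"
    by (rule closure_minimal) (rule compact_imp_closed[OF K])
  then show "compact (closure {z. act G h f z \<noteq> 0})"
    using compact_Int_closed[OF K closed_closure] by (metis inf.absorb_iff2)
qed

text \<open>
  Translations respect the filtration, so integrals over events of the past transform into integrals
  over events of the past.
\<close>

lemma (in topological_group) martingale_translate:
  fixes Q :: "(real \<Rightarrow> 'x::second_countable_topology \<times> 'g) measure"
  assumes sets: "sets path_space = sets (observed (id :: 'x \<times> 'g \<Rightarrow> _) {0..})"
    and Q: "prob_space Q" "sets Q = sets path_space"
    and M: "\<And>t. 0 \<le> t \<Longrightarrow> M t \<in> borel_measurable (natural_filtration (ennreal t))"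
    and M': "martingale Q natural_filtration M'"
    and eq: "\<And>t \<omega>. 0 \<le> t \<Longrightarrow> \<omega> \<in> paths \<Longrightarrow> M t (transl h \<omega>) = M' t \<omega>"
  shows "martingale (distr Q path_space (transl h)) natural_filtration M"
proof -
  let ?Q = "distr Q path_space (transl h)"
  interpret Q: prob_space Q by (rule Q(1))
  have sp: "space Q = paths" using sets_eq_imp_space_eq[OF Q(2)] by simp
  have T: "transl h \<in> Q \<rightarrow>\<^sub>M path_space"
    using translate_measurable[of "{0..}" h] by (simp add: measurable_cong_sets[OF Q(2) sets] measurable_cong_sets[OF sets refl])
  interpret TQ: prob_space ?Q by (rule Q.prob_space_distr[OF T])
  have sub: "subalgebra R (natural_filtration t)"
    if "sets R = sets path_space" "space R = paths" for R :: "(real \<Rightarrow> 'x \<times> 'g) measure" and t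
    using that sets_observed_mono[of "{s. 0 \<le> s \<and> ennreal s \<le> t}" "{0..}" "id :: 'x \<times> 'g \<Rightarrow> _"]
    by (auto simp: subalgebra_def natural_filtration_def sets)
  have Mm: "M t \<in> borel_measurable path_space" if "0 \<le> t" for t
    using measurable_from_subalg[OF sub[OF refl space_path_space] M[OF that]] .
  have cong: "integrable Q (\<lambda>\<omega>. M t (transl h \<omega>)) \<longleftrightarrow> integrable Q (M' t)" if "0 \<le> t" for t
    by (rule Bochner_Integration.integrable_cong[OF refl]) (simp add: sp eq that)
  have int: "integrable ?Q (M t)" if "0 \<le> t" for t
    unfolding integrable_distr_eq[OF T Mm[OF that]] cong[OF that]
    using M' that by (simp add: martingale_def)
  show ?thesis
    unfolding martingale_def
  proof (intro conjI allI impI)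
    fix s t :: real assume st: "0 \<le> s \<and> s \<le> t"
    then have s: "0 \<le> s" and t: "0 \<le> t" by auto
    let ?F = "natural_filtration (ennreal s) :: (real \<Rightarrow> 'x \<times> 'g) measure"
    interpret TF: finite_measure_subalgebra ?Q ?F by unfold_locales (rule sub, simp_all)
    interpret QF: finite_measure_subalgebra Q ?F by unfold_locales (rule sub, simp_all add: Q sp)
    show "AE \<omega> in ?Q. real_cond_exp ?Q ?F (M t) \<omega> = M s \<omega>"
    proof (rule TF.real_cond_exp_charact)
      show "integrable ?Q (M t)" "integrable ?Q (M s)" using int s t by auto
      show "M s \<in> borel_measurable ?F" by (rule M[OF s])
      fix A assume A: "A \<in> sets ?F"
      have Ap: "A \<in> sets path_space" using sub[OF refl space_path_space] A by (auto simp: subalgebra_def)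
      let ?A = "transl h -` A \<inter> paths"
      have A': "?A \<in> sets ?F"
        using measurable_sets[OF translate_measurable[of "{0..s}" h], of A] A by (simp add: natural_filtration_eq[OF s])
      have tr: "set_lebesgue_integral ?Q A (M u) = set_lebesgue_integral Q ?A (M' u)" if u: "0 \<le> u" for u
      proof -
        have "set_lebesgue_integral ?Q A (M u) = (\<integral>\<omega>. indicator A (transl h \<omega>) *\<^sub>R M u (transl h \<omega>) \<partial>Q)"
          unfolding set_lebesgue_integral_def using Ap Mm[OF u]
          by (intro integral_distr[OF T]) (intro borel_measurable_scaleR borel_measurable_indicator)
        also have "\<dots> = set_lebesgue_integral Q ?A (M' u)"
          unfolding set_lebesgue_integral_def
          by (rule Bochner_Integration.integral_cong[OF refl]) (simp add: sp eq[OF u] indicator_def)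
        finally show ?thesis .
      qed
      have "set_lebesgue_integral Q ?A (M' t) = set_lebesgue_integral Q ?A (real_cond_exp Q ?F (M' t))"
        by (rule QF.real_cond_exp_intA[OF _ A']) (use M' t in \<open>simp add: martingale_def\<close>)
      also have "\<dots> = set_lebesgue_integral Q ?A (M' s)"
        unfolding set_lebesgue_integral_def
      proof (rule integral_cong_AE)
        have A'Q: "?A \<in> sets Q" using A' sub[of Q "ennreal s"] Q sp by (auto simp: subalgebra_def)
        show "(\<lambda>\<omega>. indicator ?A \<omega> *\<^sub>R real_cond_exp Q ?F (M' t) \<omega>) \<in> borel_measurable Q"
          using A'Q by (intro borel_measurable_scaleR borel_measurable_indicator borel_measurable_cond_exp2)
        have "M' s \<in> borel_measurable Q" using M' s by (auto simp: martingale_def)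
        then show "(\<lambda>\<omega>. indicator ?A \<omega> *\<^sub>R M' s \<omega>) \<in> borel_measurable Q"
          using A'Q by (intro borel_measurable_scaleR borel_measurable_indicator)
        have "AE \<omega> in Q. real_cond_exp Q ?F (M' t) \<omega> = M' s \<omega>" using M' st by (simp add: martingale_def)
        then show "AE \<omega> in Q. indicator ?A \<omega> *\<^sub>R real_cond_exp Q ?F (M' t) \<omega> = indicator ?A \<omega> *\<^sub>R M' s \<omega>"
          by eventually_elim simp
      qed
      finally show "set_lebesgue_integral ?Q A (M t) = set_lebesgue_integral ?Q A (M s)"
        using tr s t by simp
    qed
  qed (use int M in auto)
qed

text \<open>
  The translated law solves the martingale problem started at the translated point: for a test
  function \<open>f\<close> its martingale, evaluated on a translated path, is the martingale of \<open>act G h f\<close>, by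
  equivariance of the generator.  Uniqueness of the solution does the rest.
\<close>

lemma (in topological_group) diffusion_equivariant:
  fixes MX :: "('x::{second_countable_topology,t2_space}, 'm::euclidean_space) manifold"
    and MG :: "('g, 'n::euclidean_space) manifold"
  assumes sets: "sets path_space = sets (observed (id :: 'x \<times> 'g \<Rightarrow> _) {0..})"
    and MX: "smooth_manifold MX" and MG: "lie_group G MG"
    and P: "diffusion (product_manifold MX MG) L P"
    and L: "equivariance G (product_manifold MX MG) L"
  shows "distr (P (x, g)) path_space (transl h) = P (x, h \<otimes> g)"
proof -
  let ?M = "product_manifold MX MG" and ?Q = "distr (P (x, g)) path_space (transl h)"
  have mp: "solves_martingale_problem ?M L z (P z)" for z using P unfolding diffusion_def by blast
  have prob: "prob_space (P z)" and setsP: "sets (P z) = sets path_space" for z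
    using mp[of z] by (auto simp: solves_martingale_problem_def)
  have T: "transl h \<in> P (x, g) \<rightarrow>\<^sub>M path_space"
    using translate_measurable[of "{0..}" h] by (simp add: measurable_cong_sets[OF setsP sets] measurable_cong_sets[OF sets refl])
  have "solves_martingale_problem ?M L (x, h \<otimes> g) ?Q"
    unfolding solves_martingale_problem_def
  proof (intro conjI allI impI)
    show "prob_space ?Q" by (rule prob_space.prob_space_distr[OF prob T])
    show "sets ?Q = sets path_space" by simp
    have c0: "(\<lambda>\<omega>. \<omega> 0) \<in> path_space \<rightarrow>\<^sub>M (borel :: ('x \<times> 'g) measure)"
      using coordinate_measurable[of 0 "{0..}" "id :: 'x \<times> 'g \<Rightarrow> _"] by (simp add: measurable_cong_sets[OF sets refl])
    have "{\<omega> \<in> space path_space. \<omega> 0 = (x, h \<otimes> g)} \<in> sets path_space"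
      using measurable_sets[OF c0, of "{(x, h \<otimes> g)}"] by (simp add: vimage_def Int_def conj_commute)
    then have "(AE \<omega> in ?Q. \<omega> 0 = (x, h \<otimes> g)) \<longleftrightarrow> (AE \<omega> in P (x, g). transl h \<omega> 0 = (x, h \<otimes> g))"
      by (rule AE_distr_iff[OF T])
    moreover have "AE \<omega> in P (x, g). \<omega> 0 = (x, g)"
      using mp[of "(x, g)"] by (simp add: solves_martingale_problem_def)
    then have "AE \<omega> in P (x, g). transl h \<omega> 0 = (x, h \<otimes> g)" by eventually_elim simp
    ultimately show "AE \<omega> in ?Q. \<omega> 0 = (x, h \<otimes> g)" by (simp only:)
    fix f assume f: "test_function ?M f"
    let ?N = "\<lambda>f t \<omega>. f (\<omega> t) - f (\<omega> 0) - (LINT s:{0..t}|lborel. L f (\<omega> s))"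
    have Lf: "L (act G h f) = act G h (L f)" using L f by (simp add: equivariance_def test_function_def)
    have mart: "martingale (P z) natural_filtration (?N f)" if "test_function ?M f" for f z
      using mp[of z] that by (simp add: solves_martingale_problem_def)
    show "martingale ?Q natural_filtration (?N f)"
    proof (rule martingale_translate[OF sets prob setsP])
      show "martingale (P (x, g)) natural_filtration (?N (act G h f))"
        by (rule mart[OF test_function_act[OF MX MG f]])
      show "?N f t \<in> borel_measurable (natural_filtration (ennreal t))" if "0 \<le> t" for t
        using mart[OF f, of "(x, g)"] that by (simp add: martingale_def)
      fix t :: real and \<omega> :: "real \<Rightarrow> 'x \<times> 'g" assume t: "0 \<le> t"
      have "(LINT s:{0..t}|lborel. L f (transl h \<omega> s)) = (LINT s:{0..t}|lborel. L (act G h f) (\<omega> s))"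
        unfolding Lf by (intro set_lebesgue_integral_cong) (auto simp: act_def split_beta)
      then show "?N f t (transl h \<omega>) = ?N (act G h f) t \<omega>"
        using t by (simp add: act_def split_beta)
    qed
  qed
  then show ?thesis using P unfolding diffusion_def by blast
qed

theorem theoremA:
  fixes MX :: "('x::{second_countable_topology,t2_space}, 'm::euclidean_space) manifold"
    and G :: "'g::{second_countable_topology,t2_space} monoid"
    and MG :: "('g, 'n::euclidean_space) manifold"
    and L :: "('x \<times> 'g \<Rightarrow> real) \<Rightarrow> 'x \<times> 'g \<Rightarrow> real"
    and P :: "'x \<times> 'g \<Rightarrow> (real \<Rightarrow> 'x \<times> 'g) measure"
    and \<Lambda> :: "'s measure"
    and ell :: "(real \<Rightarrow> 'x \<times> 'g) \<Rightarrow> 's"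
    and glim :: "(real \<Rightarrow> 'x \<times> 'g) \<Rightarrow> 'g"
    and x :: 'x and g :: 'g
  assumes "smooth_manifold MX"
    and "lie_group G MG"
    and "connected (UNIV :: 'g set)"
    and "diffusion (product_manifold MX MG) L P"
    and "devissage MX P \<Lambda> ell"
    and "convergence P"
    and "equivariance G (product_manifold MX MG) L"
    and "regularity P"
    and "is_group_limit (P (x, g)) glim"
  shows "eq_up_to_null (P (x, g))
           (inv_field id)
           (sigma_sets paths (inv_field fst \<union> sets (vimage_algebra paths glim borel)))"
proof -
  have MG: "smooth_manifold MG" and grp: "group G" and UN: "carrier G = UNIV"
    using assms(2) by (auto simp: lie_group_def)
  have regX: "regular_space (euclidean :: 'x topology)" by (rule manifold_regular_space[OF assms(1)])
  have regG: "regular_space (euclidean :: 'g topology)" by (rule manifold_regular_space[OF MG])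
  have "regular_space (prod_topology (euclidean :: 'x topology) (euclidean :: 'g topology))"
    by (simp only: regular_space_prod_topology regX regG simp_thms)
  then have reg: "regular_space (euclidean :: ('x \<times> 'g) topology)" by (simp only: prod_topology_euclidean)
  interpret topological_group G
    using grp UN lie_group_continuous[OF assms(2)]
    by (intro topological_group.intro topological_group_axioms.intro)
  have sm: "strong_markov P" and mp: "\<And>z. solves_martingale_problem (product_manifold MX MG) L z (P z)"
    using assms(4) unfolding diffusion_def by blast+
  have setsP: "sets (P z) = sets path_space" for z using mp[of z] by (simp add: solves_martingale_problem_def)
  have spP: "space (P z) = paths" for z using sets_eq_imp_space_eq[OF setsP[of z]] by simp
  interpret equivariant_markov_family G P
  proof
    show "regular_space (euclidean :: 'x topology)" "regular_space (euclidean :: 'g topology)" by (fact regX regG)+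
    show "\<exists>U. open U \<and> k \<in> U \<and> compact (closure U)" for k :: 'g by (rule manifold_compact_closure[OF MG])
    show "P \<in> borel \<rightarrow>\<^sub>M prob_algebra path_space" using sm by (simp add: strong_markov_def)
    show "AE \<omega> in P z. \<omega> 0 = z" for z using mp[of z] by (simp add: solves_martingale_problem_def)
    show "distr (P (x, g)) path_space (transl h) = P (x, h \<otimes>\<^bsub>G\<^esub> g)" for x g h
      by (rule diffusion_equivariant[OF sets_path_space_eq_observed[OF reg] assms(1,2,4,7)])
    show "continuous_on UNIV H" if "harmonic P H" for H using assms(8) that by (simp add: regularity_def)
    show "AE \<omega> in P z. \<omega> \<in> conv_paths" for z
    proof -
      obtain \<gamma> where "is_group_limit (P z) \<gamma>" using assms(6) unfolding convergence_def by blast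
      then have "AE \<omega> in P z. ((\<lambda>t. snd (\<omega> t)) \<longlongrightarrow> \<gamma> \<omega>) at_top" by (simp add: is_group_limit_def)
      with AE_space show ?thesis by eventually_elim (auto simp: conv_paths_def spP)
    qed
  qed (rule strong_markov_fixed_time[OF reg sm])
  obtain \<nu> :: "'g measure" where \<nu>: "prob_space \<nu>" "sets \<nu> = sets borel"
    "\<And>U. open U \<Longrightarrow> U \<noteq> {} \<Longrightarrow> U \<notin> null_sets \<nu>"
    "\<And>N g. N \<in> null_sets \<nu> \<Longrightarrow> {k. k \<otimes>\<^bsub>G\<^esub> g \<in> N} \<in> null_sets \<nu>"
    using quasi_invariant_measure[OF assms(2)] by metis
  have "eq_up_to_null (P (x, g)) (inv_field id) (limit_field glim)"
  proof (rule invariant_field_eq_limit_field[OF assms(9) \<nu>(1,2)])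
    show "{k. k \<otimes>\<^bsub>G\<^esub> g \<in> N} \<in> null_sets \<nu>" if "N \<in> null_sets \<nu>" for N g using that by (rule \<nu>(4))
    show "U \<notin> null_sets \<nu>" if "open U" "U \<noteq> {}" for U using that by (rule \<nu>(3))
  qed
  then show ?thesis by (simp only: limit_field_def)
qed

end
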